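(* Let $\mathcal{G}$ be a countable projective Fraïssé family in a language $L_0$, let $\mathbb{P}$ be the projective Fraïssé limit of $\mathcal{G}$, and let $H$ be a closed subspace of $\mathrm{Aut}(\mathbb{P})$ that is invariant under conjugation by elements of $\mathrm{Aut}(\mathbb{P})$. Let $$\mathcal{F}=\{(A,s^A)\colon A\in\mathcal{G}\text{ and there are an epimorphism }\phi\colon\mathbb{P}\to A\text{ and } f\in H\text{ such that }\phi\colon(\mathbb{P},f)\to(A,s^A)\text{ is an epimorphism}\}.$$ Then $\mathcal{F}$ has the joint projection property (JPP) and the weak amalgamation property (WAP) if and only if the conjugation action of $\mathrm{Aut}(\mathbb{P})$ on $H$ has a comeager orbit.
   Context: Given a language $L$ of relation symbols and function symbols, a topological $L$-structure is a compact zero-dimensional second-countable space $A$ equipped with closed relations $q^A$ and continuous functions $f^A$ interpreting the symbols. An epimorphism $\phi\colon B\to A$ is a continuous surjection such that for each function symbol $f$ of arity $n$ and $x_1,\dots,x_n\in B$, $f^A(\phi(x_1),\dots,\phi(x_n))=\phi(f^B(x_1,\dots,x_n))$, and for each relation symbol $q$ of arity $m$ and $x_1,\dots,x_m\in A$, $q^A(x_1,\dots,x_m)$ holds iff there are $y_1,\dots,y_m\in B$ with $\phi(y_i)=x_i$ for all $i$ and $q^B(y_1,\dots,y_m)$. An isomorphism is a bijective epimorphism. A family of finite topological $L$-structures has the JPP if for any $A,B$ in it there are $C$ in it and epimorphisms from $C$ onto $A$ and from $C$ onto $B$. It has the AP if for any $A,B_1,B_2$ in it and epimorphisms $\phi_1\colon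 B_1\to A$, $\phi_2\colon B_2\to A$, there are $C$ in it and epimorphisms $\phi_3\colon C\to B_1$, $\phi_4\colon C\to B_2$ with $\phi_1\circ\phi_3=\phi_2\circ\phi_4$. It has the WAP if for every $A$ in it there are $B$ in it and an epimorphism $\phi\colon B\to A$ such that for any $C_1,C_2$ in it and any epimorphisms $\phi_1\colon C_1\to B$, $\phi_2\colon C_2\to B$ there are $D$ in it and epimorphisms $\phi_3\colon D\to C_1$, $\phi_4\colon D\to C_2$ with $\phi\circ\phi_1\circ\phi_3=\phi\circ\phi_2\circ\phi_4$. A projective Fraïssé family is a family of finite topological structures having the JPP and the AP. A projective Fraïssé limit of $\mathcal{G}$ (it exists and is unique up to isomorphism for countable $\mathcal G$) is a topological $L_0$-structure $\mathbb{P}$ such that (L1) for every $A\in\mathcal{G}$ there is an epimorphism $\mathbb{P}\to A$; (L2) for every finite discrete space $X$ and continuous $f\colon\mathbb{P}\to X$ there are $A\in\mathcal{G}$, an epimorphism $\phi\colon\mathbb{P}\to A$ and a function $f_0\colon A\to X$ with $f=f_0\circ\phi$; (L3) for every $A\in\mathcal{G}$ and epimorphisms $\phi_1,\phi_2\colon\mathbb{P}\to A$ there is an isomorphism $\psi\colon\mathbb{P}\to\mathbb{P}$ with $\phi_2=\phi_1\circ\psi$. $\mathrm{Aut}(\mathbb{P})$ is the group of isomorphisms $\mathbb{P}\to\mathbb{P}$, with the topology inherited from the homeomorphism group of $\mathbb{P}$ with the compact-open topology. It acts on itself by conjugation $h\mapsto ghg^{-1}$, and $H$ carries the subspace topology.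 Let $s$ be a binary relation symbol not in $L_0$. Structures $(A,s^A)$, with $A$ a topological $L_0$-structure and $s^A$ a binary relation on $A$, are viewed as $L_0\cup\{s\}$-structures. For $f\in\mathrm{Aut}(\mathbb{P})$, $(\mathbb{P},f)$ denotes the $L_0\cup\{s\}$-structure in which $s^{\mathbb{P}}(x,y)$ iff $f(x)=y$. The JPP and WAP for $\mathcal{F}$ are with respect to epimorphisms of $L_0\cup\{s\}$-structures.
   Formalization: The closed invariant subspace H is assumed nonempty: for empty H the family F is empty, so it has the JPP and the WAP vacuously, while the action on H has no orbit, and the stated equivalence fails. *)

theory Defs
  imports "HOL-Analysis.Analysis" "HOL-Algebra.Group_Action"
begin

section \<open>Topological structures\<close>

record ('f, 'r) language =
  funs :: "'f set"
  rels :: "'r set"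
  far :: "'f \<Rightarrow> nat"
  rar :: "'r \<Rightarrow> nat"

text \<open>The interpretations of symbols outside the language, and of functions at tuples outside the
  carrier, are irrelevant: nothing below depends on them.\<close>

record ('a, 'f, 'r) lstruct =
  Top :: "'a topology"
  Fun :: "'f \<Rightarrow> (nat \<Rightarrow> 'a) \<Rightarrow> 'a"
  Rel :: "'r \<Rightarrow> (nat \<Rightarrow> 'a) set"

abbreviation Carrier :: "('a, 'f, 'r, 'm) lstruct_scheme \<Rightarrow> 'a set"
  where "Carrier A \<equiv> topspace (Top A)"

text \<open>An \<open>n\<close>-tuple is a function that is extensional on \<open>{..<n}\<close>, so that the power
  \<open>A\<^sup>n\<close> is the library's product topology.\<close>

definition power_top :: "'a topology \<Rightarrow> nat \<Rightarrow> (nat \<Rightarrow> 'a) topology"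
  where "power_top X n = product_topology (\<lambda>_. X) {..<n}"

definition tuples :: "'a set \<Rightarrow> nat \<Rightarrow> (nat \<Rightarrow> 'a) set"
  where "tuples S n = {..<n} \<rightarrow>\<^sub>E S"

lemma topspace_power_top: "topspace (power_top X n) = tuples (topspace X) n"
  by (simp add: power_top_def tuples_def)

definition topological_structure :: "('f, 'r) language \<Rightarrow> ('a, 'f, 'r) lstruct \<Rightarrow> bool"
  where "topological_structure L A \<longleftrightarrow>
    compact_space (Top A) \<and> Hausdorff_space (Top A) \<and> Top A dim_le 0 \<and>
    second_countable (Top A) \<and>
    (\<forall>q\<in>rels L. closedin (power_top (Top A) (rar L q)) (Rel A q)) \<and>
    (\<forall>f\<in>funs L. continuous_map (power_top (Top A) (far L f)) (Top A) (Fun A f))"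

text \<open>The term \<open>compose {..<n} \<phi> x\<close> is the tuple \<open>(\<phi>(x\<^sub>1), \<dots>, \<phi>(x\<^sub>n))\<close>.\<close>

definition epimorphism ::
  "('f, 'r) language \<Rightarrow> ('b, 'f, 'r) lstruct \<Rightarrow> ('a, 'f, 'r) lstruct \<Rightarrow> ('b \<Rightarrow> 'a) \<Rightarrow> bool"
  where "epimorphism L B A \<phi> \<longleftrightarrow>
    continuous_map (Top B) (Top A) \<phi> \<and> \<phi> ` Carrier B = Carrier A \<and>
    (\<forall>f\<in>funs L. \<forall>x\<in>tuples (Carrier B) (far L f).
       Fun A f (compose {..<far L f} \<phi> x) = \<phi> (Fun B f x)) \<and>
    (\<forall>q\<in>rels L. \<forall>x\<in>tuples (Carrier A) (rar L q).
       x \<in> Rel A q \<longleftrightarrow>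
       (\<exists>y\<in>tuples (Carrier B) (rar L q). compose {..<rar L q} \<phi> y = x \<and> y \<in> Rel B q))"

definition isomorphism ::
  "('f, 'r) language \<Rightarrow> ('b, 'f, 'r) lstruct \<Rightarrow> ('a, 'f, 'r) lstruct \<Rightarrow> ('b \<Rightarrow> 'a) \<Rightarrow> bool"
  where "isomorphism L B A \<phi> \<longleftrightarrow>
    epimorphism L B A \<phi> \<and> bij_betw \<phi> (Carrier B) (Carrier A)"

section \<open>Projective Fraisse families and their limits\<close>

definition JPP :: "('f, 'r) language \<Rightarrow> ('a, 'f, 'r) lstruct set \<Rightarrow> bool"
  where "JPP L G \<longleftrightarrow>
    (\<forall>A\<in>G. \<forall>B\<in>G. \<exists>C\<in>G. (\<exists>\<phi>. epimorphism L C A \<phi>) \<and> (\<exists>\<psi>. epimorphism L C B \<psi>))"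

definition AP :: "('f, 'r) language \<Rightarrow> ('a, 'f, 'r) lstruct set \<Rightarrow> bool"
  where "AP L G \<longleftrightarrow>
    (\<forall>A\<in>G. \<forall>B1\<in>G. \<forall>B2\<in>G. \<forall>\<phi>1 \<phi>2.
       epimorphism L B1 A \<phi>1 \<and> epimorphism L B2 A \<phi>2 \<longrightarrow>
       (\<exists>C\<in>G. \<exists>\<phi>3 \<phi>4. epimorphism L C B1 \<phi>3 \<and> epimorphism L C B2 \<phi>4 \<and>
          (\<forall>x\<in>Carrier C. \<phi>1 (\<phi>3 x) = \<phi>2 (\<phi>4 x))))"

definition WAP :: "('f, 'r) language \<Rightarrow> ('a, 'f, 'r) lstruct set \<Rightarrow> bool"
  where "WAP L G \<longleftrightarrow>
    (\<forall>A\<in>G. \<exists>B\<in>G. \<exists>\<phi>. epimorphism L B A \<phi> \<and>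
       (\<forall>C1\<in>G. \<forall>C2\<in>G. \<forall>\<phi>1 \<phi>2.
          epimorphism L C1 B \<phi>1 \<and> epimorphism L C2 B \<phi>2 \<longrightarrow>
          (\<exists>D\<in>G. \<exists>\<phi>3 \<phi>4. epimorphism L D C1 \<phi>3 \<and> epimorphism L D C2 \<phi>4 \<and>
             (\<forall>x\<in>Carrier D. \<phi> (\<phi>1 (\<phi>3 x)) = \<phi> (\<phi>2 (\<phi>4 x))))))"

definition projective_Fraisse_family :: "('f, 'r) language \<Rightarrow> ('a, 'f, 'r) lstruct set \<Rightarrow> bool"
  where "projective_Fraisse_family L G \<longleftrightarrow>
    (\<forall>A\<in>G. topological_structure L A \<and> finite (Carrier A)) \<and> JPP L G \<and> AP L G"

text \<open>Countability of a family of structures is understood up to isomorphism, so that families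
  closed under isomorphism qualify; every set \<open>G\<close> with \<open>countable G\<close> is included.\<close>

definition countable_family :: "('f, 'r) language \<Rightarrow> ('a, 'f, 'r) lstruct set \<Rightarrow> bool"
  where "countable_family L G \<longleftrightarrow>
    (\<exists>C. countable C \<and> C \<subseteq> G \<and> (\<forall>A\<in>G. \<exists>B\<in>C. \<exists>\<phi>. isomorphism L B A \<phi>))"

lemma countable_imp_countable_family:
  assumes "countable G"
  shows "countable_family L G"
proof -
  have id_tuple: "compose {..<n} (\<lambda>x. x) y = y" if "y \<in> tuples S n" for n S and y :: "nat \<Rightarrow> 'a"
    using that by (auto simp: tuples_def PiE_def compose_def extensional_def)
  have "isomorphism L A A (\<lambda>x. x)" for A :: "('a, 'b, 'c) lstruct"
    unfolding isomorphism_def epimorphism_def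
    using continuous_map_id[of "Top A"] by (auto simp: id_def id_tuple bij_betw_def)
  then show ?thesis
    unfolding countable_family_def using assms by blast
qed

text \<open>The finite discrete space \<open>X\<close> ranges over finite sets of natural numbers, which
  up to homeomorphism are all of them.\<close>

definition projective_Fraisse_limit ::
  "('f, 'r) language \<Rightarrow> ('a, 'f, 'r) lstruct set \<Rightarrow> ('p, 'f, 'r) lstruct \<Rightarrow> bool"
  where "projective_Fraisse_limit L G P \<longleftrightarrow>
    topological_structure L P \<and>
    (\<forall>A\<in>G. \<exists>\<phi>. epimorphism L P A \<phi>) \<and>
    (\<forall>X :: nat set. \<forall>f. finite X \<and> continuous_map (Top P) (discrete_topology X) f \<longrightarrow>
       (\<exists>A\<in>G. \<exists>\<phi> f0. epimorphism L P A \<phi> \<and> f0 \<in> Carrier A \<rightarrow> X \<and>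
          (\<forall>x\<in>Carrier P. f x = f0 (\<phi> x)))) \<and>
    (\<forall>A\<in>G. \<forall>\<phi>1 \<phi>2. epimorphism L P A \<phi>1 \<and> epimorphism L P A \<phi>2 \<longrightarrow>
       (\<exists>\<psi>. isomorphism L P P \<psi> \<and> (\<forall>x\<in>Carrier P. \<phi>2 x = \<phi>1 (\<psi> x))))"

section \<open>The automorphism group\<close>

text \<open>Self-maps of a space are taken extensional, as in \<^const>\<open>BijGroup\<close>, so that two maps which
  agree on the carrier are equal.\<close>

definition Homeo :: "'a topology \<Rightarrow> ('a \<Rightarrow> 'a) set"
  where "Homeo X = {f \<in> extensional (topspace X). homeomorphic_map X X f}"

definition Homeo_topology :: "'a topology \<Rightarrow> ('a \<Rightarrow> 'a) topology"
  where "Homeo_topology X =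
    topology_generated_by {{f \<in> Homeo X. f ` K \<subseteq> U} | K U. compactin X K \<and> openin X U}"

definition Aut :: "('f, 'r) language \<Rightarrow> ('p, 'f, 'r) lstruct \<Rightarrow> ('p \<Rightarrow> 'p) set"
  where "Aut L P = {f \<in> extensional (Carrier P). isomorphism L P P f}"

definition Aut_group :: "('f, 'r) language \<Rightarrow> ('p, 'f, 'r) lstruct \<Rightarrow> ('p \<Rightarrow> 'p) monoid"
  where "Aut_group L P = (BijGroup (Carrier P))\<lparr>carrier := Aut L P\<rparr>"

definition Aut_topology :: "('f, 'r) language \<Rightarrow> ('p, 'f, 'r) lstruct \<Rightarrow> ('p \<Rightarrow> 'p) topology"
  where "Aut_topology L P = subtopology (Homeo_topology (Top P)) (Aut L P)"

definition conj_action :: "('g, 'm) monoid_scheme \<Rightarrow> 'g \<Rightarrow> 'g \<Rightarrow> 'g"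
  where "conj_action \<Gamma> g h = g \<otimes>\<^bsub>\<Gamma>\<^esub> h \<otimes>\<^bsub>\<Gamma>\<^esub> inv\<^bsub>\<Gamma>\<^esub> g"

section \<open>Baire category\<close>

definition nowhere_dense_in :: "'a topology \<Rightarrow> 'a set \<Rightarrow> bool"
  where "nowhere_dense_in X S \<longleftrightarrow> S \<subseteq> topspace X \<and> X interior_of (X closure_of S) = {}"

definition meager_in :: "'a topology \<Rightarrow> 'a set \<Rightarrow> bool"
  where "meager_in X S \<longleftrightarrow>
    (\<exists>\<N>. countable \<N> \<and> (\<forall>N\<in>\<N>. nowhere_dense_in X N) \<and> S = \<Union>\<N>)"

definition comeager_in :: "'a topology \<Rightarrow> 'a set \<Rightarrow> bool"
  where "comeager_in X S \<longleftrightarrow> S \<subseteq> topspace X \<and> meager_in X (topspace X - S)"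

section \<open>Expansions by a binary relation\<close>

definition expand_language :: "('f, 'r) language \<Rightarrow> 'r \<Rightarrow> ('f, 'r) language"
  where "expand_language L s = L\<lparr>rels := insert s (rels L), rar := (rar L)(s := 2)\<rparr>"

definition expand ::
  "'r \<Rightarrow> ('a, 'f, 'r) lstruct \<Rightarrow> ('a \<times> 'a) set \<Rightarrow> ('a, 'f, 'r) lstruct"
  where "expand s A R =
    A\<lparr>Rel := (Rel A)(s := {t \<in> tuples (Carrier A) 2. (t 0, t 1) \<in> R})\<rparr>"

definition expand_fun ::
  "'r \<Rightarrow> ('p, 'f, 'r) lstruct \<Rightarrow> ('p \<Rightarrow> 'p) \<Rightarrow> ('p, 'f, 'r) lstruct"
  where "expand_fun s P f = expand s P {(x, y). x \<in> Carrier P \<and> y \<in> Carrier P \<and> f x = y}"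

definition induced_family ::
  "('f, 'r) language \<Rightarrow> 'r \<Rightarrow> ('a, 'f, 'r) lstruct set \<Rightarrow> ('p, 'f, 'r) lstruct \<Rightarrow>
    ('p \<Rightarrow> 'p) set \<Rightarrow> ('a, 'f, 'r) lstruct set"
  where "induced_family L s G P H =
    {expand s A R | A R. A \<in> G \<and> R \<subseteq> Carrier A \<times> Carrier A \<and>
       (\<exists>\<phi>. epimorphism L P A \<phi> \<and>
         (\<exists>f\<in>H. epimorphism (expand_language L s) (expand_fun s P f) (expand s A R) \<phi>))}"

end

theory Submission
  imports Defs
begin

text \<open>The cosets of the stabilizers \<open>V\<^sub>n = {g. \<epsilon>\<^sub>n \<circ> g = \<epsilon>\<^sub>n}\<close>, for a sequence of epimorphisms
  \<open>\<epsilon>\<^sub>n : P \<rightarrow> E\<^sub>n\<close> through which every continuous map to a finite space factors, are a base of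
  \<open>Aut(P)\<close>. On \<open>H\<close> the sets of all \<open>f\<close> that induce a given relation on a member of \<open>G\<close> are also a
  base. By the homogeneity (L3), the JPP then says that the conjugation action on \<open>H\<close> is
  topologically transitive, and the WAP says that every nonempty open set contains a nonempty
  open set on which \<open>V\<^sub>n\<close> acts topologically transitively.

  If an orbit is comeager, it is a countable union of translates of \<open>V\<^sub>n h\<close>, so by Baire
  \<open>h\<close> is interior to the closure of \<open>V\<^sub>n h\<close>; both transitivity properties follow. Conversely, they
  make the set of all \<open>x\<close> with a dense orbit such that \<open>x\<close> is interior to the closure of \<open>V\<^sub>n x\<close> for
  every \<open>n\<close> comeager, and a back-and-forth argument shows that any two such points are conjugate.\<close>

section \<open>Comeager sets\<close>

text \<open>A member of the family forgets the epimorphism and the \<open>f\<close> that produced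
  it, and (L3) repairs this. Any two epimorphisms onto \<open>A\<close> differ by an automorphism
  \<open>g\<close>, and replacing \<phi> by \<phi> \<circ> g has the same effect on the induced
  relation as conjugating \<open>f\<close> by \<open>g\<close>. As \<open>H\<close> is conjugation
  invariant, a relation realised along one epimorphism is realised along all of them. So a common
  cover of two members amounts to one \<open>f\<close> with conjugates in two basic open sets. The
  weak form of amalgamation matches local transitivity term by term: passing from \<open>A\<close>
  to \<open>B\<close> is shrinking an open set, and equality only after composition with the map to
  \<open>A\<close> says that two conjugators agree up to \<open>V n\<close>, not up to the finer
  partition given by \<open>B\<close>. The dynamical half mentions no structures. It needs subgroups
  shrinking to the identity, with countably many cosets and two-sided limits. No metric is chosen:
  cosets are clopen, and nested cosets replace nested balls.\<close>

definition dense_open :: "'a topology \<Rightarrow> 'a set \<Rightarrow> bool"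
  where "dense_open X D \<longleftrightarrow> openin X D \<and> (\<forall>U. openin X U \<and> U \<noteq> {} \<longrightarrow> U \<inter> D \<noteq> {})"

lemma nowhere_dense_in_subset_compl_dense_open:
  assumes "dense_open X D" and "S \<subseteq> topspace X - D"
  shows "nowhere_dense_in X S"
proof -
  have "closedin X (topspace X - D)"
    using assms(1) by (simp add: dense_open_def closedin_diff)
  then have "X closure_of S \<subseteq> topspace X - D"
    using assms(2) by (simp add: closure_of_minimal)
  then have "X interior_of (X closure_of S) \<inter> D = {}"
    using interior_of_subset[of X "X closure_of S"] by fast
  moreover have "X interior_of (X closure_of S) \<inter> D \<noteq> {}" if "X interior_of (X closure_of S) \<noteq> {}"
    using assms(1) that by (simp add: dense_open_def)
  ultimately have "X interior_of (X closure_of S) = {}" by metis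
  then show ?thesis
    using assms(2) by (auto simp: nowhere_dense_in_def)
qed

lemma dense_open_compl_closure:
  assumes "nowhere_dense_in X S"
  shows "dense_open X (topspace X - X closure_of S)"
  unfolding dense_open_def
proof (intro conjI allI impI)
  fix U assume U: "openin X U \<and> U \<noteq> {}"
  show "U \<inter> (topspace X - X closure_of S) \<noteq> {}"
  proof
    assume "U \<inter> (topspace X - X closure_of S) = {}"
    then have "U \<subseteq> X closure_of S"
      using U openin_subset[of X U] by blast
    then have "U \<subseteq> X interior_of (X closure_of S)"
      using U by (simp add: interior_of_maximal)
    with U assms show False
      by (simp add: nowhere_dense_in_def)
  qed
qed (simp add: openin_diff)

lemma comeager_inI:
  assumes "countable \<D>" and "\<And>D. D \<in> \<D> \<Longrightarrow> dense_open X D"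
    and "S \<subseteq> topspace X" and "topspace X \<inter> \<Inter>\<D> \<subseteq> S"
  shows "comeager_in X S"
  unfolding comeager_in_def meager_in_def
proof (intro conjI exI)
  \<comment> \<open>\<open>meager_in\<close> asks for equality with a union, so the complement of
    each \<open>D\<close> is cut down to the complement of \<open>S\<close>.\<close>
  let ?\<N> = "(\<lambda>D. topspace X - S - D) ` \<D>"
  show "countable ?\<N>" using assms(1) by simp
  show "\<forall>N\<in>?\<N>. nowhere_dense_in X N"
  proof
    fix N assume "N \<in> ?\<N>"
    then obtain D where D: "D \<in> \<D>" "N = topspace X - S - D" by auto
    then have "N \<subseteq> topspace X - D" by auto
    with D(1) show "nowhere_dense_in X N"
      using assms(2) nowhere_dense_in_subset_compl_dense_open by metis
  qed
  have "\<exists>D\<in>\<D>. x \<notin> D" if "x \<in> topspace X" "x \<notin> S" for x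
    using that assms(4) by auto
  then show "topspace X - S = \<Union>?\<N>"
    by auto
qed (fact assms(3))

lemma comeager_inE:
  assumes "comeager_in X S"
  obtains \<D> where "countable \<D>" "\<And>D. D \<in> \<D> \<Longrightarrow> dense_open X D" "topspace X \<inter> \<Inter>\<D> \<subseteq> S"
proof -
  obtain \<N> where \<N>: "countable \<N>" "\<forall>N\<in>\<N>. nowhere_dense_in X N" "topspace X - S = \<Union>\<N>"
    using assms unfolding comeager_in_def meager_in_def by metis
  show ?thesis
  proof
    let ?\<D> = "(\<lambda>N. topspace X - X closure_of N) ` \<N>"
    show "countable ?\<D>" using \<N>(1) by simp
    show "dense_open X D" if "D \<in> ?\<D>" for D
      using that \<N>(2) dense_open_compl_closure by auto
    show "topspace X \<inter> \<Inter>?\<D> \<subseteq> S"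
    proof
      fix x assume x: "x \<in> topspace X \<inter> \<Inter>?\<D>"
      have "x \<notin> N" if N: "N \<in> \<N>" for N
      proof -
        have "N \<subseteq> X closure_of N"
          using N \<N>(2) by (simp add: nowhere_dense_in_def closure_of_subset)
        moreover have "x \<notin> X closure_of N" using x N by (auto split: if_splits)
        ultimately show ?thesis by auto
      qed
      then show "x \<in> S" using x \<N>(3) by auto
    qed
  qed
qed

section \<open>Groups with a complete filtration by subgroups\<close>

context group
begin

lemma inv_mult_cancel: "\<lbrakk>x \<in> carrier G; y \<in> carrier G\<rbrakk> \<Longrightarrow> inv x \<otimes> (x \<otimes> y) = y"
  by (simp flip: m_assoc)

lemma mult_inv_cancel: "\<lbrakk>x \<in> carrier G; y \<in> carrier G\<rbrakk> \<Longrightarrow> x \<otimes> (inv x \<otimes> y) = y"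
  by (simp flip: m_assoc)

lemmas word_simps = m_assoc inv_mult_group inv_mult_cancel mult_inv_cancel

lemma conj_action_closed [simp]:
  "\<lbrakk>g \<in> carrier G; x \<in> carrier G\<rbrakk> \<Longrightarrow> conj_action G g x \<in> carrier G"
  by (simp add: conj_action_def)

lemma conj_action_mult:
  "\<lbrakk>g \<in> carrier G; k \<in> carrier G; x \<in> carrier G\<rbrakk>
    \<Longrightarrow> conj_action G (g \<otimes> k) x = conj_action G g (conj_action G k x)"
  by (simp add: conj_action_def word_simps)

lemma conj_action_one: "x \<in> carrier G \<Longrightarrow> conj_action G \<one> x = x"
  by (simp add: conj_action_def)

end

text \<open>Both one-sided differences occur in \<open>V_complete\<close> because a sequence that is Cauchy on one side
  only need not converge in a completely metrizable group.\<close>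

locale filtered_group = group \<Gamma> for \<Gamma> (structure) +
  fixes V :: "nat \<Rightarrow> 'a set"
  assumes V_subgroup: "subgroup (V n) \<Gamma>"
    and V_decreasing: "m \<le> n \<Longrightarrow> V n \<subseteq> V m"
    and V_conj: "g \<in> carrier \<Gamma> \<Longrightarrow> \<exists>m. \<forall>v\<in>V m. g \<otimes> v \<otimes> inv g \<in> V n"
    and V_separated: "(\<Inter>n. V n) = {\<one>}"
    and V_countable: "\<exists>I. countable I \<and> I \<subseteq> carrier \<Gamma> \<and> (\<forall>g\<in>carrier \<Gamma>. \<exists>c\<in>I. g \<otimes> inv c \<in> V n)"
    and V_complete: "\<lbrakk>\<And>n. a n \<in> carrier \<Gamma>; \<And>n. a (Suc n) \<otimes> inv (a n) \<in> V n;
       \<And>n. inv (a (Suc n)) \<otimes> a n \<in> V n\<rbrakk>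
       \<Longrightarrow> \<exists>g\<in>carrier \<Gamma>. \<forall>n. g \<otimes> inv (a n) \<in> V n \<and> inv g \<otimes> a n \<in> V n"
begin

lemma V_carrier: "v \<in> V n \<Longrightarrow> v \<in> carrier \<Gamma>"
  using V_subgroup subgroup.mem_carrier by metis

lemma V_mult: "\<lbrakk>u \<in> V n; v \<in> V n\<rbrakk> \<Longrightarrow> u \<otimes> v \<in> V n"
  using V_subgroup subgroup.m_closed by metis

lemma V_inv: "v \<in> V n \<Longrightarrow> inv v \<in> V n"
  using V_subgroup subgroup.m_inv_closed by metis

lemma V_one: "\<one> \<in> V n"
  using V_subgroup subgroup.one_closed by metis

lemma V_trans:
  assumes "x \<otimes> inv y \<in> V n" "y \<otimes> inv z \<in> V n"
    and "x \<in> carrier \<Gamma>" "y \<in> carrier \<Gamma>" "z \<in> carrier \<Gamma>"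
  shows "x \<otimes> inv z \<in> V n"
  using V_mult[OF assms(1,2)] assms(3-) by (simp add: word_simps)

lemma V_sym:
  assumes "x \<otimes> inv y \<in> V n" and "x \<in> carrier \<Gamma>" "y \<in> carrier \<Gamma>"
  shows "y \<otimes> inv x \<in> V n"
  using V_inv[OF assms(1)] assms(2-) by (simp add: word_simps)

text \<open>The lower bound \<open>k\<close> is free because the \<open>V m\<close> decrease; it
  lets one index serve several requirements at once.\<close>

lemma V_conj_le:
  assumes "g \<in> carrier \<Gamma>"
  obtains m where "m \<ge> k" "\<And>v. v \<in> V m \<Longrightarrow> g \<otimes> v \<otimes> inv g \<in> V n"
proof -
  obtain m where m: "\<forall>v\<in>V m. g \<otimes> v \<otimes> inv g \<in> V n" using V_conj[OF assms] by blast
  show ?thesis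
    using that[of "max m k"] m V_decreasing[of m "max m k"] by auto
qed

text \<open>The condition \<open>y \<otimes> inv x \<in> V n\<close> says that \<open>y\<close> is
  in the right coset \<open>V n x\<close>. For automorphisms these are the sets of maps that agree
  after composition with \<epsilon> n. By \<open>V_conj\<close>, left cosets would give the same
  topology.\<close>

definition filtration_topology :: "'a topology"
  where "filtration_topology = topology (\<lambda>U. U \<subseteq> carrier \<Gamma> \<and>
    (\<forall>x\<in>U. \<exists>n. \<forall>y\<in>carrier \<Gamma>. y \<otimes> inv x \<in> V n \<longrightarrow> y \<in> U))"

lemma openin_filtration:
  "openin filtration_topology U \<longleftrightarrow> U \<subseteq> carrier \<Gamma> \<and>
    (\<forall>x\<in>U. \<exists>n. \<forall>y\<in>carrier \<Gamma>. y \<otimes> inv x \<in> V n \<longrightarrow> y \<in> U)"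
proof -
  let ?op = "\<lambda>U. U \<subseteq> carrier \<Gamma> \<and> (\<forall>x\<in>U. \<exists>n. \<forall>y\<in>carrier \<Gamma>. y \<otimes> inv x \<in> V n \<longrightarrow> y \<in> U)"
  have "istopology ?op"
    unfolding istopology_def
  proof (intro conjI allI impI)
    fix S T assume S: "?op S" and T: "?op T"
    show "S \<inter> T \<subseteq> carrier \<Gamma>" using S by blast
    show "\<forall>x\<in>S \<inter> T. \<exists>n. \<forall>y\<in>carrier \<Gamma>. y \<otimes> inv x \<in> V n \<longrightarrow> y \<in> S \<inter> T"
    proof
      fix x assume "x \<in> S \<inter> T"
      then obtain m n where m: "\<forall>y\<in>carrier \<Gamma>. y \<otimes> inv x \<in> V m \<longrightarrow> y \<in> S"
        and n: "\<forall>y\<in>carrier \<Gamma>. y \<otimes> inv x \<in> V n \<longrightarrow> y \<in> T"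
        using S T by blast
      then show "\<exists>n. \<forall>y\<in>carrier \<Gamma>. y \<otimes> inv x \<in> V n \<longrightarrow> y \<in> S \<inter> T"
        using V_decreasing[of m "max m n"] V_decreasing[of n "max m n"]
        by (intro exI[of _ "max m n"]) auto
    qed
  next
    fix \<K> assume \<K>: "\<forall>K\<in>\<K>. ?op K"
    show "\<Union>\<K> \<subseteq> carrier \<Gamma>" using \<K> by blast
    show "\<forall>x\<in>\<Union>\<K>. \<exists>n. \<forall>y\<in>carrier \<Gamma>. y \<otimes> inv x \<in> V n \<longrightarrow> y \<in> \<Union>\<K>"
      using \<K> by (meson UnionE UnionI)
  qed
  then show ?thesis
    by (simp add: filtration_topology_def topology_inverse')
qed

lemma topspace_filtration [simp]: "topspace filtration_topology = carrier \<Gamma>"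
proof
  show "topspace filtration_topology \<subseteq> carrier \<Gamma>"
    using openin_filtration[of "topspace filtration_topology"] by simp
  have "openin filtration_topology (carrier \<Gamma>)" by (simp add: openin_filtration)
  then show "carrier \<Gamma> \<subseteq> topspace filtration_topology" by (rule openin_subset)
qed

end

section \<open>Comeager conjugacy classes\<close>

locale conjugation_space = filtered_group +
  fixes H :: "'a set"
  assumes H_closed: "closedin filtration_topology H"
    and H_nonempty: "H \<noteq> {}"
    and H_conj: "\<lbrakk>g \<in> carrier \<Gamma>; x \<in> H\<rbrakk> \<Longrightarrow> conj_action \<Gamma> g x \<in> H"
begin

abbreviation X :: "'a topology"
  where "X \<equiv> subtopology filtration_topology H"

abbreviation act :: "'a \<Rightarrow> 'a \<Rightarrow> 'a" (infixr "\<bullet>\<bullet>" 75)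
  where "g \<bullet>\<bullet> x \<equiv> conj_action \<Gamma> g x"

definition nbd :: "nat \<Rightarrow> 'a \<Rightarrow> 'a set"
  where "nbd n x = {y \<in> H. y \<otimes> inv x \<in> V n}"

lemma H_carrier: "x \<in> H \<Longrightarrow> x \<in> carrier \<Gamma>"
  using H_closed closedin_subset topspace_filtration by blast

lemma carrier_Int_H [simp]: "carrier \<Gamma> \<inter> H = H"
  using H_carrier by auto

lemma openin_H: "openin X H"
  using openin_topspace[of X] by simp

lemma nbd_self: "x \<in> H \<Longrightarrow> x \<in> nbd n x"
  by (simp add: nbd_def H_carrier V_one)

text \<open>As in an ultrametric space, every point of a coset is a centre of it.\<close>

lemma nbd_subset: "y \<in> nbd n x \<Longrightarrow> x \<in> H \<Longrightarrow> nbd n y \<subseteq> nbd n x"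
  unfolding nbd_def using V_trans H_carrier by blast

lemma nbd_mono: "m \<le> n \<Longrightarrow> nbd n x \<subseteq> nbd m x"
  unfolding nbd_def using V_decreasing by blast

lemma openin_X: "openin X U \<longleftrightarrow> U \<subseteq> H \<and> (\<forall>x\<in>U. \<exists>n. nbd n x \<subseteq> U)"
proof
  assume "openin X U"
  then obtain T where T: "openin filtration_topology T" "U = T \<inter> H"
    by (auto simp: openin_subtopology)
  show "U \<subseteq> H \<and> (\<forall>x\<in>U. \<exists>n. nbd n x \<subseteq> U)"
  proof (intro conjI ballI)
    fix x assume "x \<in> U"
    then obtain n where "\<forall>y\<in>carrier \<Gamma>. y \<otimes> inv x \<in> V n \<longrightarrow> y \<in> T"
      using T by (auto simp: openin_filtration)
    then have "nbd n x \<subseteq> U"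
      using T H_carrier by (auto simp: nbd_def)
    then show "\<exists>n. nbd n x \<subseteq> U" ..
  qed (use T in blast)
next
  assume U: "U \<subseteq> H \<and> (\<forall>x\<in>U. \<exists>n. nbd n x \<subseteq> U)"
  \<comment> \<open>The witness is the union of the full cosets \<open>V n x\<close> whose traces on
    \<open>H\<close> already lie in \<open>U\<close>, so its own trace on \<open>H\<close> cannot
    leave \<open>U\<close>.\<close>
  define T where "T = {y \<in> carrier \<Gamma>. \<exists>x\<in>U. \<exists>n. nbd n x \<subseteq> U \<and> y \<otimes> inv x \<in> V n}"
  have "openin filtration_topology T"
    unfolding openin_filtration
  proof (intro conjI ballI)
    fix y assume "y \<in> T"
    then obtain x n where xn: "y \<in> carrier \<Gamma>" "x \<in> U" "nbd n x \<subseteq> U" "y \<otimes> inv x \<in> V n"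
      by (auto simp: T_def)
    then have "z \<in> T" if "z \<in> carrier \<Gamma>" "z \<otimes> inv y \<in> V n" for z
      using that U H_carrier V_trans[of z y n x] unfolding T_def by blast
    then show "\<exists>n. \<forall>z\<in>carrier \<Gamma>. z \<otimes> inv y \<in> V n \<longrightarrow> z \<in> T" by blast
  qed (auto simp: T_def)
  moreover have "U = T \<inter> H"
  proof
    show "U \<subseteq> T \<inter> H" using U H_carrier V_one by (fastforce simp: T_def)
    show "T \<inter> H \<subseteq> U" unfolding T_def nbd_def by blast
  qed
  ultimately show "openin X U"
    by (auto simp: openin_subtopology)
qed

lemma openin_nbd:
  assumes "x \<in> H"
  shows "openin X (nbd n x)"
  unfolding openin_X
proof (intro conjI ballI)
  show "nbd n x \<subseteq> H" by (auto simp: nbd_def)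
  show "\<exists>m. nbd m y \<subseteq> nbd n x" if "y \<in> nbd n x" for y
    using nbd_subset[OF that assms] by auto
qed

lemma openin_X_H: "openin X U \<Longrightarrow> x \<in> U \<Longrightarrow> x \<in> H"
  using openin_X by blast

text \<open>This is the form in which closedness of \<open>H\<close> enters the Baire argument: it
  keeps the limit supplied by \<open>V_complete\<close> inside \<open>H\<close>.\<close>

lemma limit_in_H:
  assumes "g \<in> carrier \<Gamma>" and "\<And>n. \<exists>x\<in>H. g \<otimes> inv x \<in> V n"
  shows "g \<in> H"
proof (rule ccontr)
  assume "g \<notin> H"
  moreover have "openin filtration_topology (carrier \<Gamma> - H)"
    using H_closed by (simp add: closedin_def)
  ultimately obtain n where n: "\<forall>y\<in>carrier \<Gamma>. y \<otimes> inv g \<in> V n \<longrightarrow> y \<in> carrier \<Gamma> - H"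
    using assms(1) unfolding openin_filtration by (metis DiffI)
  obtain x where "x \<in> H" "g \<otimes> inv x \<in> V n" using assms(2) by blast
  then show False
    using n V_sym[of g x n] assms(1) H_carrier by blast
qed

section \<open>Continuity of the conjugation action, and the Baire property of
  \<open>H\<close>\<close>

lemma act_mult: "\<lbrakk>g \<in> carrier \<Gamma>; k \<in> carrier \<Gamma>; x \<in> H\<rbrakk> \<Longrightarrow> (g \<otimes> k) \<bullet>\<bullet> x = g \<bullet>\<bullet> k \<bullet>\<bullet> x"
  by (simp add: conj_action_mult H_carrier)

lemma act_one: "x \<in> H \<Longrightarrow> \<one> \<bullet>\<bullet> x = x"
  by (simp add: conj_action_one H_carrier)

lemma act_inv: "\<lbrakk>g \<in> carrier \<Gamma>; x \<in> H\<rbrakk> \<Longrightarrow> inv g \<bullet>\<bullet> g \<bullet>\<bullet> x = x"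
  using act_mult[of "inv g" g x] by (simp add: act_one)

text \<open>Acting by \<open>g\<close> conjugates the difference \<open>y \<otimes> inv x\<close> by
  \<open>g\<close>, so \<open>V_conj\<close> amounts to continuity of the action of each group
  element.\<close>

lemma openin_act_vimage:
  assumes "g \<in> carrier \<Gamma>" and "openin X U"
  shows "openin X {x \<in> H. g \<bullet>\<bullet> x \<in> U}"
  unfolding openin_X
proof (intro conjI ballI)
  fix x assume "x \<in> {x \<in> H. g \<bullet>\<bullet> x \<in> U}"
  then have x: "x \<in> H" "g \<bullet>\<bullet> x \<in> U" by auto
  obtain n where n: "nbd n (g \<bullet>\<bullet> x) \<subseteq> U" using assms(2) x unfolding openin_X by blast
  obtain m where m: "\<And>v. v \<in> V m \<Longrightarrow> g \<otimes> v \<otimes> inv g \<in> V n" using V_conj_le[OF assms(1)] by metis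
  have "g \<bullet>\<bullet> y \<in> U" if "y \<in> nbd m x" for y
  proof -
    have y: "y \<in> H" "y \<otimes> inv x \<in> V m" using that by (auto simp: nbd_def)
    have "(g \<bullet>\<bullet> y) \<otimes> inv (g \<bullet>\<bullet> x) = g \<otimes> (y \<otimes> inv x) \<otimes> inv g"
      using assms(1) x(1) y(1) by (simp add: conj_action_def word_simps H_carrier)
    then have "g \<bullet>\<bullet> y \<in> nbd n (g \<bullet>\<bullet> x)"
      using m[OF y(2)] H_conj[OF assms(1) y(1)] by (simp add: nbd_def)
    then show ?thesis using n by blast
  qed
  then show "\<exists>n. nbd n x \<subseteq> {x \<in> H. g \<bullet>\<bullet> x \<in> U}"
    unfolding nbd_def by blast
qed auto

text \<open>The last property converts closeness in right cosets into closeness of the left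
  differences: \<open>inv h \<otimes> g\<close> is the conjugate by \<open>inv g\<close> of the
  inverse of \<open>h \<otimes> inv g\<close>. The price is an index \<open>m\<close> that depends
  on \<open>g\<close>.\<close>

lemma nbd_shrink:
  assumes "openin X W" and "g \<in> W"
  obtains m where "m \<ge> k" "nbd m g \<subseteq> W" "\<And>h. h \<in> nbd m g \<Longrightarrow> inv h \<otimes> g \<in> V k"
proof -
  have gH: "g \<in> carrier \<Gamma>" using assms H_carrier openin_X_H by blast
  obtain n where n: "nbd n g \<subseteq> W" using assms unfolding openin_X by blast
  obtain m where m: "m \<ge> max n k" "\<And>v. v \<in> V m \<Longrightarrow> inv g \<otimes> v \<otimes> inv (inv g) \<in> V k"
    using V_conj_le[of "inv g"] gH by (metis inv_closed)
  show ?thesis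
  proof
    show "nbd m g \<subseteq> W" using n nbd_mono[of n m g] m(1) by auto
    fix h assume h: "h \<in> nbd m g"
    then have hH: "h \<in> carrier \<Gamma>" using H_carrier by (auto simp: nbd_def)
    have "inv (h \<otimes> inv g) \<in> V m" using h V_inv by (auto simp: nbd_def)
    from m(2)[OF this] show "inv h \<otimes> g \<in> V k"
      using hH gH by (simp add: word_simps)
  qed (use m in auto)
qed

text \<open>The nested-balls argument with cosets as balls. A coset is closed as well as open, so
  the limit stays in every coset of the sequence without any passage to closures.\<close>

theorem Baire:
  assumes "countable \<D>" and "\<And>D. D \<in> \<D> \<Longrightarrow> dense_open X D" and "openin X U" and "U \<noteq> {}"
  shows "\<exists>x\<in>U. \<forall>D\<in>\<D>. x \<in> D"
proof (cases "\<D> = {}")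
  case False
  define D where "D = from_nat_into \<D>"
  have D: "dense_open X (D k)" for k
    using assms(2) False by (simp add: D_def from_nat_into)
  \<comment> \<open>A state is a centre in \<open>H\<close> with a radius index. Besides shrinking
    radii it demands \<open>inv h \<otimes> fst s \<in> V k\<close> on the whole neighbourhood: this
    bounds the left difference to the next centre, the last premise of
    \<open>V_complete\<close>.\<close>
  define good where "good k s \<longleftrightarrow> fst s \<in> H \<and> nbd (snd s) (fst s) \<subseteq> U \<and> k \<le> snd s \<and>
    (\<forall>h\<in>nbd (snd s) (fst s). inv h \<otimes> fst s \<in> V k)" for k :: nat and s :: "'a \<times> nat"
  define step where "step k s t \<longleftrightarrow> fst t \<in> nbd (snd s) (fst s) \<and>
    nbd (snd t) (fst t) \<subseteq> nbd (snd s) (fst s) \<inter> D k" for k and s t :: "'a \<times> nat"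
  have "\<exists>f. \<forall>k. good k (f k) \<and> step k (f k) (f (Suc k))"
  proof (rule dependent_nat_choice)
    obtain g where g: "g \<in> U" using assms(4) by blast
    obtain m where "m \<ge> 0" "nbd m g \<subseteq> U" "\<And>h. h \<in> nbd m g \<Longrightarrow> inv h \<otimes> g \<in> V 0"
      using nbd_shrink[OF assms(3) g] by metis
    then show "\<exists>s. good 0 s"
      using g assms(3) openin_X_H unfolding good_def by (intro exI[of _ "(g, m)"]) auto
  next
    fix s k assume s: "good k s"
    define W where "W = nbd (snd s) (fst s) \<inter> D k"
    have o: "openin X (nbd (snd s) (fst s))" "nbd (snd s) (fst s) \<noteq> {}"
      using s openin_nbd nbd_self unfolding good_def by blast+
    then have W: "openin X W" "W \<noteq> {}"
      using D[of k] unfolding W_def dense_open_def by auto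
    then obtain g where g: "g \<in> W" by blast
    obtain m where "m \<ge> Suc k" "nbd m g \<subseteq> W" "\<And>h. h \<in> nbd m g \<Longrightarrow> inv h \<otimes> g \<in> V (Suc k)"
      using nbd_shrink[OF W(1) g] by metis
    moreover have "g \<in> H" using W(1) g openin_X_H by blast
    moreover have "W \<subseteq> U" using s by (auto simp: W_def good_def)
    ultimately have "good (Suc k) (g, m) \<and> step k s (g, m)"
      using g by (auto simp: good_def step_def W_def)
    then show "\<exists>t. good (Suc k) t \<and> step k s t" ..
  qed
  then obtain f where f: "\<And>k. good k (f k)" "\<And>k. step k (f k) (f (Suc k))" by blast
  define a m where "a k = fst (f k)" and "m k = snd (f k)" for k
  have aH: "a k \<in> H" and aC: "a k \<in> carrier \<Gamma>" and mk: "k \<le> m k" for k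
    using f(1)[of k] H_carrier by (auto simp: good_def a_def m_def)
  have a_step: "a (Suc k) \<in> nbd (m k) (a k)" for k
    using f(2)[of k] by (simp add: step_def a_def m_def)
  have "a (Suc k) \<otimes> inv (a k) \<in> V k" for k
    using a_step[of k] V_decreasing[OF mk[of k]] by (auto simp: nbd_def)
  moreover have "inv (a (Suc k)) \<otimes> a k \<in> V k" for k
    using a_step[of k] f(1)[of k] by (auto simp: good_def a_def m_def)
  ultimately obtain g where g: "g \<in> carrier \<Gamma>" "\<And>n. g \<otimes> inv (a n) \<in> V n"
    using V_complete[of a] aC by blast
  have gH: "g \<in> H" using limit_in_H[OF g(1)] g(2) aH by blast
  have nested: "nbd (m j) (a j) \<subseteq> nbd (m k) (a k)" if "k \<le> j" for j k
    using that
  proof (induction rule: dec_induct)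
    case (step j)
    then show ?case using f(2)[of j] by (auto simp: step_def a_def m_def)
  qed auto
  have g_in: "g \<in> nbd (m k) (a k)" for k
  proof -
    \<comment> \<open>At stage \<open>?j\<close> the centre is already in the neighbourhood of stage
      \<open>k\<close>, and the limit is \<open>V (m k)\<close>-close to that centre because
      \<open>?j \<ge> m k\<close>.\<close>
    let ?j = "max k (m k)"
    have "a ?j \<in> nbd (m k) (a k)"
      using nested[of k ?j] nbd_self[OF aH] by auto
    moreover have "g \<in> nbd (m k) (a ?j)"
      using g(2)[of ?j] V_decreasing[of "m k" ?j] gH by (auto simp: nbd_def)
    ultimately show ?thesis using nbd_subset aH by blast
  qed
  have "g \<in> U" using g_in[of 0] f(1)[of 0] by (auto simp: good_def a_def m_def)
  moreover have "g \<in> D k" for k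
    using g_in[of "Suc k"] f(2)[of k] by (auto simp: step_def a_def m_def)
  then have "\<forall>D\<in>\<D>. g \<in> D"
    unfolding D_def using from_nat_into_surj[OF assms(1)] by metis
  ultimately show ?thesis by blast
qed (use assms in blast)

definition transitive_on :: "nat \<Rightarrow> 'a set \<Rightarrow> bool"
  where "transitive_on n U \<longleftrightarrow> (\<forall>W1 W2. openin X W1 \<and> W1 \<noteq> {} \<and> W1 \<subseteq> U \<and>
    openin X W2 \<and> W2 \<noteq> {} \<and> W2 \<subseteq> U \<longrightarrow> (\<exists>v\<in>V n. \<exists>x\<in>W1. v \<bullet>\<bullet> x \<in> W2))"

definition transitive :: bool
  where "transitive \<longleftrightarrow> (\<forall>W1 W2. openin X W1 \<and> W1 \<noteq> {} \<and> openin X W2 \<and> W2 \<noteq> {} \<longrightarrow>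
    (\<exists>g\<in>carrier \<Gamma>. \<exists>x\<in>W1. g \<bullet>\<bullet> x \<in> W2))"

definition locally_transitive :: bool
  where "locally_transitive \<longleftrightarrow> (\<forall>n U. openin X U \<and> U \<noteq> {} \<longrightarrow>
    (\<exists>U'. openin X U' \<and> U' \<noteq> {} \<and> U' \<subseteq> U \<and> transitive_on n U'))"

text \<open>\<open>approx n x y\<close> says that \<open>y\<close> lies in the interior of the closure of the
  \<open>V n\<close>-orbit of \<open>x\<close>.\<close>

definition approx :: "nat \<Rightarrow> 'a \<Rightarrow> 'a \<Rightarrow> bool"
  where "approx n x y \<longleftrightarrow> (\<exists>U. openin X U \<and> y \<in> U \<and>
    (\<forall>Y. openin X Y \<and> Y \<noteq> {} \<and> Y \<subseteq> U \<longrightarrow> (\<exists>v\<in>V n. v \<bullet>\<bullet> x \<in> Y)))"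

section \<open>From a comeager orbit to transitivity\<close>

lemma comeager_meets_open:
  assumes "comeager_in X S" and "openin X U" and "U \<noteq> {}"
  shows "U \<inter> S \<noteq> {}"
proof -
  obtain \<D> where \<D>: "countable \<D>" "\<And>D. D \<in> \<D> \<Longrightarrow> dense_open X D" "topspace X \<inter> \<Inter>\<D> \<subseteq> S"
    using comeager_inE[OF assms(1)] by blast
  obtain x where "x \<in> U" "\<forall>D\<in>\<D>. x \<in> D" using Baire[OF \<D>(1,2) assms(2,3)] by blast
  then show ?thesis using \<D>(3) openin_subset[OF assms(2)] by blast
qed

lemma comeager_not_Union_nowhere_dense:
  assumes "comeager_in X S" and "countable I" and "S \<subseteq> (\<Union>i\<in>I. A i)"
  shows "\<exists>i\<in>I. \<not> nowhere_dense_in X (A i)"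
proof (rule ccontr)
  assume "\<not> ?thesis"
  then have nd: "nowhere_dense_in X (A i)" if "i \<in> I" for i using that by blast
  obtain \<D> where \<D>: "countable \<D>" "\<And>D. D \<in> \<D> \<Longrightarrow> dense_open X D" "topspace X \<inter> \<Inter>\<D> \<subseteq> S"
    using comeager_inE[OF assms(1)] by blast
  let ?\<E> = "(\<lambda>i. topspace X - X closure_of A i) ` I"
  have "dense_open X D" if "D \<in> \<D> \<union> ?\<E>" for D
    using that \<D>(2) dense_open_compl_closure[OF nd] by auto
  moreover have "countable (\<D> \<union> ?\<E>)" using \<D>(1) assms(2) by simp
  ultimately have "\<exists>x\<in>H. \<forall>D\<in>\<D> \<union> ?\<E>. x \<in> D"
    using openin_H H_nonempty Baire by meson
  then obtain x where x: "x \<in> topspace X" "\<forall>D\<in>\<D> \<union> ?\<E>. x \<in> D"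
    by auto
  then have "x \<in> S" using \<D>(3) by blast
  then obtain i where i: "i \<in> I" "x \<in> A i" using assms(3) by blast
  then have "A i \<subseteq> X closure_of A i"
    using nd[OF i(1)] by (intro closure_of_subset) (simp add: nowhere_dense_in_def)
  moreover have "x \<in> topspace X - X closure_of A i" using x(2) i(1) by blast
  ultimately show False using i(2) by blast
qed

text \<open>The comeager set \<open>S\<close> is kept apart from the orbit written with base point
  \<open>h\<close>, so that the same \<open>S\<close> serves for every base point of one
  orbit.\<close>

lemma comeager_orbit_approx:
  assumes "h \<in> H" and "comeager_in X S" and "S \<subseteq> {g \<bullet>\<bullet> h | g. g \<in> carrier \<Gamma>}"
  shows "approx n h h"
proof -
  obtain I where I: "countable I" "I \<subseteq> carrier \<Gamma>" "\<forall>g\<in>carrier \<Gamma>. \<exists>c\<in>I. g \<otimes> inv c \<in> V n"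
    using V_countable by blast
  \<comment> \<open>Applied to inverses, \<open>V_countable\<close> covers the group by countably
    many left cosets \<open>inv c \<otimes> V n\<close>; so \<open>S\<close> is covered by countably
    many translates of the \<open>V n\<close>-orbit of \<open>h\<close>.\<close>
  define A where "A c = {(inv c \<otimes> v) \<bullet>\<bullet> h | v. v \<in> V n}" for c
  have "S \<subseteq> (\<Union>c\<in>I. A c)"
  proof
    fix x assume "x \<in> S"
    then obtain g where g: "g \<in> carrier \<Gamma>" "x = g \<bullet>\<bullet> h" using assms(3) by blast
    then obtain c where c: "c \<in> I" "inv g \<otimes> inv c \<in> V n" using I(3) by (metis inv_closed)
    have "inv (inv g \<otimes> inv c) \<in> V n" using c(2) V_inv by blast
    then have "c \<otimes> g \<in> V n" using c(1) g(1) I(2) by (simp add: word_simps subset_iff)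
    moreover have "inv c \<otimes> (c \<otimes> g) = g" using c(1) g(1) I(2) by (auto simp: word_simps subset_iff)
    then have "x = (inv c \<otimes> (c \<otimes> g)) \<bullet>\<bullet> h" using g(2) by simp
    ultimately have "x \<in> A c" by (auto simp: A_def)
    then show "x \<in> (\<Union>c\<in>I. A c)" using c(1) by blast
  qed
  then obtain c where c: "c \<in> I" "\<not> nowhere_dense_in X (A c)"
    using comeager_not_Union_nowhere_dense[OF assms(2) I(1)] by blast
  have cC: "c \<in> carrier \<Gamma>" using c(1) I(2) by blast
  have "A c \<subseteq> H" unfolding A_def using cC H_conj assms(1) V_carrier by auto
  define W where "W = X interior_of (X closure_of A c)"
  have W: "openin X W" "W \<noteq> {}" "W \<subseteq> X closure_of A c"
    using c(2) \<open>A c \<subseteq> H\<close> by (auto simp: W_def nowhere_dense_in_def interior_of_subset)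
  have meet: "\<exists>v\<in>V n. (inv c \<otimes> v) \<bullet>\<bullet> h \<in> T" if T: "openin X T" "y \<in> T" "y \<in> W" for T y
  proof -
    have "y \<in> X closure_of A c" using T(3) W(3) by auto
    then obtain a where "a \<in> A c" "a \<in> T" using T(1,2) by (auto simp: in_closure_of)
    then show ?thesis by (auto simp: A_def)
  qed
  obtain v0 where v0: "v0 \<in> V n" "(inv c \<otimes> v0) \<bullet>\<bullet> h \<in> W"
    using meet[OF W(1)] W(2) by auto
  \<comment> \<open>A point \<open>k \<bullet>\<bullet> h\<close> of the translated orbit lies in
    the interior \<open>W\<close>. Pulling \<open>W\<close> back along \<open>k\<close> gives a
    neighbourhood of \<open>h\<close>, and the factor \<open>inv c\<close> cancels:
    \<open>inv k \<otimes> (inv c \<otimes> v)\<close> is \<open>inv v0 \<otimes> v\<close>, again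
    in \<open>V n\<close>.\<close>
  define k where "k = inv c \<otimes> v0"
  have kC: "k \<in> carrier \<Gamma>" using cC v0 V_carrier by (simp add: k_def)
  show ?thesis
    unfolding approx_def
  proof (intro exI conjI allI impI)
    let ?U = "{x \<in> H. k \<bullet>\<bullet> x \<in> W}"
    show "openin X ?U" using openin_act_vimage[OF kC W(1)] .
    show "h \<in> ?U" using assms(1) v0 by (simp add: k_def)
    fix Y assume Y: "openin X Y \<and> Y \<noteq> {} \<and> Y \<subseteq> ?U"
    then obtain y where y: "y \<in> Y" "y \<in> H" "k \<bullet>\<bullet> y \<in> W" by blast
    have "openin X {x \<in> H. inv k \<bullet>\<bullet> x \<in> Y}" using openin_act_vimage[of "inv k" Y] Y kC by simp
    moreover have "k \<bullet>\<bullet> y \<in> {x \<in> H. inv k \<bullet>\<bullet> x \<in> Y}"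
      using y kC H_conj by (simp add: act_inv)
    ultimately obtain v where v: "v \<in> V n" "inv k \<bullet>\<bullet> (inv c \<otimes> v) \<bullet>\<bullet> h \<in> Y"
      using meet[OF _ _ y(3)] by auto
    have C: "v0 \<in> carrier \<Gamma>" "v \<in> carrier \<Gamma>" using v0(1) v(1) V_carrier by auto
    have "inv k \<bullet>\<bullet> (inv c \<otimes> v) \<bullet>\<bullet> h = (inv k \<otimes> (inv c \<otimes> v)) \<bullet>\<bullet> h"
      using act_mult[of "inv k" "inv c \<otimes> v" h] cC kC C assms(1) by simp
    also have "inv k \<otimes> (inv c \<otimes> v) = inv v0 \<otimes> v"
      using cC C by (simp add: k_def word_simps)
    finally show "\<exists>v\<in>V n. v \<bullet>\<bullet> h \<in> Y"
      using v(2) V_mult[OF V_inv[OF v0(1)] v(1)] by auto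
  qed
qed

theorem comeager_orbit_imp_transitive:
  assumes "h \<in> H" and "comeager_in X (orbit \<Gamma> (conj_action \<Gamma>) h)"
  shows "transitive" and "locally_transitive"
proof -
  let ?O = "orbit \<Gamma> (conj_action \<Gamma>) h"
  have O: "?O = {g \<bullet>\<bullet> h | g. g \<in> carrier \<Gamma>}" by (simp add: orbit_def)
  have meets: "\<exists>g\<in>carrier \<Gamma>. g \<bullet>\<bullet> h \<in> U" if "openin X U" "U \<noteq> {}" for U
    using comeager_meets_open[OF assms(2) that] O by auto
  show transitive
    unfolding transitive_def
  proof (intro allI impI)
    fix W1 W2 assume W: "openin X W1 \<and> W1 \<noteq> {} \<and> openin X W2 \<and> W2 \<noteq> {}"
    then obtain g1 g2 where g: "g1 \<in> carrier \<Gamma>" "g1 \<bullet>\<bullet> h \<in> W1" "g2 \<in> carrier \<Gamma>" "g2 \<bullet>\<bullet> h \<in> W2"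
      using meets by meson
    then have "(g2 \<otimes> inv g1) \<bullet>\<bullet> g1 \<bullet>\<bullet> h \<in> W2"
      using assms(1) H_conj by (simp add: act_mult act_inv)
    with g show "\<exists>g\<in>carrier \<Gamma>. \<exists>x\<in>W1. g \<bullet>\<bullet> x \<in> W2" by (metis inv_closed m_closed)
  qed
  show locally_transitive
    unfolding locally_transitive_def
  proof (intro allI impI)
    fix n U assume U: "openin X U \<and> U \<noteq> {}"
    then obtain k where k: "k \<in> carrier \<Gamma>" "k \<bullet>\<bullet> h \<in> U" using meets by blast
    have kh: "k \<bullet>\<bullet> h \<in> H" using H_conj k assms(1) by blast
    have "?O \<subseteq> {g \<bullet>\<bullet> k \<bullet>\<bullet> h | g. g \<in> carrier \<Gamma>}"
    proof
      fix x assume "x \<in> ?O"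
      then obtain g where g: "g \<in> carrier \<Gamma>" "x = g \<bullet>\<bullet> h" using O by blast
      then have "x = (g \<otimes> inv k) \<bullet>\<bullet> k \<bullet>\<bullet> h" using k kh assms(1) by (simp add: act_mult act_inv)
      then show "x \<in> {g \<bullet>\<bullet> k \<bullet>\<bullet> h | g. g \<in> carrier \<Gamma>}" using g k by blast
    qed
    then obtain U1 where U1: "openin X U1" "k \<bullet>\<bullet> h \<in> U1"
      "\<And>Y. openin X Y \<Longrightarrow> Y \<noteq> {} \<Longrightarrow> Y \<subseteq> U1 \<Longrightarrow> \<exists>v\<in>V n. v \<bullet>\<bullet> k \<bullet>\<bullet> h \<in> Y"
      using comeager_orbit_approx[OF kh assms(2), of n] unfolding approx_def by metis
    \<comment> \<open>Both open sets are reached from \<open>k \<bullet>\<bullet> h\<close> by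
      elements of \<open>V n\<close>, so one gets from \<open>W1\<close> to \<open>W2\<close> by
      going back through that point.\<close>
    have "transitive_on n (U \<inter> U1)"
      unfolding transitive_on_def
    proof (intro allI impI)
      fix W1 W2
      assume "openin X W1 \<and> W1 \<noteq> {} \<and> W1 \<subseteq> U \<inter> U1 \<and> openin X W2 \<and> W2 \<noteq> {} \<and> W2 \<subseteq> U \<inter> U1"
      then obtain v1 v2 where v: "v1 \<in> V n" "v1 \<bullet>\<bullet> k \<bullet>\<bullet> h \<in> W1" "v2 \<in> V n" "v2 \<bullet>\<bullet> k \<bullet>\<bullet> h \<in> W2"
        using U1(3) by (meson le_inf_iff)
      then have "(v2 \<otimes> inv v1) \<bullet>\<bullet> v1 \<bullet>\<bullet> k \<bullet>\<bullet> h \<in> W2"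
        using kh H_conj V_carrier by (simp add: act_mult act_inv)
      with v show "\<exists>v\<in>V n. \<exists>x\<in>W1. v \<bullet>\<bullet> x \<in> W2" by (metis V_mult V_inv)
    qed
    then show "\<exists>U'. openin X U' \<and> U' \<noteq> {} \<and> U' \<subseteq> U \<and> transitive_on n U'"
      using U U1 k by (intro exI[of _ "U \<inter> U1"]) auto
  qed
qed

text \<open>The coset of \<open>x\<close> is also the coset of a representative \<open>c\<close>
  from the countable set \<open>I n\<close>. Since \<open>c\<close> need not lie in
  \<open>H\<close>, the base is enumerated by traces of cosets of such \<open>c\<close>.\<close>

lemma countable_base:
  obtains \<B> where "countable \<B>" "\<And>B. B \<in> \<B> \<Longrightarrow> openin X B \<and> B \<noteq> {}"
    "\<And>U x. \<lbrakk>openin X U; x \<in> U\<rbrakk> \<Longrightarrow> \<exists>B\<in>\<B>. x \<in> B \<and> B \<subseteq> U"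
proof -
  obtain I where I: "\<And>n. countable (I n)" "\<And>n. I n \<subseteq> carrier \<Gamma>"
    "\<And>n g. g \<in> carrier \<Gamma> \<Longrightarrow> \<exists>c\<in>I n. g \<otimes> inv c \<in> V n"
    using V_countable by metis
  define \<B> where "\<B> = {nbd n x | n x. x \<in> H}"
  have "\<B> \<subseteq> (\<Union>n. (\<lambda>c. {y \<in> H. y \<otimes> inv c \<in> V n}) ` I n)"
  proof
    fix B assume "B \<in> \<B>"
    then obtain n x where x: "x \<in> H" "B = nbd n x" unfolding \<B>_def by blast
    obtain c where c: "c \<in> I n" "x \<otimes> inv c \<in> V n" using I(3) H_carrier x(1) by blast
    have C: "c \<in> carrier \<Gamma>" "x \<in> carrier \<Gamma>" using I(2) c(1) H_carrier x(1) by blast+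
    have "y \<otimes> inv x \<in> V n \<longleftrightarrow> y \<otimes> inv c \<in> V n" if "y \<in> H" for y
      using V_trans[OF _ c(2)] V_trans[OF _ V_sym[OF c(2)]] C H_carrier[OF that] by blast
    then have "B = {y \<in> H. y \<otimes> inv c \<in> V n}" using x(2) by (auto simp: nbd_def)
    then show "B \<in> (\<Union>n. (\<lambda>c. {y \<in> H. y \<otimes> inv c \<in> V n}) ` I n)" using c(1) by blast
  qed
  moreover have "countable (\<Union>n. (\<lambda>c. {y \<in> H. y \<otimes> inv c \<in> V n}) ` I n)"
    using I(1) by blast
  ultimately have "countable \<B>" using countable_subset by blast
  moreover have "openin X B \<and> B \<noteq> {}" if "B \<in> \<B>" for B
    using that openin_nbd nbd_self unfolding \<B>_def by blast
  moreover have "\<exists>B\<in>\<B>. x \<in> B \<and> B \<subseteq> U" if "openin X U" "x \<in> U" for U x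
  proof -
    obtain n where "nbd n x \<subseteq> U" using \<open>openin X U\<close> \<open>x \<in> U\<close> unfolding openin_X by blast
    moreover have "x \<in> H" using that openin_X_H by blast
    ultimately show ?thesis using nbd_self unfolding \<B>_def by blast
  qed
  ultimately show ?thesis using that by blast
qed

section \<open>Generic points: they form a comeager set and are pairwise conjugate\<close>

definition generic :: "'a \<Rightarrow> bool"
  where "generic x \<longleftrightarrow> x \<in> H \<and>
    (\<forall>U. openin X U \<and> U \<noteq> {} \<longrightarrow> (\<exists>g\<in>carrier \<Gamma>. g \<bullet>\<bullet> x \<in> U)) \<and> (\<forall>n. approx n x x)"

lemma openin_translates:
  assumes "openin X B" and "T \<subseteq> carrier \<Gamma>"
  shows "openin X {x \<in> H. \<exists>g\<in>T. g \<bullet>\<bullet> x \<in> B}"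
proof -
  have "openin X (\<Union>g\<in>T. {x \<in> H. g \<bullet>\<bullet> x \<in> B})"
    using openin_act_vimage assms by (intro openin_Union) blast
  moreover have "(\<Union>g\<in>T. {x \<in> H. g \<bullet>\<bullet> x \<in> B}) = {x \<in> H. \<exists>g\<in>T. g \<bullet>\<bullet> x \<in> B}"
    by blast
  ultimately show ?thesis by simp
qed

text \<open>Genericity is enforced by countably many dense open conditions: the orbit meets each
  basic set, some neighbourhood of the point is transitive for \<open>V n\<close>, and for each
  basic \<open>B\<close> it is settled near the point whether \<open>V n\<close> can move points
  into \<open>B\<close>. The last two together give \<open>approx n x x\<close>.\<close>

lemma generic_comeager:
  assumes transitive and locally_transitive
  shows "comeager_in X {x. generic x}"
proof -
  obtain \<B> where \<B>: "countable \<B>" "\<And>B. B \<in> \<B> \<Longrightarrow> openin X B \<and> B \<noteq> {}"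
    "\<And>U x. \<lbrakk>openin X U; x \<in> U\<rbrakk> \<Longrightarrow> \<exists>B\<in>\<B>. x \<in> B \<and> B \<subseteq> U"
    using countable_base by blast
  define hit where "hit T B = {x \<in> H. \<exists>g\<in>T. g \<bullet>\<bullet> x \<in> B}" for T B
  have open_hit: "openin X (hit T B)" if "openin X B" "T \<subseteq> carrier \<Gamma>" for T B
    using openin_translates[OF that] by (simp add: hit_def)
  \<comment> \<open>An open set together with its exterior, hence dense open for every
    \<open>B\<close>. If \<open>x\<close> were in the exterior while a transitive \<open>U\<close>
    around \<open>x\<close> contains \<open>B\<close>, some point near \<open>x\<close> would be
    moved into \<open>B\<close> after all.\<close>
  define E where "E n B = hit (V n) B \<union> \<Union>{U. openin X U \<and> U \<inter> hit (V n) B = {}}" for n B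
  define L where "L n = \<Union>{U. openin X U \<and> transitive_on n U}" for n
  let ?\<D> = "hit (carrier \<Gamma>) ` \<B> \<union> range L \<union> (\<Union>n. E n ` \<B>)"
  have Vn: "V n \<subseteq> carrier \<Gamma>" for n using V_carrier by blast
  show ?thesis
  proof (rule comeager_inI)
    show "countable ?\<D>" using \<B>(1) by auto
    have "dense_open X (hit (carrier \<Gamma>) B)" if "B \<in> \<B>" for B
      unfolding dense_open_def
    proof (intro conjI allI impI)
      fix U assume U: "openin X U \<and> U \<noteq> {}"
      then have "\<exists>g\<in>carrier \<Gamma>. \<exists>x\<in>U. g \<bullet>\<bullet> x \<in> B"
        using assms(1) \<B>(2)[OF that] unfolding transitive_def by blast
      then obtain g x where "g \<in> carrier \<Gamma>" "x \<in> U" "g \<bullet>\<bullet> x \<in> B" by blast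
      moreover have "x \<in> H" using \<open>x \<in> U\<close> U openin_X_H by blast
      ultimately show "U \<inter> hit (carrier \<Gamma>) B \<noteq> {}" unfolding hit_def by blast
    qed (use \<B>(2)[OF that] open_hit in blast)
    moreover have "dense_open X (L n)" for n
      using assms(2) unfolding dense_open_def L_def locally_transitive_def
      by (fastforce intro: openin_Union)
    moreover have "dense_open X (E n B)" if "B \<in> \<B>" for n B
      using open_hit[OF _ Vn] \<B>(2)[OF that] unfolding dense_open_def E_def
      by (blast intro: openin_Union openin_Un)
    ultimately show "dense_open X D" if "D \<in> ?\<D>" for D using that by blast
    show "{x. generic x} \<subseteq> topspace X" by (auto simp: generic_def)
    show "topspace X \<inter> \<Inter>?\<D> \<subseteq> {x. generic x}"
    proof
      fix x assume x: "x \<in> topspace X \<inter> \<Inter>?\<D>"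
      have "\<exists>g\<in>carrier \<Gamma>. g \<bullet>\<bullet> x \<in> U" if U: "openin X U" "U \<noteq> {}" for U
      proof -
        obtain B where "B \<in> \<B>" "B \<subseteq> U" using \<B>(3)[OF U(1)] U(2) by blast
        moreover then have "x \<in> hit (carrier \<Gamma>) B" using x by blast
        ultimately show ?thesis unfolding hit_def by blast
      qed
      moreover have "approx n x x" for n
      proof -
        have "x \<in> L n" using x by blast
        then obtain U where U: "openin X U" "transitive_on n U" "x \<in> U" unfolding L_def by blast
        have "\<exists>v\<in>V n. v \<bullet>\<bullet> x \<in> Y" if Y: "openin X Y" "Y \<noteq> {}" "Y \<subseteq> U" for Y
        proof -
          obtain B where B: "B \<in> \<B>" "B \<subseteq> Y" using \<B>(3)[OF Y(1)] Y(2) by blast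
          have "x \<in> hit (V n) B"
          proof (rule ccontr)
            assume "x \<notin> hit (V n) B"
            moreover have "x \<in> E n B" using x B(1) by blast
            ultimately obtain U2 where U2: "openin X U2" "x \<in> U2" "U2 \<inter> hit (V n) B = {}"
              unfolding E_def by blast
            have "openin X (U \<inter> U2)" "U \<inter> U2 \<noteq> {}" using U U2 by auto
            then obtain v z where "v \<in> V n" "z \<in> U \<inter> U2" "v \<bullet>\<bullet> z \<in> B"
              using U(2) \<B>(2)[OF B(1)] B(2) Y(3) unfolding transitive_on_def
              by (meson inf.cobounded1 order_trans)
            then have "z \<in> hit (V n) B" using U2(1) openin_X_H unfolding hit_def by blast
            then show False using \<open>z \<in> U \<inter> U2\<close> U2(3) by blast
          qed
          then show ?thesis using B(2) unfolding hit_def by blast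
        qed
        then show ?thesis using U unfolding approx_def by blast
      qed
      ultimately show "x \<in> {x. generic x}" using x by (auto simp: generic_def)
    qed
  qed
qed

text \<open>Density at level \<open>n\<close> around the translated point comes from density at a
  level \<open>m\<close> around \<open>x\<close>, where \<open>g\<close> conjugates
  \<open>V m\<close> into \<open>V n\<close>. This is why \<open>generic\<close> quantifies over all
  levels.\<close>

lemma generic_act:
  assumes "generic x" and "g \<in> carrier \<Gamma>"
  shows "generic (g \<bullet>\<bullet> x)"
proof -
  have x: "x \<in> H" using assms(1) by (simp add: generic_def)
  have gx: "g \<bullet>\<bullet> x \<in> H" using H_conj assms(2) x by blast
  have "\<exists>k\<in>carrier \<Gamma>. k \<bullet>\<bullet> g \<bullet>\<bullet> x \<in> U" if U: "openin X U" "U \<noteq> {}" for U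
  proof -
    obtain k where k: "k \<in> carrier \<Gamma>" "k \<bullet>\<bullet> x \<in> U" using assms(1) U unfolding generic_def by blast
    then have "(k \<otimes> inv g) \<bullet>\<bullet> g \<bullet>\<bullet> x \<in> U" using assms(2) x gx by (simp add: act_mult act_inv)
    then show ?thesis using k(1) assms(2) by blast
  qed
  moreover have "approx n (g \<bullet>\<bullet> x) (g \<bullet>\<bullet> x)" for n
  proof -
    obtain m where m: "\<And>v. v \<in> V m \<Longrightarrow> g \<otimes> v \<otimes> inv g \<in> V n" using V_conj_le[OF assms(2)] by metis
    obtain U where U: "openin X U" "x \<in> U"
      "\<And>Y. openin X Y \<Longrightarrow> Y \<noteq> {} \<Longrightarrow> Y \<subseteq> U \<Longrightarrow> \<exists>v\<in>V m. v \<bullet>\<bullet> x \<in> Y"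
      using assms(1) unfolding generic_def approx_def by metis
    show ?thesis
      unfolding approx_def
    proof (intro exI conjI allI impI)
      let ?U = "{w \<in> H. inv g \<bullet>\<bullet> w \<in> U}"
      show "openin X ?U" using openin_act_vimage U(1) assms(2) by blast
      show "g \<bullet>\<bullet> x \<in> ?U" using gx U(2) x assms(2) by (simp add: act_inv)
      fix Y assume Y: "openin X Y \<and> Y \<noteq> {} \<and> Y \<subseteq> ?U"
      then obtain y where y: "y \<in> Y" "y \<in> H" by blast
      let ?Y = "{w \<in> H. g \<bullet>\<bullet> w \<in> Y}"
      have "inv g \<bullet>\<bullet> y \<in> ?Y"
        using y assms(2) H_conj act_inv[of "inv g" y] by simp
      moreover have "?Y \<subseteq> U"
      proof
        fix w assume "w \<in> ?Y"
        then have "w \<in> H" "g \<bullet>\<bullet> w \<in> ?U" using Y by blast+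
        then show "w \<in> U" using assms(2) by (simp add: act_inv)
      qed
      moreover have "openin X ?Y" using openin_act_vimage Y assms(2) by blast
      ultimately obtain v where v: "v \<in> V m" "g \<bullet>\<bullet> v \<bullet>\<bullet> x \<in> Y" using U(3)[of ?Y] by blast
      have "(g \<otimes> v \<otimes> inv g) \<bullet>\<bullet> g \<bullet>\<bullet> x = g \<bullet>\<bullet> v \<bullet>\<bullet> x"
        using assms(2) V_carrier[OF v(1)] x gx by (simp add: act_mult act_inv H_conj)
      then show "\<exists>v\<in>V n. v \<bullet>\<bullet> g \<bullet>\<bullet> x \<in> Y" using m[OF v(1)] v(2) by metis
    qed
  qed
  ultimately show ?thesis using gx by (simp add: generic_def)
qed

text \<open>The difference of the two conjugates of \<open>w\<close> is
  \<open>inv g \<otimes> e k\<close> conjugated by \<open>g \<otimes> w\<close>, times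
  \<open>g \<otimes> inv (e k)\<close>. Hence both one-sided differences must be small, and the
  threshold depends on \<open>w\<close>.\<close>

lemma act_limit:
  assumes "g \<in> carrier \<Gamma>" and "\<And>k. e k \<in> carrier \<Gamma>"
    and "\<And>k. g \<otimes> inv (e k) \<in> V k" and "\<And>k. inv g \<otimes> e k \<in> V k" and "w \<in> H"
  shows "\<exists>K. \<forall>k\<ge>K. (g \<bullet>\<bullet> w) \<otimes> inv (e k \<bullet>\<bullet> w) \<in> V n"
proof -
  have w: "w \<in> carrier \<Gamma>" using H_carrier assms(5) by blast
  obtain m where m: "m \<ge> n" "\<And>v. v \<in> V m \<Longrightarrow> (g \<otimes> w) \<otimes> v \<otimes> inv (g \<otimes> w) \<in> V n"
    using V_conj_le[of "g \<otimes> w"] assms(1) w by (metis m_closed)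
  have "(g \<bullet>\<bullet> w) \<otimes> inv (e k \<bullet>\<bullet> w) \<in> V n" if "k \<ge> m" for k
  proof -
    have "(g \<otimes> w) \<otimes> (inv g \<otimes> e k) \<otimes> inv (g \<otimes> w) \<in> V n"
      using m(2) assms(4)[of k] V_decreasing[OF that] by blast
    moreover have "g \<otimes> inv (e k) \<in> V n"
      using assms(3)[of k] V_decreasing[of n k] m(1) that by auto
    ultimately have "((g \<otimes> w) \<otimes> (inv g \<otimes> e k) \<otimes> inv (g \<otimes> w)) \<otimes> (g \<otimes> inv (e k)) \<in> V n"
      by (rule V_mult)
    then show ?thesis
      using assms(1,2) w by (simp add: conj_action_def word_simps)
  qed
  then show ?thesis by blast
qed

text \<open>Conjugators for \<open>x\<close> and for \<open>y\<close> are corrected in turn so that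
  the two conjugates approach each other. Their limits satisfy
  \<open>g 0 \<bullet>\<bullet> x = g 1 \<bullet>\<bullet> y\<close>.\<close>

theorem generic_conjugate:
  assumes "generic x" and "generic y"
  shows "\<exists>g\<in>carrier \<Gamma>. y = g \<bullet>\<bullet> x"
proof -
  define z where "z k = (if even k then x else y)" for k :: nat
  have z: "generic (z k)" and zH: "z k \<in> H" for k
    using assms by (auto simp: z_def generic_def)
  \<comment> \<open>In a state \<open>(a, b, m)\<close>, \<open>a\<close> acts on \<open>z k\<close>
    and \<open>b\<close> on the other point, and \<open>V m\<close> can still move the first
    conjugate arbitrarily close to the second. The bound on
    \<open>inv a \<otimes> v \<otimes> a\<close> makes a later correction of \<open>a\<close> from
    \<open>V m\<close> small on the other side too, as \<open>V_complete\<close> requires.\<close>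
  define good where "good k s \<longleftrightarrow> (case s of (a, b, m) \<Rightarrow>
    a \<in> carrier \<Gamma> \<and> b \<in> carrier \<Gamma> \<and> k \<le> m \<and> approx m (a \<bullet>\<bullet> z k) (b \<bullet>\<bullet> z (Suc k)) \<and>
    (\<forall>v\<in>V m. inv a \<otimes> v \<otimes> a \<in> V k))" for k and s :: "'a \<times> 'a \<times> nat"
  \<comment> \<open>The older conjugator is corrected by a factor from \<open>V m\<close> and
    becomes the newer one, so the two points exchange roles with the parity of
    \<open>k\<close>.\<close>
  define step where "step k s t \<longleftrightarrow> (case s of (a, b, m) \<Rightarrow> case t of (a', b', m') \<Rightarrow>
    a' = b \<and> (\<exists>v\<in>V m. b' = v \<otimes> a) \<and> b' \<bullet>\<bullet> z k \<in> nbd k (b \<bullet>\<bullet> z (Suc k)))"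
    for k and s t :: "'a \<times> 'a \<times> nat"
  have "\<exists>f. \<forall>k. good k (f k) \<and> step k (f k) (f (Suc k))"
  proof (rule dependent_nat_choice)
    obtain U where U: "openin X U" "x \<in> U"
      "\<And>Y. openin X Y \<Longrightarrow> Y \<noteq> {} \<Longrightarrow> Y \<subseteq> U \<Longrightarrow> \<exists>v\<in>V 0. v \<bullet>\<bullet> x \<in> Y"
      using assms(1) unfolding generic_def approx_def by metis
    obtain g where g: "g \<in> carrier \<Gamma>" "g \<bullet>\<bullet> y \<in> U"
      using assms(2) U(1,2) unfolding generic_def by blast
    \<comment> \<open>The dense orbit of \<open>y\<close> brings it to where the
      \<open>V 0\<close>-orbit of \<open>x\<close> is dense, so the conjugator of \<open>x\<close>
      can start at \<open>\<one>\<close>.\<close>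
    have "approx 0 x (g \<bullet>\<bullet> y)" using U g unfolding approx_def by blast
    then have "good 0 (\<one>, g, 0)"
      using g(1) zH[of 0] V_carrier by (auto simp: good_def z_def act_one)
    then show "\<exists>s. good 0 s" by blast
  next
    fix s k assume "good k s"
    then obtain a b m where s: "s = (a, b, m)" and ab: "a \<in> carrier \<Gamma>" "b \<in> carrier \<Gamma>"
      and ap: "approx m (a \<bullet>\<bullet> z k) (b \<bullet>\<bullet> z (Suc k))"
      by (auto simp: good_def split: prod.splits)
    have bz: "b \<bullet>\<bullet> z (Suc k) \<in> H" using H_conj ab(2) zH by blast
    obtain U where U: "openin X U" "b \<bullet>\<bullet> z (Suc k) \<in> U"
      "\<And>Y. openin X Y \<Longrightarrow> Y \<noteq> {} \<Longrightarrow> Y \<subseteq> U \<Longrightarrow> \<exists>v\<in>V m. v \<bullet>\<bullet> a \<bullet>\<bullet> z k \<in> Y"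
      using ap unfolding approx_def by metis
    obtain m' where m': "m' \<ge> Suc k" "\<And>v. v \<in> V m' \<Longrightarrow> inv b \<otimes> v \<otimes> inv (inv b) \<in> V (Suc k)"
      using V_conj_le[of "inv b"] ab(2) by (metis inv_closed)
    \<comment> \<open>Genericity of \<open>b \<bullet>\<bullet> z (Suc k)\<close> at the new level
      \<open>m'\<close>. Sending the other point into \<open>U1\<close> as well keeps it
      approximable by this orbit, which is the invariant with the roles exchanged.\<close>
    obtain U1 where U1: "openin X U1" "b \<bullet>\<bullet> z (Suc k) \<in> U1"
      "\<And>Y. openin X Y \<Longrightarrow> Y \<noteq> {} \<Longrightarrow> Y \<subseteq> U1 \<Longrightarrow> \<exists>v\<in>V m'. v \<bullet>\<bullet> b \<bullet>\<bullet> z (Suc k) \<in> Y"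
      using generic_act[OF z ab(2), of "Suc k"] unfolding generic_def approx_def by metis
    let ?Y = "U \<inter> U1 \<inter> nbd k (b \<bullet>\<bullet> z (Suc k))"
    have "openin X ?Y" using U(1) U1(1) openin_nbd bz by blast
    moreover have "b \<bullet>\<bullet> z (Suc k) \<in> ?Y" using U(2) U1(2) nbd_self bz by blast
    ultimately obtain v where v: "v \<in> V m" "v \<bullet>\<bullet> a \<bullet>\<bullet> z k \<in> ?Y"
      using U(3)[of ?Y] by blast
    have va: "v \<bullet>\<bullet> a \<bullet>\<bullet> z k = (v \<otimes> a) \<bullet>\<bullet> z k" using V_carrier v(1) ab(1) zH by (simp add: act_mult)
    have "approx m' (b \<bullet>\<bullet> z (Suc k)) ((v \<otimes> a) \<bullet>\<bullet> z k)"
      unfolding approx_def using U1 v(2) va by (intro exI[of _ U1]) auto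
    moreover have "z (Suc (Suc k)) = z k" by (simp add: z_def)
    ultimately have "good (Suc k) (b, v \<otimes> a, m') \<and> step k s (b, v \<otimes> a, m')"
      using ab m' v va V_carrier by (auto simp: good_def step_def s)
    then show "\<exists>t. good (Suc k) t \<and> step k s t" ..
  qed
  then obtain f where f: "\<And>k. good k (f k)" "\<And>k. step k (f k) (f (Suc k))" by blast
  define a m where "a k = fst (f k)" and "m k = snd (snd (f k))" for k
  have a: "f k = (a k, a (Suc k), m k)" for k
    using f(2)[of k] by (auto simp: a_def m_def step_def split: prod.splits)
  have aC: "a k \<in> carrier \<Gamma>" and mk: "k \<le> m k" and ak: "\<And>v. v \<in> V (m k) \<Longrightarrow> inv (a k) \<otimes> v \<otimes> a k \<in> V k" for k
    using f(1)[of k] by (auto simp: a good_def)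
  have astep: "\<exists>v\<in>V (m k). a (Suc (Suc k)) = v \<otimes> a k"
    and near: "a (Suc (Suc k)) \<bullet>\<bullet> z k \<in> nbd k (a (Suc k) \<bullet>\<bullet> z (Suc k))" for k
    using f(2)[of k] by (auto simp: a step_def)
  \<comment> \<open>Consecutive conjugators of the same point are two steps apart:
    \<open>i = 0\<close> collects those acting on \<open>x\<close>, \<open>i = 1\<close> those
    acting on \<open>y\<close>.\<close>
  have "\<exists>g\<in>carrier \<Gamma>. \<forall>k. g \<otimes> inv (a (2 * k + i)) \<in> V k \<and> inv g \<otimes> a (2 * k + i) \<in> V k" for i
  proof (rule V_complete)
    fix k
    obtain v where v: "v \<in> V (m (2 * k + i))" "a (2 * Suc k + i) = v \<otimes> a (2 * k + i)"
      using astep[of "2 * k + i"] by auto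
    have le: "V (2 * k + i) \<subseteq> V k" "V (m (2 * k + i)) \<subseteq> V k"
      using V_decreasing mk[of "2 * k + i"] by simp_all
    show "a (2 * Suc k + i) \<otimes> inv (a (2 * k + i)) \<in> V k"
      using v le(2) aC V_carrier[OF v(1)] by (auto simp: word_simps)
    show "inv (a (2 * Suc k + i)) \<otimes> a (2 * k + i) \<in> V k"
      using ak[OF V_inv[OF v(1)]] le(1) aC V_carrier[OF v(1)] v(2) by (auto simp: word_simps)
  qed (rule aC)
  then obtain g where g: "\<And>i. g i \<in> carrier \<Gamma>" "\<And>i k. g i \<otimes> inv (a (2 * k + i)) \<in> V k"
    "\<And>i k. inv (g i) \<otimes> a (2 * k + i) \<in> V k" for i :: nat
    by metis
  have xy: "x \<in> H" "y \<in> H" using assms by (auto simp: generic_def)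
  have gH: "g 0 \<bullet>\<bullet> x \<in> carrier \<Gamma>" "g 1 \<bullet>\<bullet> y \<in> carrier \<Gamma>" using g(1) xy by (simp_all add: H_carrier)
  have "(g 0 \<bullet>\<bullet> x) \<otimes> inv (g 1 \<bullet>\<bullet> y) \<in> V n" for n
  proof -
    obtain K0 where K0: "\<forall>k\<ge>K0. (g 0 \<bullet>\<bullet> x) \<otimes> inv (a (2 * k + 0) \<bullet>\<bullet> x) \<in> V n"
      using act_limit[OF g(1) aC g(2,3) xy(1)] by blast
    obtain K1 where K1: "\<forall>k\<ge>K1. (g 1 \<bullet>\<bullet> y) \<otimes> inv (a (2 * k + 1) \<bullet>\<bullet> y) \<in> V n"
      using act_limit[OF g(1) aC g(2,3) xy(2)] by blast
    \<comment> \<open>At \<open>2 * k\<close>, \<open>near\<close> compares the conjugators with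
      indices \<open>2 * k + 2\<close> and \<open>2 * k + 1\<close>; so the limit for
      \<open>x\<close> is used at \<open>Suc k\<close> and the one for \<open>y\<close> at
      \<open>k\<close>.\<close>
    define k where "k = max n (max K0 K1)"
    have "n \<le> k" by (simp add: k_def)
    have 1: "(g 0 \<bullet>\<bullet> x) \<otimes> inv (a (Suc (Suc (2 * k))) \<bullet>\<bullet> x) \<in> V n"
      using K0[rule_format, of "Suc k"] by (simp add: k_def)
    have 2: "(g 1 \<bullet>\<bullet> y) \<otimes> inv (a (Suc (2 * k)) \<bullet>\<bullet> y) \<in> V n"
      using K1[rule_format, of k] by (simp add: k_def)
    have "(a (Suc (Suc (2 * k))) \<bullet>\<bullet> x) \<otimes> inv (a (Suc (2 * k)) \<bullet>\<bullet> y) \<in> V (2 * k)"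
      using near[of "2 * k"] by (simp add: nbd_def z_def)
    then have 3: "(a (Suc (Suc (2 * k))) \<bullet>\<bullet> x) \<otimes> inv (a (Suc (2 * k)) \<bullet>\<bullet> y) \<in> V n"
      using V_decreasing[of n "2 * k"] \<open>n \<le> k\<close> by auto
    have C: "a (Suc (Suc (2 * k))) \<bullet>\<bullet> x \<in> carrier \<Gamma>" "a (Suc (2 * k)) \<bullet>\<bullet> y \<in> carrier \<Gamma>"
      using aC xy by (simp_all add: H_carrier)
    show ?thesis
      using V_trans[OF V_trans[OF 1 3] V_sym[OF 2]] C gH by blast
  qed
  then have "(g 0 \<bullet>\<bullet> x) \<otimes> inv (g 1 \<bullet>\<bullet> y) = \<one>" using V_separated by blast
  then have "g 0 \<bullet>\<bullet> x = g 1 \<bullet>\<bullet> y"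
    using gH inv_equality[of "g 0 \<bullet>\<bullet> x" "inv (g 1 \<bullet>\<bullet> y)"] by simp
  then have "y = (inv (g 1) \<otimes> g 0) \<bullet>\<bullet> x"
    using g(1) xy by (simp add: act_mult act_inv)
  then show ?thesis using g(1) by blast
qed

theorem transitive_imp_comeager_orbit:
  assumes transitive and locally_transitive
  shows "\<exists>h\<in>H. comeager_in X (orbit \<Gamma> (conj_action \<Gamma>) h)"
proof -
  note gc = generic_comeager[OF assms]
  obtain h where h: "generic h" using comeager_meets_open[OF gc openin_H H_nonempty] by blast
  then have hH: "h \<in> H" by (simp add: generic_def)
  have "{x. generic x} \<subseteq> orbit \<Gamma> (conj_action \<Gamma>) h"
    using generic_conjugate[OF h] by (auto simp: orbit_def)
  moreover have "orbit \<Gamma> (conj_action \<Gamma>) h \<subseteq> topspace X"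
    using H_conj hH by (auto simp: orbit_def)
  moreover obtain \<D> where "countable \<D>" "\<And>D. D \<in> \<D> \<Longrightarrow> dense_open X D"
    "topspace X \<inter> \<Inter>\<D> \<subseteq> {x. generic x}"
    using comeager_inE[OF gc] by blast
  ultimately have "comeager_in X (orbit \<Gamma> (conj_action \<Gamma>) h)"
    by (intro comeager_inI[of \<D>]) auto
  then show ?thesis using hH by blast
qed

end

section \<open>Epimorphisms\<close>

lemma compose_tuples:
  "\<lbrakk>x \<in> tuples S n; \<And>s. s \<in> S \<Longrightarrow> \<phi> s \<in> T\<rbrakk> \<Longrightarrow> compose {..<n} \<phi> x \<in> tuples T n"
  by (simp add: tuples_def PiE_iff compose_def)

lemma compose_compose_tuple:
  "compose {..<n} \<pi> (compose {..<n} \<phi> x) = compose {..<n} (\<lambda>i. \<pi> (\<phi> i)) x"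
  by (simp add: compose_def fun_eq_iff restrict_def)

lemma compose_cong_tuples:
  assumes "x \<in> tuples S n" and "\<And>s. s \<in> S \<Longrightarrow> \<phi> s = \<psi> s"
  shows "compose {..<n} \<phi> x = compose {..<n} \<psi> x"
  using assms by (simp add: compose_def fun_eq_iff restrict_def tuples_def PiE_iff)

lemma compose_id_tuples:
  assumes "x \<in> tuples S n" and "\<And>s. s \<in> S \<Longrightarrow> \<phi> s = s"
  shows "compose {..<n} \<phi> x = x"
  using assms by (auto simp: compose_def fun_eq_iff restrict_def tuples_def PiE_iff extensional_def)

lemma surj_tuples:
  assumes "y \<in> tuples T n" and "\<phi> ` S = T"
  obtains x where "x \<in> tuples S n" "compose {..<n} \<phi> x = y"
proof -
  have *: "inv_into S \<phi> t \<in> S" "\<phi> (inv_into S \<phi> t) = t" if "t \<in> T" for t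
    using that assms(2) inv_into_into[of t \<phi> S] f_inv_into_f[of t \<phi> S] by simp_all
  show ?thesis
  proof
    show "compose {..<n} (inv_into S \<phi>) y \<in> tuples S n"
      by (rule compose_tuples[OF assms(1) *(1)])
    show "compose {..<n} \<phi> (compose {..<n} (inv_into S \<phi>) y) = y"
      unfolding compose_compose_tuple by (rule compose_id_tuples[OF assms(1) *(2)])
  qed
qed

lemma inj_on_compose_tuples:
  assumes "inj_on \<phi> S" and "x \<in> tuples S n" and "y \<in> tuples S n"
    and "compose {..<n} \<phi> x = compose {..<n} \<phi> y"
  shows "x = y"
proof
  fix i
  show "x i = y i"
  proof (cases "i < n")
    case True
    then have "\<phi> (x i) = \<phi> (y i)" using fun_cong[OF assms(4), of i] by (simp add: compose_def)
    moreover have "x i \<in> S" "y i \<in> S" using True assms(2,3) by (auto simp: tuples_def PiE_iff)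
    ultimately show ?thesis using inj_onD[OF assms(1)] by simp
  next
    case False
    then show ?thesis using assms(2,3) by (simp add: tuples_def PiE_iff extensional_def)
  qed
qed

lemma Fun_closed:
  assumes "topological_structure L A" and "f \<in> funs L" and "x \<in> tuples (Carrier A) (far L f)"
  shows "Fun A f x \<in> Carrier A"
proof -
  have "continuous_map (power_top (Top A) (far L f)) (Top A) (Fun A f)"
    using assms(1,2) by (simp add: topological_structure_def)
  then show ?thesis
    using assms(3) by (auto simp: continuous_map_def topspace_power_top)
qed

lemma Rel_subset:
  assumes "topological_structure L A" and "q \<in> rels L" and "x \<in> Rel A q"
  shows "x \<in> tuples (Carrier A) (rar L q)"
proof -
  have "closedin (power_top (Top A) (rar L q)) (Rel A q)"
    using assms(1,2) by (simp add: topological_structure_def)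
  then show ?thesis
    using assms(3) closedin_subset[of _ "Rel A q"] topspace_power_top[of "Top A" "rar L q"] by auto
qed

text \<open>Finite Hausdorff spaces are discrete. Hence maps out of a member of \<open>G\<close> are
  continuous for free, and epimorphisms onto it are locally constant.\<close>

lemma finite_structure_discrete:
  assumes "topological_structure L A" and "finite (Carrier A)"
  shows "Top A = discrete_topology (Carrier A)"
proof -
  have H: "Hausdorff_space (Top A)" using assms(1) by (simp add: topological_structure_def)
  have "openin (Top A) {x}" if x: "x \<in> Carrier A" for x
  proof -
    have "compactin (Top A) (Carrier A - {x})"
      using assms(2) by (simp add: finite_imp_compactin_eq)
    then have "closedin (Top A) (Carrier A - {x})"
      by (rule compactin_imp_closedin[OF H])
    then have "openin (Top A) (Carrier A - (Carrier A - {x}))" by (rule openin_diff[OF openin_topspace])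
    moreover have "Carrier A - (Carrier A - {x}) = {x}" using x by auto
    ultimately show ?thesis by simp
  qed
  then show ?thesis
    using discrete_topology_unique[of "Carrier A" "Top A"] by simp
qed

section \<open>Composing and factoring epimorphisms\<close>

lemma epimorphism_surj: "epimorphism L B A \<phi> \<Longrightarrow> \<phi> ` Carrier B = Carrier A"
  by (simp add: epimorphism_def)

lemma epimorphism_Fun:
  "\<lbrakk>epimorphism L B A \<phi>; f \<in> funs L; x \<in> tuples (Carrier B) (far L f)\<rbrakk>
    \<Longrightarrow> Fun A f (compose {..<far L f} \<phi> x) = \<phi> (Fun B f x)"
  by (simp add: epimorphism_def)

lemma epimorphism_Rel:
  "\<lbrakk>epimorphism L B A \<phi>; q \<in> rels L; x \<in> tuples (Carrier A) (rar L q)\<rbrakk>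
    \<Longrightarrow> x \<in> Rel A q \<longleftrightarrow>
      (\<exists>y\<in>tuples (Carrier B) (rar L q). compose {..<rar L q} \<phi> y = x \<and> y \<in> Rel B q)"
  by (simp add: epimorphism_def)

lemma epimorphism_compose:
  assumes \<psi>: "epimorphism L C B \<psi>" and \<phi>: "epimorphism L B A \<phi>"
  shows "epimorphism L C A (\<lambda>x. \<phi> (\<psi> x))"
  unfolding epimorphism_def
proof (intro conjI ballI)
  show "continuous_map (Top C) (Top A) (\<lambda>x. \<phi> (\<psi> x))"
    using assms continuous_map_compose[of "Top C" "Top B" \<psi> "Top A" \<phi>]
    by (simp add: epimorphism_def comp_def)
  have surj: "\<psi> ` Carrier C = Carrier B" "\<phi> ` Carrier B = Carrier A"
    using assms by (simp_all add: epimorphism_def)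
  then show "(\<lambda>x. \<phi> (\<psi> x)) ` Carrier C = Carrier A"
    by (metis image_image)
  have \<psi>B: "\<psi> x \<in> Carrier B" if "x \<in> Carrier C" for x using that surj(1) by auto
  have \<phi>A: "\<phi> x \<in> Carrier A" if "x \<in> Carrier B" for x using that surj(2) by auto
  show "Fun A f (compose {..<far L f} (\<lambda>x. \<phi> (\<psi> x)) x) = \<phi> (\<psi> (Fun C f x))"
    if "f \<in> funs L" "x \<in> tuples (Carrier C) (far L f)" for f x
    using epimorphism_Fun[OF \<phi> that(1) compose_tuples[OF that(2) \<psi>B]] epimorphism_Fun[OF \<psi> that]
    by (simp add: compose_compose_tuple)
  fix q x assume q: "q \<in> rels L" and x: "x \<in> tuples (Carrier A) (rar L q)"
  show "x \<in> Rel A q \<longleftrightarrow> (\<exists>z\<in>tuples (Carrier C) (rar L q).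
      compose {..<rar L q} (\<lambda>x. \<phi> (\<psi> x)) z = x \<and> z \<in> Rel C q)" (is "_ \<longleftrightarrow> ?R")
  proof
    assume "x \<in> Rel A q"
    then obtain y where y: "y \<in> tuples (Carrier B) (rar L q)" "compose {..<rar L q} \<phi> y = x" "y \<in> Rel B q"
      using epimorphism_Rel[OF \<phi> q x] by auto
    then obtain z where z: "z \<in> tuples (Carrier C) (rar L q)" "compose {..<rar L q} \<psi> z = y" "z \<in> Rel C q"
      using epimorphism_Rel[OF \<psi> q y(1)] by auto
    then show ?R
      using y(2) compose_compose_tuple[of "rar L q" \<phi> \<psi> z] by auto
  next
    assume ?R
    then obtain z where z: "z \<in> tuples (Carrier C) (rar L q)"
      "compose {..<rar L q} (\<lambda>x. \<phi> (\<psi> x)) z = x" "z \<in> Rel C q"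
      by auto
    let ?y = "compose {..<rar L q} \<psi> z"
    have y: "?y \<in> tuples (Carrier B) (rar L q)" using compose_tuples[OF z(1) \<psi>B] .
    then have "?y \<in> Rel B q" using epimorphism_Rel[OF \<psi> q y] z by auto
    moreover have "compose {..<rar L q} \<phi> ?y = x" using z(2) by (simp add: compose_compose_tuple)
    ultimately show "x \<in> Rel A q" using epimorphism_Rel[OF \<phi> q x] y by auto
  qed
qed

text \<open>Every tuple of \<open>B\<close>, and every related tuple, lifts along \<phi> to
  \<open>P\<close>, where \<pi> turns into \<psi>; so each clause for \<pi> is read off from \<phi>
  and \<psi>. Continuity is automatic since \<open>B\<close> is discrete.\<close>

lemma epimorphism_factor:
  assumes \<phi>: "epimorphism L P B \<phi>" and \<psi>: "epimorphism L P A \<psi>"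
    and \<pi>: "\<And>x. x \<in> Carrier P \<Longrightarrow> \<pi> (\<phi> x) = \<psi> x"
    and P: "topological_structure L P" and B: "topological_structure L B" "finite (Carrier B)"
  shows "epimorphism L B A \<pi>"
  unfolding epimorphism_def
proof (intro conjI ballI)
  have surj: "\<phi> ` Carrier P = Carrier B" "\<psi> ` Carrier P = Carrier A"
    using \<phi> \<psi> by (simp_all add: epimorphism_def)
  have "\<pi> ` Carrier B = (\<lambda>x. \<pi> (\<phi> x)) ` Carrier P" using surj(1) by (metis image_image)
  also have "\<dots> = \<psi> ` Carrier P" using \<pi> by (rule image_cong[OF refl])
  finally show im: "\<pi> ` Carrier B = Carrier A" using surj(2) by simp
  then have "\<pi> \<in> Carrier B \<rightarrow> Carrier A" by auto
  then show "continuous_map (Top B) (Top A) \<pi>"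
    using finite_structure_discrete[OF B] continuous_map_from_discrete_topology[of "Carrier B" "Top A" \<pi>]
    by simp
  have \<pi>\<phi>: "compose {..<n} \<pi> (compose {..<n} \<phi> x) = compose {..<n} \<psi> x" if "x \<in> tuples (Carrier P) n" for x n
    unfolding compose_compose_tuple by (rule compose_cong_tuples[OF that \<pi>])
  show "Fun A f (compose {..<far L f} \<pi> y) = \<pi> (Fun B f y)"
    if f: "f \<in> funs L" and y: "y \<in> tuples (Carrier B) (far L f)" for f y
  proof -
    obtain x where x: "x \<in> tuples (Carrier P) (far L f)" "compose {..<far L f} \<phi> x = y"
      using surj_tuples[OF y surj(1)] .
    have "Fun A f (compose {..<far L f} \<pi> y) = \<psi> (Fun P f x)"
      using \<pi>\<phi>[OF x(1)] x(2) epimorphism_Fun[OF \<psi> f x(1)] by simp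
    also have "\<dots> = \<pi> (\<phi> (Fun P f x))" using \<pi> Fun_closed[OF P f x(1)] by simp
    also have "\<dots> = \<pi> (Fun B f y)" using epimorphism_Fun[OF \<phi> f x(1)] x(2) by simp
    finally show ?thesis .
  qed
  fix q x assume q: "q \<in> rels L" and x: "x \<in> tuples (Carrier A) (rar L q)"
  show "x \<in> Rel A q \<longleftrightarrow>
      (\<exists>y\<in>tuples (Carrier B) (rar L q). compose {..<rar L q} \<pi> y = x \<and> y \<in> Rel B q)" (is "_ \<longleftrightarrow> ?R")
  proof
    assume "x \<in> Rel A q"
    then obtain z where z: "z \<in> tuples (Carrier P) (rar L q)" "compose {..<rar L q} \<psi> z = x" "z \<in> Rel P q"
      using epimorphism_Rel[OF \<psi> q x] by auto
    let ?y = "compose {..<rar L q} \<phi> z"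
    have y: "?y \<in> tuples (Carrier B) (rar L q)"
      by (rule compose_tuples[OF z(1)]) (use surj(1) in auto)
    moreover have "?y \<in> Rel B q" using epimorphism_Rel[OF \<phi> q y] z by auto
    ultimately show ?R using \<pi>\<phi>[OF z(1)] z(2) by auto
  next
    assume ?R
    then obtain y where y: "y \<in> tuples (Carrier B) (rar L q)" "compose {..<rar L q} \<pi> y = x" "y \<in> Rel B q"
      by auto
    then obtain z where z: "z \<in> tuples (Carrier P) (rar L q)" "compose {..<rar L q} \<phi> z = y" "z \<in> Rel P q"
      using epimorphism_Rel[OF \<phi> q y(1)] by auto
    then show "x \<in> Rel A q" using epimorphism_Rel[OF \<psi> q x] \<pi>\<phi>[OF z(1)] y(2) by auto
  qed
qed

text \<open>For a bijection the tuple that the relation clause asks for is unique, so the clause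
  becomes preservation in both directions. This form passes to inverses and limits.\<close>

lemma isomorphism_iff:
  assumes "topological_structure L P"
  shows "isomorphism L P P p \<longleftrightarrow> continuous_map (Top P) (Top P) p \<and> bij_betw p (Carrier P) (Carrier P) \<and>
    (\<forall>f\<in>funs L. \<forall>x\<in>tuples (Carrier P) (far L f). Fun P f (compose {..<far L f} p x) = p (Fun P f x)) \<and>
    (\<forall>q\<in>rels L. \<forall>x\<in>tuples (Carrier P) (rar L q). compose {..<rar L q} p x \<in> Rel P q \<longleftrightarrow> x \<in> Rel P q)"
    (is "?I \<longleftrightarrow> ?c \<and> ?b \<and> ?f \<and> ?r")
proof -
  have eq: "(\<forall>q\<in>rels L. \<forall>x\<in>tuples (Carrier P) (rar L q). x \<in> Rel P q \<longleftrightarrow>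
       (\<exists>y\<in>tuples (Carrier P) (rar L q). compose {..<rar L q} p y = x \<and> y \<in> Rel P q)) \<longleftrightarrow> ?r"
    (is "?e \<longleftrightarrow> _") if b: ?b
  proof -
    have inj: "inj_on p (Carrier P)" and surj: "p ` Carrier P = Carrier P"
      using b by (simp_all add: bij_betw_def)
    show ?thesis
    proof
      assume e: ?e
      show ?r
      proof (intro ballI)
        fix q x assume q: "q \<in> rels L" and x: "x \<in> tuples (Carrier P) (rar L q)"
        have px: "compose {..<rar L q} p x \<in> tuples (Carrier P) (rar L q)"
          by (rule compose_tuples[OF x]) (use surj in auto)
        have "compose {..<rar L q} p x \<in> Rel P q \<longleftrightarrow> (\<exists>y\<in>tuples (Carrier P) (rar L q).
            compose {..<rar L q} p y = compose {..<rar L q} p x \<and> y \<in> Rel P q)"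
          using e q px by simp
        also have "\<dots> \<longleftrightarrow> x \<in> Rel P q"
        proof
          assume "\<exists>y\<in>tuples (Carrier P) (rar L q).
            compose {..<rar L q} p y = compose {..<rar L q} p x \<and> y \<in> Rel P q"
          then obtain y where y: "y \<in> tuples (Carrier P) (rar L q)"
            "compose {..<rar L q} p y = compose {..<rar L q} p x" "y \<in> Rel P q" by auto
          then show "x \<in> Rel P q" using inj_on_compose_tuples[OF inj y(1) x y(2)] by simp
        qed (use x in auto)
        finally show "compose {..<rar L q} p x \<in> Rel P q \<longleftrightarrow> x \<in> Rel P q" .
      qed
    next
      assume r: ?r
      show ?e
      proof (intro ballI)
        fix q x assume q: "q \<in> rels L" and x: "x \<in> tuples (Carrier P) (rar L q)"
        obtain y where y: "y \<in> tuples (Carrier P) (rar L q)" "compose {..<rar L q} p y = x"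
          using surj_tuples[OF x surj] .
        show "x \<in> Rel P q \<longleftrightarrow>
          (\<exists>y\<in>tuples (Carrier P) (rar L q). compose {..<rar L q} p y = x \<and> y \<in> Rel P q)"
        proof
          assume "x \<in> Rel P q"
          then have "y \<in> Rel P q" using r q y by auto
          then show "\<exists>y\<in>tuples (Carrier P) (rar L q). compose {..<rar L q} p y = x \<and> y \<in> Rel P q"
            using y by auto
        next
          assume "\<exists>y\<in>tuples (Carrier P) (rar L q). compose {..<rar L q} p y = x \<and> y \<in> Rel P q"
          then show "x \<in> Rel P q" using r q by auto
        qed
      qed
    qed
  qed
  show ?thesis
  proof (cases ?b)
    case True
    then have im: "p ` Carrier P = Carrier P" by (simp add: bij_betw_def)
    show ?thesis
      unfolding isomorphism_def epimorphism_def eq[OF True] using True im by (simp only: simp_thms)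
  next
    case False
    then show ?thesis unfolding isomorphism_def by (simp only: simp_thms)
  qed
qed

text \<open>Since \<open>s\<close> is new, the clauses for the other symbols are unchanged. The
  clause for \<open>s\<close> says that \<open>R\<close> is the image of \<open>S\<close>, because
  pairs over a carrier correspond to its extensional 2-tuples.\<close>

lemma epimorphism_expand_iff:
  fixes L :: "('f, 'r) language" and B :: "('b, 'f, 'r) lstruct" and A :: "('a, 'f, 'r) lstruct"
  assumes "s \<notin> rels L" and "S \<subseteq> Carrier B \<times> Carrier B" and "R \<subseteq> Carrier A \<times> Carrier A"
  shows "epimorphism (expand_language L s) (expand s B S) (expand s A R) \<phi> \<longleftrightarrow>
    epimorphism L B A \<phi> \<and> map_prod \<phi> \<phi> ` S = R"
proof -
  let ?L = "expand_language L s" and ?B = "expand s B S" and ?A = "expand s A R"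
  let ?C = "\<lambda>(L::('f, 'r) language) (B::('b, 'f, 'r) lstruct) (A::('a, 'f, 'r) lstruct) q.
    \<forall>x\<in>tuples (Carrier A) (rar L q). x \<in> Rel A q \<longleftrightarrow>
      (\<exists>y\<in>tuples (Carrier B) (rar L q). compose {..<rar L q} \<phi> y = x \<and> y \<in> Rel B q)"
  have rest: "?C ?L ?B ?A q \<longleftrightarrow> ?C L B A q" if "q \<in> rels L" for q
  proof -
    have "q \<noteq> s" using that assms(1) by auto
    then show ?thesis by (simp add: expand_def expand_language_def)
  qed
  have s: "?C ?L ?B ?A s \<longleftrightarrow> map_prod \<phi> \<phi> ` S = R" if surj: "\<phi> ` Carrier B = Carrier A"
  proof -
    have "?C ?L ?B ?A s \<longleftrightarrow> (\<forall>x\<in>tuples (Carrier A) 2. (x 0, x 1) \<in> R \<longleftrightarrow>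
        (\<exists>y\<in>tuples (Carrier B) 2. compose {..<2} \<phi> y = x \<and> (y 0, y 1) \<in> S))"
      by (simp add: expand_def expand_language_def)
    also have "\<dots> \<longleftrightarrow> map_prod \<phi> \<phi> ` S = R" (is "?l = ?r")
    proof
      assume l: ?l
      show ?r
      proof (intro equalityI subsetI)
        fix z assume "z \<in> map_prod \<phi> \<phi> ` S"
        then obtain a b where ab: "(a, b) \<in> S" "z = (\<phi> a, \<phi> b)" by auto
        let ?y = "\<lambda>i\<in>{..<2::nat}. if i = 0 then a else b"
        have y: "?y \<in> tuples (Carrier B) 2" using ab(1) assms(2) by (auto simp: tuples_def PiE_iff)
        have "compose {..<2} \<phi> ?y \<in> tuples (Carrier A) 2"
          by (rule compose_tuples[OF y]) (use surj in auto)
        moreover have "(?y 0, ?y 1) \<in> S" using ab(1) by simp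
        ultimately have "(compose {..<2} \<phi> ?y 0, compose {..<2} \<phi> ?y 1) \<in> R" using l y by auto
        then show "z \<in> R" using ab(2) by (simp add: compose_def)
      next
        fix z assume z: "z \<in> R"
        obtain a b where ab: "z = (a, b)" by (cases z)
        let ?x = "\<lambda>i\<in>{..<2::nat}. if i = 0 then a else b"
        have x: "?x \<in> tuples (Carrier A) 2" using z ab assms(3) by (auto simp: tuples_def PiE_iff)
        have "(?x 0, ?x 1) \<in> R" using z ab by simp
        then obtain y where y: "y \<in> tuples (Carrier B) 2" "compose {..<2} \<phi> y = ?x" "(y 0, y 1) \<in> S"
          using l x by auto
        have "\<phi> (y 0) = a" using fun_cong[OF y(2), of 0] by (simp add: compose_def)
        moreover have "\<phi> (y 1) = b" using fun_cong[OF y(2), of 1] by (simp add: compose_def)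
        ultimately have "map_prod \<phi> \<phi> (y 0, y 1) = z" using ab by simp
        then show "z \<in> map_prod \<phi> \<phi> ` S" using y(3) by (metis image_eqI)
      qed
    next
      assume r: ?r
      show ?l
      proof (intro ballI iffI)
        fix x assume x: "x \<in> tuples (Carrier A) 2" "(x 0, x 1) \<in> R"
        then obtain a b where ab: "(a, b) \<in> S" "x 0 = \<phi> a" "x 1 = \<phi> b" using r by auto
        let ?y = "\<lambda>i\<in>{..<2::nat}. if i = 0 then a else b"
        have "?y \<in> tuples (Carrier B) 2" using ab(1) assms(2) by (auto simp: tuples_def PiE_iff)
        moreover have "compose {..<2} \<phi> ?y = x"
        proof
          fix i
          show "compose {..<2} \<phi> ?y i = x i"
          proof (cases "i < 2")
            case True
            then have "i = 0 \<or> i = 1" by auto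
            then show ?thesis using ab by (auto simp: compose_def)
          next
            case False
            then show ?thesis using x(1) by (simp add: compose_def tuples_def PiE_iff extensional_def)
          qed
        qed
        moreover have "(?y 0, ?y 1) \<in> S" using ab(1) by simp
        ultimately show "\<exists>y\<in>tuples (Carrier B) 2. compose {..<2} \<phi> y = x \<and> (y 0, y 1) \<in> S"
          by (intro bexI[of _ ?y] conjI)
      next
        fix x assume "\<exists>y\<in>tuples (Carrier B) 2. compose {..<2} \<phi> y = x \<and> (y 0, y 1) \<in> S"
        then obtain y where y: "compose {..<2} \<phi> y = x" "(y 0, y 1) \<in> S" by auto
        have "(x 0, x 1) = map_prod \<phi> \<phi> (y 0, y 1)"
          using fun_cong[OF y(1), of 0] fun_cong[OF y(1), of 1] by (simp add: compose_def)
        then show "(x 0, x 1) \<in> R" using r y(2) by (metis image_eqI)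
      qed
    qed
    finally show ?thesis .
  qed
  have "epimorphism ?L ?B ?A \<phi> \<longleftrightarrow>
    (continuous_map (Top B) (Top A) \<phi> \<and> \<phi> ` Carrier B = Carrier A \<and>
    (\<forall>f\<in>funs L. \<forall>x\<in>tuples (Carrier B) (far L f). Fun A f (compose {..<far L f} \<phi> x) = \<phi> (Fun B f x)))
    \<and> ?C ?L ?B ?A s \<and> (\<forall>q\<in>rels L. ?C ?L ?B ?A q)"
    unfolding epimorphism_def by (simp add: expand_def expand_language_def)
  also have "\<dots> \<longleftrightarrow> epimorphism L B A \<phi> \<and> map_prod \<phi> \<phi> ` S = R"
  proof (cases "\<phi> ` Carrier B = Carrier A")
    case True
    have "(\<forall>q\<in>rels L. ?C ?L ?B ?A q) \<longleftrightarrow> (\<forall>q\<in>rels L. ?C L B A q)"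
      by (rule ball_cong[OF refl rest])
    then show ?thesis
      unfolding s[OF True] epimorphism_def by argo
  next
    case False
    then show ?thesis unfolding epimorphism_def by (simp only: simp_thms)
  qed
  finally show ?thesis .
qed

section \<open>Projective Fraisse limits\<close>

locale fraisse_limit =
  fixes L :: "('f, 'r) language" and G :: "('a, 'f, 'r) lstruct set" and P :: "('p, 'f, 'r) lstruct"
  assumes G_struct: "A \<in> G \<Longrightarrow> topological_structure L A"
    and G_finite: "A \<in> G \<Longrightarrow> finite (Carrier A)"
    and limit: "projective_Fraisse_limit L G P"
begin

text \<open>Equivalently, \<psi> factors through \<phi> on the carrier. The codomains are arbitrary
  so that epimorphisms, their composites with automorphisms and characteristic functions are treated
  alike.\<close>

definition finer :: "('p \<Rightarrow> 'x) \<Rightarrow> ('p \<Rightarrow> 'y) \<Rightarrow> bool"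
  where "finer \<phi> \<psi> \<longleftrightarrow> (\<forall>x\<in>Carrier P. \<forall>y\<in>Carrier P. \<phi> x = \<phi> y \<longrightarrow> \<psi> x = \<psi> y)"

text \<open>Continuity into a discrete space, without naming the codomain; the image is finite by
  compactness.\<close>

definition loc_const :: "('p \<Rightarrow> 'x) \<Rightarrow> bool"
  where "loc_const \<psi> \<longleftrightarrow> (\<forall>z. openin (Top P) {x \<in> Carrier P. \<psi> x = z})"

lemma finerD: "\<lbrakk>finer \<phi> \<psi>; \<phi> x = \<phi> y; x \<in> Carrier P; y \<in> Carrier P\<rbrakk> \<Longrightarrow> \<psi> x = \<psi> y"
  unfolding finer_def by blast

lemma finer_trans: "finer \<phi> \<psi> \<Longrightarrow> finer \<psi> \<theta> \<Longrightarrow> finer \<phi> \<theta>"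
  unfolding finer_def by blast

lemma finer_refl: "finer \<phi> \<phi>"
  by (simp add: finer_def)

lemma P_struct: "topological_structure L P"
  using limit by (simp add: projective_Fraisse_limit_def)

lemma P_compact: "compact_space (Top P)" and P_Hausdorff: "Hausdorff_space (Top P)"
  and P_dim: "Top P dim_le 0" and P_second_countable: "second_countable (Top P)"
  using P_struct by (simp_all add: topological_structure_def)

lemma ex_epi: "A \<in> G \<Longrightarrow> \<exists>\<phi>. epimorphism L P A \<phi>"
  using limit by (simp add: projective_Fraisse_limit_def)

lemma factor_through_epi:
  fixes X :: "nat set"
  assumes "finite X" and "continuous_map (Top P) (discrete_topology X) f"
  shows "\<exists>A\<in>G. \<exists>\<phi> f0. epimorphism L P A \<phi> \<and> (\<forall>x\<in>Carrier P. f x = f0 (\<phi> x))"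
  using limit assms unfolding projective_Fraisse_limit_def by metis

lemma epis_conjugate:
  "\<lbrakk>A \<in> G; epimorphism L P A \<phi>1; epimorphism L P A \<phi>2\<rbrakk>
    \<Longrightarrow> \<exists>\<psi>. isomorphism L P P \<psi> \<and> (\<forall>x\<in>Carrier P. \<phi>2 x = \<phi>1 (\<psi> x))"
  using limit unfolding projective_Fraisse_limit_def by metis

section \<open>Locally constant maps and their refinement by epimorphisms\<close>

lemma openin_loc_const:
  assumes "loc_const \<psi>"
  shows "openin (Top P) {x \<in> Carrier P. Q (\<psi> x)}"
proof -
  have "openin (Top P) (\<Union>z\<in>{z. Q z}. {x \<in> Carrier P. \<psi> x = z})"
    using assms by (intro openin_Union) (auto simp: loc_const_def)
  moreover have "(\<Union>z\<in>{z. Q z}. {x \<in> Carrier P. \<psi> x = z}) = {x \<in> Carrier P. Q (\<psi> x)}"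
    by auto
  ultimately show ?thesis by simp
qed

lemma closedin_loc_const:
  assumes "loc_const \<psi>"
  shows "closedin (Top P) {x \<in> Carrier P. Q (\<psi> x)}"
proof -
  have "Carrier P - {x \<in> Carrier P. Q (\<psi> x)} = {x \<in> Carrier P. \<not> Q (\<psi> x)}" by auto
  then show ?thesis
    using openin_loc_const[OF assms, of "\<lambda>z. \<not> Q z"] by (simp add: closedin_def)
qed

lemma loc_const_finite:
  assumes "loc_const \<psi>"
  shows "finite (\<psi> ` Carrier P)"
proof -
  let ?F = "\<lambda>z. {x \<in> Carrier P. \<psi> x = z}"
  have "\<exists>\<F>. finite \<F> \<and> \<F> \<subseteq> range ?F \<and> Carrier P \<subseteq> \<Union>\<F>"
    using P_compact unfolding compact_space_def
    by (rule compactinD) (use assms in \<open>auto simp: loc_const_def\<close>)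
  then obtain \<F> where \<F>: "finite \<F>" "\<F> \<subseteq> range ?F" "Carrier P \<subseteq> \<Union>\<F>" by auto
  then obtain Z where Z: "finite Z" "\<F> = ?F ` Z" by (meson finite_subset_image)
  then have "\<psi> ` Carrier P \<subseteq> Z" using \<F>(3) by auto
  then show ?thesis using Z(1) finite_subset by auto
qed

lemma loc_const_pair:
  assumes "loc_const \<psi>" and "loc_const \<theta>"
  shows "loc_const (\<lambda>x. (\<psi> x, \<theta> x))"
  unfolding loc_const_def
proof
  fix z
  have "{x \<in> Carrier P. (\<psi> x, \<theta> x) = z} = {x \<in> Carrier P. \<psi> x = fst z} \<inter> {x \<in> Carrier P. \<theta> x = snd z}"
    by auto
  then show "openin (Top P) {x \<in> Carrier P. (\<psi> x, \<theta> x) = z}"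
    using assms by (simp add: loc_const_def openin_Int)
qed

lemma loc_const_compose:
  assumes "loc_const \<psi>" and "continuous_map (Top P) (Top P) g"
  shows "loc_const (\<lambda>x. \<psi> (g x))"
  unfolding loc_const_def
proof
  fix z
  have "g x \<in> Carrier P" if "x \<in> Carrier P" for x
    using assms(2) that by (auto simp: continuous_map_def)
  then have "{x \<in> Carrier P. g x \<in> {y \<in> Carrier P. \<psi> y = z}} = {x \<in> Carrier P. \<psi> (g x) = z}"
    by auto
  moreover have "openin (Top P) {x \<in> Carrier P. g x \<in> {y \<in> Carrier P. \<psi> y = z}}"
    using openin_continuous_map_preimage[OF assms(2)] assms(1) by (metis loc_const_def)
  ultimately show "openin (Top P) {x \<in> Carrier P. \<psi> (g x) = z}" by simp
qed

lemma loc_const_epi: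
  assumes "A \<in> G" and "epimorphism L P A \<phi>"
  shows "loc_const \<phi>"
  unfolding loc_const_def
proof
  fix z
  have "continuous_map (Top P) (discrete_topology (Carrier A)) \<phi>"
    using assms finite_structure_discrete[OF G_struct G_finite, OF assms(1) assms(1)]
    by (simp add: epimorphism_def)
  then have "openin (Top P) {x \<in> Carrier P. \<phi> x \<in> {z} \<inter> Carrier A}"
    by (rule openin_continuous_map_preimage) simp
  moreover have "{x \<in> Carrier P. \<phi> x \<in> {z} \<inter> Carrier A} = {x \<in> Carrier P. \<phi> x = z}"
    using epimorphism_surj[OF assms(2)] by auto
  ultimately show "openin (Top P) {x \<in> Carrier P. \<phi> x = z}" by simp
qed

lemma loc_const_clopen:
  assumes "openin (Top P) U" and "closedin (Top P) U"
  shows "loc_const (\<lambda>x. x \<in> U)"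
  unfolding loc_const_def
proof
  fix z
  have "U \<subseteq> Carrier P" using assms(1) openin_subset by auto
  then have "{x \<in> Carrier P. (x \<in> U) = z} = (if z then U else Carrier P - U)" by auto
  then show "openin (Top P) {x \<in> Carrier P. (x \<in> U) = z}"
    using assms by (simp add: closedin_def)
qed

text \<open>(L2) speaks of finite sets of natural numbers, so the finite image of \<psi> is first
  coded injectively by numbers.\<close>

lemma epi_refining:
  assumes "loc_const \<psi>"
  shows "\<exists>A\<in>G. \<exists>\<phi>. epimorphism L P A \<phi> \<and> finer \<phi> \<psi>"
proof -
  have fin: "finite (\<psi> ` Carrier P)" using loc_const_finite[OF assms] .
  then obtain e :: "_ \<Rightarrow> nat" where e: "inj_on e (\<psi> ` Carrier P)"
    using finite_imp_inj_to_nat_seg[OF fin] by auto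
  let ?X = "(\<lambda>x. e (\<psi> x)) ` Carrier P"
  have "continuous_map (Top P) (discrete_topology ?X) (\<lambda>x. e (\<psi> x))"
    unfolding continuous_map_def
  proof (intro conjI allI impI)
    show "(\<lambda>x. e (\<psi> x)) \<in> topspace (Top P) \<rightarrow> topspace (discrete_topology ?X)" by simp
    show "openin (Top P) {x \<in> Carrier P. e (\<psi> x) \<in> U}" for U
      by (rule openin_loc_const[OF assms])
  qed
  moreover have "finite ?X" using finite_imageI[OF fin, of e] by (simp add: image_image)
  ultimately obtain A \<phi> f0 where A: "A \<in> G" "epimorphism L P A \<phi>"
    and f0: "\<forall>x\<in>Carrier P. e (\<psi> x) = f0 (\<phi> x)"
    using factor_through_epi[of ?X "\<lambda>x. e (\<psi> x)"] by auto
  have "finer \<phi> \<psi>"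
    unfolding finer_def
  proof (intro ballI impI)
    fix x y assume xy: "x \<in> Carrier P" "y \<in> Carrier P" "\<phi> x = \<phi> y"
    then have "e (\<psi> x) = e (\<psi> y)" using f0 by simp
    then show "\<psi> x = \<psi> y" by (rule inj_onD[OF e]) (use xy in simp_all)
  qed
  then show ?thesis using A by (intro bexI[of _ A] exI[of _ \<phi>]) simp_all
qed

lemma finer_pair: "finer \<phi> (\<lambda>x. (\<psi> x, \<theta> x)) \<longleftrightarrow> finer \<phi> \<psi> \<and> finer \<phi> \<theta>"
  unfolding finer_def prod.inject ball_conj_distrib[symmetric] imp_conjR[symmetric] by (rule refl)

lemma common_refinement:
  assumes "loc_const \<psi>" and "loc_const \<theta>"
  shows "\<exists>A\<in>G. \<exists>\<phi>. epimorphism L P A \<phi> \<and> finer \<phi> \<psi> \<and> finer \<phi> \<theta>"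
  using epi_refining[OF loc_const_pair[OF assms]] unfolding finer_pair .

text \<open>The map is defined by choosing a preimage under \<beta>; fineness makes its value
  independent of the choice.\<close>

lemma finer_epimorphism:
  assumes "B \<in> G" and "epimorphism L P B \<beta>" and "epimorphism L P A \<alpha>" and "finer \<beta> \<alpha>"
  shows "\<exists>\<pi>. epimorphism L B A \<pi> \<and> (\<forall>x\<in>Carrier P. \<pi> (\<beta> x) = \<alpha> x)"
proof -
  let ?\<pi> = "\<lambda>b. \<alpha> (inv_into (Carrier P) \<beta> b)"
  have *: "?\<pi> (\<beta> x) = \<alpha> x" if "x \<in> Carrier P" for x
    using that inv_into_into[of "\<beta> x" \<beta> "Carrier P"] f_inv_into_f[of "\<beta> x" \<beta> "Carrier P"]
    by (intro finerD[OF assms(4)]) simp_all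
  then have "epimorphism L B A ?\<pi>"
    by (rule epimorphism_factor[OF assms(2,3) _ P_struct G_struct[OF assms(1)] G_finite[OF assms(1)]])
  with * show ?thesis by (intro exI[of _ ?\<pi>] conjI ballI)
qed

text \<open>A clopen set is compact, hence a finite union of members of a countable base.\<close>

lemma countable_clopen: "countable {U. openin (Top P) U \<and> closedin (Top P) U}"
proof -
  obtain \<B> where \<B>: "countable \<B>" "\<And>V. V \<in> \<B> \<Longrightarrow> openin (Top P) V"
    "\<And>U x. openin (Top P) U \<Longrightarrow> x \<in> U \<Longrightarrow> \<exists>V\<in>\<B>. x \<in> V \<and> V \<subseteq> U"
    using P_second_countable unfolding second_countable_def by metis
  have "U \<in> Union ` {\<F>. finite \<F> \<and> \<F> \<subseteq> \<B>}" if U: "openin (Top P) U" "closedin (Top P) U" for U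
  proof -
    have "compactin (Top P) U" using closedin_compact_space[OF P_compact U(2)] .
    then have "\<exists>\<F>. finite \<F> \<and> \<F> \<subseteq> {V \<in> \<B>. V \<subseteq> U} \<and> U \<subseteq> \<Union>\<F>"
    proof (rule compactinD)
      show "U \<subseteq> \<Union>{V \<in> \<B>. V \<subseteq> U}" using \<B>(3)[OF U(1)] by blast
    qed (use \<B>(2) in simp)
    then obtain \<F> where "finite \<F>" "\<F> \<subseteq> {V \<in> \<B>. V \<subseteq> U}" "U \<subseteq> \<Union>\<F>" by auto
    then have "\<Union>\<F> \<subseteq> U" "U \<subseteq> \<Union>\<F>" and fin: "\<F> \<in> {\<F>. finite \<F> \<and> \<F> \<subseteq> \<B>}" by auto
    then have "U = \<Union>\<F>" by (intro equalityI)
    from this fin show ?thesis by (rule image_eqI)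
  qed
  then have "{U. openin (Top P) U \<and> closedin (Top P) U} \<subseteq> Union ` {\<F>. finite \<F> \<and> \<F> \<subseteq> \<B>}"
    by auto
  then show ?thesis
    by (rule countable_subset[OF _ countable_image[OF countable_Collect_finite_subset[OF \<B>(1)]]])
qed

text \<open>Each step refines the previous epimorphism together with the characteristic function of
  the next set in an enumeration of the clopen sets.\<close>

lemma ex_cofinal_sequence:
  "\<exists>E \<epsilon>. (\<forall>n. E n \<in> G \<and> epimorphism L P (E n) (\<epsilon> n) \<and> finer (\<epsilon> (Suc n)) (\<epsilon> n)) \<and>
    (\<forall>K. openin (Top P) K \<and> closedin (Top P) K \<longrightarrow> (\<exists>n. finer (\<epsilon> n) (\<lambda>x. x \<in> K)))"
proof -
  let ?C = "{U. openin (Top P) U \<and> closedin (Top P) U}"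
  define K where "K = from_nat_into ?C"
  have "?C \<noteq> {}" using openin_empty closedin_empty by auto
  then have K: "openin (Top P) (K n)" "closedin (Top P) (K n)" for n
    using from_nat_into[of ?C n] unfolding K_def by simp_all
  define good where "good n s \<longleftrightarrow> fst s \<in> G \<and> epimorphism L P (fst s) (snd s)"
    for n :: nat and s :: "('a, 'f, 'r) lstruct \<times> ('p \<Rightarrow> 'a)"
  define step where "step n s t \<longleftrightarrow> finer (snd t) (snd s) \<and> finer (snd t) (\<lambda>x. x \<in> K n)"
    for n and s t :: "('a, 'f, 'r) lstruct \<times> ('p \<Rightarrow> 'a)"
  have "\<exists>f. \<forall>n. good n (f n) \<and> step n (f n) (f (Suc n))"
  proof (rule dependent_nat_choice)
    obtain A \<phi> where "A \<in> G" "epimorphism L P A \<phi>"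
      using epi_refining[OF loc_const_clopen[OF openin_empty closedin_empty]] by auto
    then show "\<exists>s. good 0 s" by (intro exI[of _ "(A, \<phi>)"]) (simp add: good_def)
  next
    fix s n assume s: "good n s"
    have lc: "loc_const (snd s)" using s by (intro loc_const_epi[of "fst s"]) (simp_all add: good_def)
    obtain A \<phi> where "A \<in> G" "epimorphism L P A \<phi>" "finer \<phi> (snd s)" "finer \<phi> (\<lambda>x. x \<in> K n)"
      using common_refinement[OF lc loc_const_clopen[OF K[of n]]] by auto
    then show "\<exists>t. good (Suc n) t \<and> step n s t"
      by (intro exI[of _ "(A, \<phi>)"]) (simp add: good_def step_def)
  qed
  then obtain f where f: "\<And>n. good n (f n)" "\<And>n. step n (f n) (f (Suc n))" by auto
  have "\<exists>n. finer (snd (f n)) (\<lambda>x. x \<in> U)" if U: "openin (Top P) U" "closedin (Top P) U" for U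
  proof -
    have "U \<in> ?C" using U by simp
    then obtain n where "K n = U"
      using from_nat_into_surj[OF countable_clopen] unfolding K_def by metis
    then show ?thesis using f(2)[of n] unfolding step_def by metis
  qed
  then show ?thesis
    using f by (intro exI[of _ "\<lambda>n. fst (f n)"] exI[of _ "\<lambda>n. snd (f n)"]) (simp add: good_def step_def)
qed

text \<open>The image of the graph of \<open>f\<close>: the relation that \<open>s\<close> must have
  on \<open>A\<close> for an epimorphism \<phi> onto \<open>A\<close> to be one from the expansion
  of \<open>P\<close> by \<open>f\<close>.\<close>

definition push :: "('p \<Rightarrow> 'x) \<Rightarrow> ('p \<Rightarrow> 'p) \<Rightarrow> ('x \<times> 'x) set"
  where "push \<phi> f = (\<lambda>x. (\<phi> x, \<phi> (f x))) ` Carrier P"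

section \<open>Automorphisms: the group, and the use of homogeneity (L3)\<close>

lemma Aut_iff: "g \<in> Aut L P \<longleftrightarrow> g \<in> extensional (Carrier P) \<and> isomorphism L P P g"
  by (simp add: Aut_def)

lemmas Aut_isomorphism = Aut_iff[THEN iffD1, THEN conjunct2, unfolded isomorphism_iff[OF P_struct]]

lemmas Aut_continuous = Aut_isomorphism[THEN conjunct1]

lemmas Aut_bij = Aut_isomorphism[THEN conjunct2, THEN conjunct1]

lemmas Aut_Fun = Aut_isomorphism[THEN conjunct2, THEN conjunct2, THEN conjunct1, rule_format]

lemmas Aut_Rel = Aut_isomorphism[THEN conjunct2, THEN conjunct2, THEN conjunct2, rule_format]

lemma Aut_epi: "g \<in> Aut L P \<Longrightarrow> epimorphism L P P g"
  by (simp add: Aut_iff isomorphism_def)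

lemma Aut_in: "\<lbrakk>g \<in> Aut L P; x \<in> Carrier P\<rbrakk> \<Longrightarrow> g x \<in> Carrier P"
  by (rule bij_betw_apply[OF Aut_bij])

lemma Aut_eqI: "\<lbrakk>g \<in> Aut L P; h \<in> Aut L P; \<And>x. x \<in> Carrier P \<Longrightarrow> g x = h x\<rbrakk> \<Longrightarrow> g = h"
  using extensionalityI[of g "Carrier P" h] by (simp add: Aut_iff)

text \<open>Isomorphisms from (L3) have arbitrary values off the carrier, whereas members of
  \<open>Aut\<close> are extensional.\<close>

lemma restrict_isomorphism_Aut:
  assumes "isomorphism L P P p"
  shows "restrict p (Carrier P) \<in> Aut L P"
proof -
  note iso = assms[unfolded isomorphism_iff[OF P_struct]]
  note p = iso[THEN conjunct1] iso[THEN conjunct2, THEN conjunct1]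
  note f = iso[THEN conjunct2, THEN conjunct2, THEN conjunct1, rule_format]
  note q = iso[THEN conjunct2, THEN conjunct2, THEN conjunct2, rule_format]
  have c: "compose {..<n} (restrict p (Carrier P)) x = compose {..<n} p x" if "x \<in> tuples (Carrier P) n" for x n
    by (rule compose_cong_tuples[OF that]) simp
  have "isomorphism L P P (restrict p (Carrier P))"
    unfolding isomorphism_iff[OF P_struct]
  proof (intro conjI ballI)
    show "continuous_map (Top P) (Top P) (restrict p (Carrier P))"
      by (rule continuous_map_eq[OF p(1)]) simp
    show "bij_betw (restrict p (Carrier P)) (Carrier P) (Carrier P)"
      using p(2) by (simp add: bij_betw_restrict_eq)
    show "Fun P f (compose {..<far L f} (restrict p (Carrier P)) x) = restrict p (Carrier P) (Fun P f x)"
      if fx: "f \<in> funs L" "x \<in> tuples (Carrier P) (far L f)" for f x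
      unfolding c[OF fx(2)] restrict_apply'[OF Fun_closed[OF P_struct fx]] by (rule f[OF fx])
    show "compose {..<rar L r} (restrict p (Carrier P)) x \<in> Rel P r \<longleftrightarrow> x \<in> Rel P r"
      if rx: "r \<in> rels L" "x \<in> tuples (Carrier P) (rar L r)" for r x
      unfolding c[OF rx(2)] by (rule q[OF rx])
  qed
  then show ?thesis by (simp add: Aut_iff)
qed

lemma Aut_conjugates_epis:
  assumes "A \<in> G" and "epimorphism L P A \<phi>1" and "epimorphism L P A \<phi>2"
  shows "\<exists>g\<in>Aut L P. \<forall>x\<in>Carrier P. \<phi>2 x = \<phi>1 (g x)"
proof -
  obtain \<psi> where \<psi>: "isomorphism L P P \<psi>" "\<forall>x\<in>Carrier P. \<phi>2 x = \<phi>1 (\<psi> x)"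
    using epis_conjugate[OF assms] by auto
  show ?thesis
  proof (intro bexI ballI)
    show "restrict \<psi> (Carrier P) \<in> Aut L P" by (rule restrict_isomorphism_Aut[OF \<psi>(1)])
    show "\<phi>2 x = \<phi>1 (restrict \<psi> (Carrier P) x)" if "x \<in> Carrier P" for x
      using \<psi>(2) that by simp
  qed
qed

text \<open>(L1) gives some epimorphism onto \<open>B\<close>. Composed with \<pi> it need not be
  \<phi>, but (L3) for \<open>A\<close> supplies the automorphism that corrects it.\<close>

lemma lift_epi:
  assumes "A \<in> G" and "B \<in> G" and "epimorphism L B A \<pi>" and "epimorphism L P A \<phi>"
  shows "\<exists>\<psi>. epimorphism L P B \<psi> \<and> (\<forall>x\<in>Carrier P. \<pi> (\<psi> x) = \<phi> x)"
proof -
  obtain \<psi> where \<psi>: "epimorphism L P B \<psi>" using ex_epi[OF assms(2)] by auto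
  obtain g where g: "g \<in> Aut L P" "\<forall>x\<in>Carrier P. \<phi> x = \<pi> (\<psi> (g x))"
    using Aut_conjugates_epis[OF assms(1) epimorphism_compose[OF \<psi> assms(3)] assms(4)] by auto
  show ?thesis
    using epimorphism_compose[OF Aut_epi[OF g(1)] \<psi>] g(2) by (intro exI[of _ "\<lambda>x. \<psi> (g x)"] conjI) simp_all
qed

lemma Aut_inv:
  assumes "g \<in> Aut L P"
  shows "restrict (inv_into (Carrier P) g) (Carrier P) \<in> Aut L P"
proof (rule restrict_isomorphism_Aut)
  let ?i = "inv_into (Carrier P) g"
  have b: "bij_betw ?i (Carrier P) (Carrier P)" using bij_betw_inv_into[OF Aut_bij[OF assms]] .
  have gi: "g (?i x) = x" and iP: "?i x \<in> Carrier P" if "x \<in> Carrier P" for x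
    using bij_betw_inv_into_right[OF Aut_bij[OF assms] that] bij_betw_apply[OF b that] by simp_all
  have ig: "?i (g x) = x" if "x \<in> Carrier P" for x
    using bij_betw_inv_into_left[OF Aut_bij[OF assms] that] .
  have tup: "compose {..<n} ?i x \<in> tuples (Carrier P) n" "compose {..<n} g (compose {..<n} ?i x) = x"
    if "x \<in> tuples (Carrier P) n" for x n
    using compose_tuples[OF that iP] compose_id_tuples[OF that gi] by (simp_all add: compose_compose_tuple)
  show "isomorphism L P P ?i"
    unfolding isomorphism_iff[OF P_struct]
  proof (intro conjI ballI)
    \<comment> \<open>A continuous bijection of a compact Hausdorff space onto itself is a
      homeomorphism; its continuous inverse agrees with \<open>inv_into\<close> on the
      carrier.\<close>
    have "homeomorphic_map (Top P) (Top P) g"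
      using continuous_imp_homeomorphic_map[OF Aut_continuous[OF assms] P_compact P_Hausdorff]
        Aut_bij[OF assms] by (simp add: bij_betw_def)
    then obtain h where h: "homeomorphic_maps (Top P) (Top P) g h"
      by (auto simp: homeomorphic_map_maps)
    have "h y = ?i y" if "y \<in> Carrier P" for y
    proof -
      have "h (g (?i y)) = ?i y" using h iP[OF that] by (simp add: homeomorphic_maps_def)
      then show ?thesis using gi[OF that] by simp
    qed
    then show "continuous_map (Top P) (Top P) ?i"
      using h by (intro continuous_map_eq[of "Top P" "Top P" h ?i]) (simp_all add: homeomorphic_maps_def)
  next
    fix f x assume f: "f \<in> funs L" and x: "x \<in> tuples (Carrier P) (far L f)"
    have "Fun P f x = g (Fun P f (compose {..<far L f} ?i x))"
      using Aut_Fun[OF assms f tup(1)[OF x]] tup(2)[OF x] by simp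
    then show "Fun P f (compose {..<far L f} ?i x) = ?i (Fun P f x)"
      using ig Fun_closed[OF P_struct f tup(1)[OF x]] by simp
  next
    fix q x assume q: "q \<in> rels L" and x: "x \<in> tuples (Carrier P) (rar L q)"
    show "compose {..<rar L q} ?i x \<in> Rel P q \<longleftrightarrow> x \<in> Rel P q"
      using Aut_Rel[OF assms q tup(1)[OF x]] tup(2)[OF x] by simp
  qed (rule b)
qed

lemma Aut_compose:
  assumes "g \<in> Aut L P" and "h \<in> Aut L P"
  shows "compose (Carrier P) g h \<in> Aut L P"
proof -
  have "isomorphism L P P (\<lambda>x. g (h x))"
    unfolding isomorphism_def
  proof
    show "epimorphism L P P (\<lambda>x. g (h x))"
      by (rule epimorphism_compose[OF Aut_epi[OF assms(2)] Aut_epi[OF assms(1)]])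
    show "bij_betw (\<lambda>x. g (h x)) (Carrier P) (Carrier P)"
      using bij_betw_trans[OF Aut_bij[OF assms(2)] Aut_bij[OF assms(1)]] by (simp add: comp_def)
  qed
  then show ?thesis
    using restrict_isomorphism_Aut by (simp add: compose_def)
qed

lemma Aut_id: "(\<lambda>x\<in>Carrier P. x) \<in> Aut L P"
proof (rule restrict_isomorphism_Aut)
  show "isomorphism L P P (\<lambda>x. x)"
    unfolding isomorphism_iff[OF P_struct]
  proof (intro conjI ballI)
    show "continuous_map (Top P) (Top P) (\<lambda>x. x)" using continuous_map_id[of "Top P"] by (simp add: id_def)
    have c: "compose {..<n} (\<lambda>x. x) y = y" if "y \<in> tuples (Carrier P) n" for n y
      by (rule compose_id_tuples[OF that]) simp
    show "Fun P f (compose {..<far L f} (\<lambda>x. x) x) = Fun P f x" if "x \<in> tuples (Carrier P) (far L f)" for f x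
      using c[OF that] by simp
    show "compose {..<rar L q} (\<lambda>x. x) x \<in> Rel P q \<longleftrightarrow> x \<in> Rel P q" if "x \<in> tuples (Carrier P) (rar L q)" for q x
      using c[OF that] by simp
  qed (simp add: bij_betw_def)
qed

lemma Aut_subgroup: "subgroup (Aut L P) (BijGroup (Carrier P))"
proof
  have Bij: "g \<in> Bij (Carrier P)" if "g \<in> Aut L P" for g
    using that Aut_bij by (simp add: Bij_def Aut_iff)
  then show "Aut L P \<subseteq> carrier (BijGroup (Carrier P))"
    by (auto simp: BijGroup_def)
  show "g \<otimes>\<^bsub>BijGroup (Carrier P)\<^esub> h \<in> Aut L P" if "g \<in> Aut L P" "h \<in> Aut L P" for g h
    using that Aut_compose Bij by (simp add: BijGroup_def)
  show "\<one>\<^bsub>BijGroup (Carrier P)\<^esub> \<in> Aut L P"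
    using Aut_id by (simp add: BijGroup_def)
  show "inv\<^bsub>BijGroup (Carrier P)\<^esub> g \<in> Aut L P" if "g \<in> Aut L P" for g
    using that Aut_inv Bij by (simp add: inv_BijGroup)
qed

abbreviation "\<Gamma> \<equiv> Aut_group L P"

lemma Aut_group: "group \<Gamma>"
  unfolding Aut_group_def by (rule subgroup.subgroup_is_group[OF Aut_subgroup group_BijGroup])

lemma carrier_Aut [simp]: "carrier \<Gamma> = Aut L P"
  by (simp add: Aut_group_def)

lemma Aut_Bij: "g \<in> Aut L P \<Longrightarrow> g \<in> Bij (Carrier P)"
  using Aut_bij by (simp add: Bij_def Aut_iff)

lemma mult_apply:
  "\<lbrakk>g \<in> Aut L P; h \<in> Aut L P; x \<in> Carrier P\<rbrakk> \<Longrightarrow> (g \<otimes>\<^bsub>\<Gamma>\<^esub> h) x = g (h x)"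
  using Aut_Bij by (simp add: Aut_group_def BijGroup_def compose_def)

lemma one_apply: "x \<in> Carrier P \<Longrightarrow> \<one>\<^bsub>\<Gamma>\<^esub> x = x"
  by (simp add: Aut_group_def BijGroup_def)

lemma inv_Aut: "g \<in> Aut L P \<Longrightarrow> inv\<^bsub>\<Gamma>\<^esub> g \<in> Aut L P"
  using group.inv_closed[OF Aut_group] by simp

lemma mult_Aut: "\<lbrakk>g \<in> Aut L P; h \<in> Aut L P\<rbrakk> \<Longrightarrow> g \<otimes>\<^bsub>\<Gamma>\<^esub> h \<in> Aut L P"
  using monoid.m_closed[OF group.is_monoid[OF Aut_group]] by simp

lemma inv_apply:
  assumes "g \<in> Aut L P" and "x \<in> Carrier P"
  shows "g ((inv\<^bsub>\<Gamma>\<^esub> g) x) = x" and "(inv\<^bsub>\<Gamma>\<^esub> g) (g x) = x"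
  using mult_apply[OF assms(1) inv_Aut[OF assms(1)] assms(2)]
    mult_apply[OF inv_Aut[OF assms(1)] assms] one_apply[OF assms(2)] assms(1)
    group.r_inv[OF Aut_group] group.l_inv[OF Aut_group] by simp_all

lemma conj_apply:
  "\<lbrakk>g \<in> Aut L P; h \<in> Aut L P; x \<in> Carrier P\<rbrakk>
    \<Longrightarrow> conj_action \<Gamma> g h x = g (h ((inv\<^bsub>\<Gamma>\<^esub> g) x))"
  by (simp add: conj_action_def mult_apply mult_Aut inv_Aut Aut_in)

text \<open>The graph of the conjugate is the image of the graph of \<open>f\<close> under
  \<open>g\<close> in both coordinates. A change of epimorphism thus becomes a conjugation.\<close>

lemma push_conj:
  assumes "g \<in> Aut L P" and "f \<in> Aut L P"
  shows "push \<phi> (conj_action \<Gamma> g f) = push (\<lambda>x. \<phi> (g x)) f"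
proof
  show "push \<phi> (conj_action \<Gamma> g f) \<subseteq> push (\<lambda>x. \<phi> (g x)) f"
  proof
    fix z assume "z \<in> push \<phi> (conj_action \<Gamma> g f)"
    then obtain x where x: "x \<in> Carrier P" "z = (\<phi> x, \<phi> (conj_action \<Gamma> g f x))"
      by (auto simp: push_def)
    let ?y = "(inv\<^bsub>\<Gamma>\<^esub> g) x"
    have "?y \<in> Carrier P" using Aut_in inv_Aut assms(1) x(1) by simp
    moreover have "z = (\<phi> (g ?y), \<phi> (g (f ?y)))"
      using x assms by (simp add: conj_apply inv_apply)
    ultimately show "z \<in> push (\<lambda>x. \<phi> (g x)) f" unfolding push_def by (rule rev_image_eqI)
  qed
  show "push (\<lambda>x. \<phi> (g x)) f \<subseteq> push \<phi> (conj_action \<Gamma> g f)"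
  proof
    fix z assume "z \<in> push (\<lambda>x. \<phi> (g x)) f"
    then obtain y where y: "y \<in> Carrier P" "z = (\<phi> (g y), \<phi> (g (f y)))"
      by (auto simp: push_def)
    have "g y \<in> Carrier P" using Aut_in assms(1) y(1) by simp
    moreover have "z = (\<phi> (g y), \<phi> (conj_action \<Gamma> g f (g y)))"
      using y assms by (simp add: conj_apply inv_apply Aut_in)
    ultimately show "z \<in> push \<phi> (conj_action \<Gamma> g f)" unfolding push_def by (rule rev_image_eqI)
  qed
qed

lemma push_cong:
  assumes "f \<in> Aut L P" and "\<And>x. x \<in> Carrier P \<Longrightarrow> \<phi> x = \<psi> x"
  shows "push \<phi> f = push \<psi> f"
  unfolding push_def using assms Aut_in by (intro image_cong) simp_all

lemma push_compose: "push (\<lambda>x. \<pi> (\<phi> x)) f = map_prod \<pi> \<pi> ` push \<phi> f"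
  by (simp add: push_def image_image)

lemma push_subset:
  assumes "f \<in> Aut L P" and "\<phi> ` Carrier P = S"
  shows "push \<phi> f \<subseteq> S \<times> S"
  using assms Aut_in by (auto simp: push_def)

end

section \<open>The filtration of the automorphism group\<close>

locale fraisse_sequence = fraisse_limit L G P
  for L :: "('f, 'r) language" and G :: "('a, 'f, 'r) lstruct set" and P :: "('p, 'f, 'r) lstruct" +
  fixes E :: "nat \<Rightarrow> ('a, 'f, 'r) lstruct" and \<epsilon> :: "nat \<Rightarrow> 'p \<Rightarrow> 'a"
  assumes E_in: "E n \<in> G" and \<epsilon>_epi: "epimorphism L P (E n) (\<epsilon> n)"
    and \<epsilon>_Suc: "finer (\<epsilon> (Suc n)) (\<epsilon> n)"
    and \<epsilon>_clopen: "\<lbrakk>openin (Top P) K; closedin (Top P) K\<rbrakk> \<Longrightarrow> \<exists>n. finer (\<epsilon> n) (\<lambda>x. x \<in> K)"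
begin

section \<open>Approximating points and sets by the fibres of the sequence\<close>

lemma \<epsilon>_mono: "m \<le> n \<Longrightarrow> finer (\<epsilon> n) (\<epsilon> m)"
proof (induction rule: dec_induct)
  case base
  show ?case by (rule finer_refl)
next
  case (step n)
  show ?case by (rule finer_trans[OF \<epsilon>_Suc step.IH])
qed

lemma \<epsilon>_loc_const: "loc_const (\<epsilon> n)"
  using loc_const_epi E_in \<epsilon>_epi by auto

text \<open>\<psi> has finitely many fibres, each clopen and so decided by some level; the maximum
  of these levels and \<open>k\<close> works.\<close>

lemma \<epsilon>_cofinal:
  assumes "loc_const \<psi>"
  obtains n where "n \<ge> k" "finer (\<epsilon> n) \<psi>"
proof -
  have "\<exists>n. finer (\<epsilon> n) (\<lambda>x. x \<in> {x \<in> Carrier P. \<psi> x = z})" for z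
    by (rule \<epsilon>_clopen[OF openin_loc_const[OF assms] closedin_loc_const[OF assms]])
  then obtain N where N: "\<And>z. finer (\<epsilon> (N z)) (\<lambda>x. x \<in> {x \<in> Carrier P. \<psi> x = z})" by metis
  define n where "n = Max (insert k (N ` \<psi> ` Carrier P))"
  have fin: "finite (insert k (N ` \<psi> ` Carrier P))" using loc_const_finite[OF assms] by simp
  have k: "k \<le> n" unfolding n_def by (rule Max_ge[OF fin]) simp
  have "\<psi> x = \<psi> y" if xy: "x \<in> Carrier P" "y \<in> Carrier P" "\<epsilon> n x = \<epsilon> n y" for x y
  proof -
    have "N (\<psi> x) \<le> n" unfolding n_def by (rule Max_ge[OF fin]) (use xy(1) in simp)
    then have "finer (\<epsilon> n) (\<lambda>w. w \<in> {w \<in> Carrier P. \<psi> w = \<psi> x})"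
      using finer_trans[OF \<epsilon>_mono N] by simp
    from finerD[OF this xy(3,1,2)] xy show ?thesis by simp
  qed
  then have "finer (\<epsilon> n) \<psi>" unfolding finer_def by blast
  then show ?thesis by (rule that[OF k])
qed

text \<open>Zero-dimensionality covers \<open>K\<close> by clopen subsets of \<open>U\<close>,
  compactness makes the cover finite, and a single level decides membership in its union.\<close>

lemma compact_saturation:
  assumes K: "compactin (Top P) K" and U: "openin (Top P) U" and "K \<subseteq> U"
  shows "\<exists>n. \<forall>x\<in>K. \<forall>y\<in>Carrier P. \<epsilon> n y = \<epsilon> n x \<longrightarrow> y \<in> U"
proof -
  have base: "\<forall>W x. openin (Top P) W \<and> x \<in> W \<longrightarrow> (\<exists>V. (closedin (Top P) V \<and> openin (Top P) V) \<and> x \<in> V \<and> V \<subseteq> W)"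
    using P_dim unfolding dimension_le_0_neighbourhood_base_of_clopen
    by (subst (asm) open_neighbourhood_base_of) simp_all
  let ?V = "{V. closedin (Top P) V \<and> openin (Top P) V \<and> V \<subseteq> U}"
  have "\<exists>\<F>. finite \<F> \<and> \<F> \<subseteq> ?V \<and> K \<subseteq> \<Union>\<F>"
    using K
  proof (rule compactinD)
    show "K \<subseteq> \<Union>?V"
    proof
      fix x assume "x \<in> K"
      then have "x \<in> U" using assms(3) by auto
      then obtain V where "closedin (Top P) V \<and> openin (Top P) V" "x \<in> V" "V \<subseteq> U"
        using base U by metis
      then show "x \<in> \<Union>?V" by auto
    qed
  qed simp
  then obtain \<F> where \<F>: "finite \<F>" "\<F> \<subseteq> ?V" "K \<subseteq> \<Union>\<F>" by auto
  have clopen: "openin (Top P) (\<Union>\<F>)" "closedin (Top P) (\<Union>\<F>)"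
    using \<F>(1,2) by (auto intro: openin_Union closedin_Union)
  obtain n where n: "n \<ge> 0" "finer (\<epsilon> n) (\<lambda>x. x \<in> \<Union>\<F>)"
    using \<epsilon>_cofinal[OF loc_const_clopen[OF clopen]] .
  have KP: "K \<subseteq> Carrier P" using compactin_subset_topspace[OF K] .
  show ?thesis
  proof (intro exI ballI impI)
    fix x y assume xy: "x \<in> K" "y \<in> Carrier P" "\<epsilon> n y = \<epsilon> n x"
    then have "(y \<in> \<Union>\<F>) = (x \<in> \<Union>\<F>)" using finerD[OF n(2) xy(3,2)] KP by auto
    then have "y \<in> \<Union>\<F>" using \<F>(3) xy(1) by auto
    then show "y \<in> U" using \<F>(2) by auto
  qed
qed

lemma \<epsilon>_separates:
  assumes "x \<in> Carrier P" and "y \<in> Carrier P" and "\<And>n. \<epsilon> n x = \<epsilon> n y"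
  shows "x = y"
proof (rule ccontr)
  assume "x \<noteq> y"
  have "closedin (Top P) {x}" using closedin_Hausdorff_singleton[OF P_Hausdorff assms(1)] .
  then have "openin (Top P) (Carrier P - {x})" by (simp add: closedin_def)
  moreover have "compactin (Top P) {y}" using assms(2) by simp
  moreover have "{y} \<subseteq> Carrier P - {x}" using assms(2) \<open>x \<noteq> y\<close> by simp
  ultimately obtain n where "\<forall>z\<in>{y}. \<forall>w\<in>Carrier P. \<epsilon> n w = \<epsilon> n z \<longrightarrow> w \<in> Carrier P - {x}"
    using compact_saturation[of "{y}" "Carrier P - {x}"] by metis
  then have "x \<in> Carrier P - {x}" using assms(1) assms(3)[of n] by blast
  then show False by simp
qed

lemma \<epsilon>_nbhd:
  assumes "openin (Top P) U" and "x \<in> U"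
  shows "\<exists>n. \<forall>y\<in>Carrier P. \<epsilon> n y = \<epsilon> n x \<longrightarrow> y \<in> U"
proof -
  have "x \<in> Carrier P" using assms openin_subset by auto
  then show ?thesis
    using compact_saturation[of "{x}" U] assms by simp
qed

text \<open>The fibres through the \<open>w n\<close> are closed, nonempty and nested, so
  compactness gives a common point. This produces the values of limit automorphisms.\<close>

lemma \<epsilon>_complete:
  assumes w: "\<And>n. w n \<in> Carrier P" and coh: "\<And>n. \<epsilon> n (w (Suc n)) = \<epsilon> n (w n)"
  shows "\<exists>y\<in>Carrier P. \<forall>n. \<epsilon> n y = \<epsilon> n (w n)"
proof -
  let ?C = "\<lambda>n. {y \<in> Carrier P. \<epsilon> n y = \<epsilon> n (w n)}"
  have "(\<Inter>n. ?C n) \<noteq> {}"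
  proof (rule compact_space_imp_nest[OF P_compact])
    show "closedin (Top P) (?C n)" for n by (rule closedin_loc_const[OF \<epsilon>_loc_const])
    show "?C n \<noteq> {}" for n using w[of n] by auto
    show "decseq ?C"
      unfolding decseq_Suc_iff
    proof (intro allI subsetI)
      fix n y assume "y \<in> ?C (Suc n)"
      then have y: "y \<in> Carrier P" "\<epsilon> (Suc n) y = \<epsilon> (Suc n) (w (Suc n))" by auto
      then have "\<epsilon> n y = \<epsilon> n (w (Suc n))" using finerD[OF \<epsilon>_Suc y(2,1) w] by simp
      then show "y \<in> ?C n" using y(1) coh by simp
    qed
  qed
  then obtain y where "\<And>n. y \<in> ?C n" by auto
  then show ?thesis by (intro bexI[of _ y]) simp_all
qed

definition V :: "nat \<Rightarrow> ('p \<Rightarrow> 'p) set"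
  where "V n = {g \<in> Aut L P. \<forall>x\<in>Carrier P. \<epsilon> n (g x) = \<epsilon> n x}"

section \<open>The stabilizers as a complete filtration\<close>

lemma V_coset_iff:
  assumes "g \<in> Aut L P" and "h \<in> Aut L P"
  shows "g \<otimes>\<^bsub>\<Gamma>\<^esub> inv\<^bsub>\<Gamma>\<^esub> h \<in> V n \<longleftrightarrow> (\<forall>x\<in>Carrier P. \<epsilon> n (g x) = \<epsilon> n (h x))"
proof
  assume l: "g \<otimes>\<^bsub>\<Gamma>\<^esub> inv\<^bsub>\<Gamma>\<^esub> h \<in> V n"
  show "\<forall>x\<in>Carrier P. \<epsilon> n (g x) = \<epsilon> n (h x)"
  proof
    fix x assume x: "x \<in> Carrier P"
    then have "\<epsilon> n ((g \<otimes>\<^bsub>\<Gamma>\<^esub> inv\<^bsub>\<Gamma>\<^esub> h) (h x)) = \<epsilon> n (h x)"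
      using l Aut_in[OF assms(2)] by (simp add: V_def)
    then show "\<epsilon> n (g x) = \<epsilon> n (h x)"
      using x assms by (simp add: mult_apply inv_Aut Aut_in inv_apply)
  qed
next
  assume r: "\<forall>x\<in>Carrier P. \<epsilon> n (g x) = \<epsilon> n (h x)"
  have "\<epsilon> n ((g \<otimes>\<^bsub>\<Gamma>\<^esub> inv\<^bsub>\<Gamma>\<^esub> h) x) = \<epsilon> n x" if x: "x \<in> Carrier P" for x
    using r x assms Aut_in[OF inv_Aut[OF assms(2)] x] by (simp add: mult_apply inv_Aut inv_apply)
  then show "g \<otimes>\<^bsub>\<Gamma>\<^esub> inv\<^bsub>\<Gamma>\<^esub> h \<in> V n"
    using assms by (simp add: V_def mult_Aut inv_Aut)
qed

text \<open>Functions survive the limit because each \<epsilon> n commutes with them and the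
  \<epsilon> n separate points; relations survive because they are closed. The approximations of the
  inverse give the backward direction for relations.\<close>

lemma Aut_limit:
  assumes p: "\<And>x. x \<in> Carrier P \<Longrightarrow> p x \<in> Carrier P \<and> q (p x) = x"
    and q: "\<And>x. x \<in> Carrier P \<Longrightarrow> q x \<in> Carrier P \<and> p (q x) = x"
    and pa: "\<And>n x. x \<in> Carrier P \<Longrightarrow> \<epsilon> n (p x) = \<epsilon> n (a n x)" and a: "\<And>n. a n \<in> Aut L P"
    and qb: "\<And>n x. x \<in> Carrier P \<Longrightarrow> \<epsilon> n (q x) = \<epsilon> n (b n x)" and b: "\<And>n. b n \<in> Aut L P"
  shows "isomorphism L P P p"
  unfolding isomorphism_iff[OF P_struct]
proof (intro conjI ballI)
  show "continuous_map (Top P) (Top P) p"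
    unfolding continuous_map_def
  proof (intro conjI allI impI)
    show "p \<in> topspace (Top P) \<rightarrow> topspace (Top P)" using p by simp
    fix U assume U: "openin (Top P) U"
    show "openin (Top P) {x \<in> topspace (Top P). p x \<in> U}"
    proof (subst openin_subopen, intro ballI)
      fix x assume "x \<in> {x \<in> topspace (Top P). p x \<in> U}"
      then have x: "x \<in> Carrier P" "p x \<in> U" by auto
      obtain n where n: "\<forall>y\<in>Carrier P. \<epsilon> n y = \<epsilon> n (p x) \<longrightarrow> y \<in> U"
        using \<epsilon>_nbhd[OF U x(2)] by auto
      let ?W = "{z \<in> Carrier P. \<epsilon> n (a n z) = \<epsilon> n (a n x)}"
      have "openin (Top P) ?W"
        using openin_loc_const[OF loc_const_compose[OF \<epsilon>_loc_const Aut_continuous[OF a]]] .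
      moreover have "?W \<subseteq> {x \<in> topspace (Top P). p x \<in> U}"
      proof
        fix z assume "z \<in> ?W"
        then have z: "z \<in> Carrier P" "\<epsilon> n (a n z) = \<epsilon> n (a n x)" by simp_all
        then have pz: "\<epsilon> n (p z) = \<epsilon> n (p x)" by (simp only: pa[OF z(1)] pa[OF x(1)])
        have "p z \<in> Carrier P" using p[OF z(1)] by simp
        then show "z \<in> {x \<in> topspace (Top P). p x \<in> U}" using n z(1) pz by simp
      qed
      ultimately show "\<exists>W. openin (Top P) W \<and> x \<in> W \<and> W \<subseteq> {x \<in> topspace (Top P). p x \<in> U}"
        using x(1) by (intro exI[of _ ?W]) simp
    qed
  qed
  show "bij_betw p (Carrier P) (Carrier P)"
  proof (rule bij_betw_byWitness[where f' = q])
    show "\<forall>x\<in>Carrier P. q (p x) = x" "\<forall>x\<in>Carrier P. p (q x) = x" using p q by blast+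
    show "p ` Carrier P \<subseteq> Carrier P" "q ` Carrier P \<subseteq> Carrier P" using p q by blast+
  qed
next
  fix f x assume f: "f \<in> funs L" and x: "x \<in> tuples (Carrier P) (far L f)"
  have px: "compose {..<far L f} p x \<in> tuples (Carrier P) (far L f)"
    by (rule compose_tuples[OF x]) (use p in simp)
  have "\<epsilon> n (Fun P f (compose {..<far L f} p x)) = \<epsilon> n (p (Fun P f x))" for n
  proof -
    have ax: "compose {..<far L f} (a n) x \<in> tuples (Carrier P) (far L f)"
      by (rule compose_tuples[OF x Aut_in[OF a]])
    have "compose {..<far L f} (\<epsilon> n) (compose {..<far L f} p x) =
      compose {..<far L f} (\<epsilon> n) (compose {..<far L f} (a n) x)"
      unfolding compose_compose_tuple by (rule compose_cong_tuples[OF x pa])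
    then have "\<epsilon> n (Fun P f (compose {..<far L f} p x)) = \<epsilon> n (Fun P f (compose {..<far L f} (a n) x))"
      using epimorphism_Fun[OF \<epsilon>_epi f px, of n] epimorphism_Fun[OF \<epsilon>_epi f ax, of n] by simp
    then show ?thesis
      using Aut_Fun[OF a f x] pa[OF Fun_closed[OF P_struct f x]] by simp
  qed
  note eq = this
  have "p (Fun P f x) \<in> Carrier P" using p[OF Fun_closed[OF P_struct f x]] by simp
  then show "Fun P f (compose {..<far L f} p x) = p (Fun P f x)"
    by (rule \<epsilon>_separates[OF Fun_closed[OF P_struct f px] _ eq])
next
  fix r x assume r: "r \<in> rels L" and x: "x \<in> tuples (Carrier P) (rar L r)"
  \<comment> \<open>Otherwise the tuple has a product neighbourhood that misses the relation. Some
    \<open>c n\<close> moves \<open>z\<close> into it, although automorphisms preserve the relation.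
    This is used for \<open>p\<close> and again for \<open>q\<close>.\<close>
  have closed: "compose {..<rar L r} h z \<in> Rel P r"
    if z: "z \<in> Rel P r" and h: "\<And>x. x \<in> Carrier P \<Longrightarrow> h x \<in> Carrier P"
      and hc: "\<And>n x. x \<in> Carrier P \<Longrightarrow> \<epsilon> n (h x) = \<epsilon> n (c n x)" and c: "\<And>n. c n \<in> Aut L P"
    for z h and c :: "nat \<Rightarrow> 'p \<Rightarrow> 'p"
  proof (rule ccontr)
    let ?k = "rar L r" and ?y = "compose {..<rar L r} h z"
    assume not: "?y \<notin> Rel P r"
    have zt: "z \<in> tuples (Carrier P) ?k" using Rel_subset[OF P_struct r z] .
    have yt: "?y \<in> tuples (Carrier P) ?k" by (rule compose_tuples[OF zt h])
    have "closedin (power_top (Top P) ?k) (Rel P r)"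
      using P_struct r by (simp add: topological_structure_def)
    then have "openin (power_top (Top P) ?k) (tuples (Carrier P) ?k - Rel P r)"
      by (simp add: closedin_def topspace_power_top)
    moreover have "?y \<in> tuples (Carrier P) ?k - Rel P r" using not yt by simp
    ultimately have "\<exists>U. finite {i \<in> {..<?k}. U i \<noteq> topspace (Top P)} \<and>
        (\<forall>i\<in>{..<?k}. openin (Top P) (U i)) \<and> ?y \<in> Pi\<^sub>E {..<?k} U \<and>
        Pi\<^sub>E {..<?k} U \<subseteq> tuples (Carrier P) ?k - Rel P r"
      unfolding power_top_def openin_product_topology_alt by (rule bspec)
    then obtain U where U: "\<forall>i\<in>{..<?k}. openin (Top P) (U i)" "?y \<in> Pi\<^sub>E {..<?k} U"
      "Pi\<^sub>E {..<?k} U \<subseteq> tuples (Carrier P) ?k - Rel P r"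
      by (elim exE conjE)
    have "\<exists>n. \<forall>w\<in>Carrier P. \<epsilon> n w = \<epsilon> n (?y i) \<longrightarrow> w \<in> U i" if "i < ?k" for i
    proof -
      have Ui: "openin (Top P) (U i)" "?y i \<in> U i" using U(1,2) that by (auto simp: PiE_iff)
      show ?thesis by (rule \<epsilon>_nbhd[OF Ui])
    qed
    then obtain N where N: "\<And>i w. \<lbrakk>i < ?k; w \<in> Carrier P; \<epsilon> (N i) w = \<epsilon> (N i) (?y i)\<rbrakk> \<Longrightarrow> w \<in> U i"
      by metis
    \<comment> \<open>One level fine enough for all coordinates; \<open>0\<close> is inserted for
      relations of arity 0.\<close>
    define n where "n = Max (insert 0 (N ` {..<?k}))"
    have "N i \<le> n" if "i < ?k" for i unfolding n_def by (rule Max_ge) (use that in simp_all)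
    note le = \<epsilon>_mono[OF this]
    let ?w = "compose {..<?k} (c n) z"
    have wt: "?w \<in> tuples (Carrier P) ?k" by (rule compose_tuples[OF zt Aut_in[OF c]])
    have "?w i \<in> U i" if i: "i < ?k" for i
    proof (rule N[OF i])
      have ziP: "z i \<in> Carrier P" using zt i by (auto simp: tuples_def PiE_iff)
      show wP: "?w i \<in> Carrier P" using wt i by (auto simp: tuples_def PiE_iff)
      have yP: "?y i \<in> Carrier P" using yt i by (auto simp: tuples_def PiE_iff)
      have "\<epsilon> n (?w i) = \<epsilon> n (?y i)" using hc[OF ziP] i by (simp add: compose_def)
      then show "\<epsilon> (N i) (?w i) = \<epsilon> (N i) (?y i)" by (rule finerD[OF le[OF i] _ wP yP])
    qed
    then have "?w \<in> Pi\<^sub>E {..<?k} U" using wt by (auto simp: tuples_def PiE_iff)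
    then have "?w \<notin> Rel P r" using U(3) by auto
    moreover have "?w \<in> Rel P r" using Aut_Rel[OF c r zt] z by simp
    ultimately show False by simp
  qed
  have px: "compose {..<rar L r} p x \<in> tuples (Carrier P) (rar L r)"
    by (rule compose_tuples[OF x]) (use p in simp)
  have qp: "compose {..<rar L r} q (compose {..<rar L r} p x) = x"
    unfolding compose_compose_tuple by (rule compose_id_tuples[OF x]) (use p in simp)
  show "compose {..<rar L r} p x \<in> Rel P r \<longleftrightarrow> x \<in> Rel P r"
  proof
    assume "compose {..<rar L r} p x \<in> Rel P r"
    then have "compose {..<rar L r} q (compose {..<rar L r} p x) \<in> Rel P r"
      by (rule closed[OF _ _ qb b]) (use q in simp_all)
    then show "x \<in> Rel P r" using qp by simp
  next
    assume "x \<in> Rel P r"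
    then show "compose {..<rar L r} p x \<in> Rel P r"
      by (rule closed[OF _ _ pa a]) (use p in simp_all)
  qed
qed

text \<open>The first difference condition makes the \<open>a n\<close> converge pointwise to a map
  \<open>p\<close>, but does not make \<open>p\<close> injective. The second gives a limit
  \<open>q\<close> of the inverses, and \<open>p\<close> and \<open>q\<close> are then mutually
  inverse.\<close>

lemma V_complete:
  assumes a: "\<And>n. a n \<in> Aut L P"
    and left: "\<And>n. a (Suc n) \<otimes>\<^bsub>\<Gamma>\<^esub> inv\<^bsub>\<Gamma>\<^esub> (a n) \<in> V n"
    and right: "\<And>n. inv\<^bsub>\<Gamma>\<^esub> (a (Suc n)) \<otimes>\<^bsub>\<Gamma>\<^esub> a n \<in> V n"
  shows "\<exists>g\<in>Aut L P. \<forall>n. g \<otimes>\<^bsub>\<Gamma>\<^esub> inv\<^bsub>\<Gamma>\<^esub> (a n) \<in> V n \<and> inv\<^bsub>\<Gamma>\<^esub> g \<otimes>\<^bsub>\<Gamma>\<^esub> a n \<in> V n"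
proof -
  define b where "b n = inv\<^bsub>\<Gamma>\<^esub> (a n)" for n
  have b: "b n \<in> Aut L P" for n using inv_Aut[OF a] by (simp add: b_def)
  have a_eq: "a n = inv\<^bsub>\<Gamma>\<^esub> (b n)" for n
    using group.inv_inv[OF Aut_group] a by (simp add: b_def)
  have ab: "a n (b n x) = x" "b n (a n x) = x" if "x \<in> Carrier P" for n x
    using inv_apply[OF a that] by (simp_all add: b_def)
  have aS: "\<epsilon> n (a (Suc n) x) = \<epsilon> n (a n x)" if "x \<in> Carrier P" for n x
    using left[of n] that by (simp add: V_coset_iff a)
  have bS: "\<epsilon> n (b (Suc n) x) = \<epsilon> n (b n x)" if "x \<in> Carrier P" for n x
  proof -
    have "b (Suc n) \<otimes>\<^bsub>\<Gamma>\<^esub> inv\<^bsub>\<Gamma>\<^esub> (b n) \<in> V n"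
      using right[of n] unfolding a_eq[symmetric] b_def[symmetric] .
    then show ?thesis using that by (simp add: V_coset_iff b)
  qed
  have "\<exists>y\<in>Carrier P. \<forall>n. \<epsilon> n y = \<epsilon> n (a n x)" if "x \<in> Carrier P" for x
    using \<epsilon>_complete[of "\<lambda>n. a n x"] Aut_in[OF a that] aS[OF that] by simp
  then obtain p where p: "\<And>x. x \<in> Carrier P \<Longrightarrow> p x \<in> Carrier P"
    "\<And>n x. x \<in> Carrier P \<Longrightarrow> \<epsilon> n (p x) = \<epsilon> n (a n x)" by metis
  have "\<exists>y\<in>Carrier P. \<forall>n. \<epsilon> n y = \<epsilon> n (b n x)" if "x \<in> Carrier P" for x
    using \<epsilon>_complete[of "\<lambda>n. b n x"] Aut_in[OF b that] bS[OF that] by simp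
  then obtain q where q: "\<And>x. x \<in> Carrier P \<Longrightarrow> q x \<in> Carrier P"
    "\<And>n x. x \<in> Carrier P \<Longrightarrow> \<epsilon> n (q x) = \<epsilon> n (b n x)" by metis
  \<comment> \<open>Stated for abstract limits to serve for both composites. The index of
    \<open>f\<close> is frozen at \<open>n\<close>: then \<epsilon> n \<circ> f n is one locally
    constant map, some \<epsilon> m refines it, and \<open>c x\<close> may be replaced by
    \<open>e m x\<close>.\<close>
  have inverse: "d (c x) = x"
    if cP: "\<And>x. x \<in> Carrier P \<Longrightarrow> c x \<in> Carrier P" and dP: "\<And>x. x \<in> Carrier P \<Longrightarrow> d x \<in> Carrier P"
      and c: "\<And>n x. x \<in> Carrier P \<Longrightarrow> \<epsilon> n (c x) = \<epsilon> n (e n x)"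
      and d: "\<And>n x. x \<in> Carrier P \<Longrightarrow> \<epsilon> n (d x) = \<epsilon> n (f n x)"
      and ef: "\<And>n. e n \<in> Aut L P" "\<And>n. f n \<in> Aut L P"
      and fe: "\<And>n x. x \<in> Carrier P \<Longrightarrow> f n (e n x) = x" and x: "x \<in> Carrier P"
    for c d x and e f :: "nat \<Rightarrow> 'p \<Rightarrow> 'p"
  proof (rule \<epsilon>_separates)
    fix n
    obtain m where m: "m \<ge> n" "finer (\<epsilon> m) (\<lambda>x. \<epsilon> n (f n x))"
      using \<epsilon>_cofinal[OF loc_const_compose[OF \<epsilon>_loc_const Aut_continuous[OF ef(2)]]] .
    have eP: "e m x \<in> Carrier P" using Aut_in[OF ef(1) x] .
    \<comment> \<open>Both \<open>f n\<close> and \<open>f m\<close> agree with \<open>d\<close>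
      after \<epsilon> n, the latter because \<open>m \<ge> n\<close>.\<close>
    have fn: "\<epsilon> n (f n y) = \<epsilon> n (f m y)" if y: "y \<in> Carrier P" for y
    proof -
      have "\<epsilon> n (d y) = \<epsilon> n (f m y)"
        using finerD[OF \<epsilon>_mono[OF m(1)] d[OF y]] dP[OF y] Aut_in[OF ef(2) y] by simp
      then show ?thesis using d[OF y] by simp
    qed
    have "\<epsilon> n (d (c x)) = \<epsilon> n (f n (c x))" using d[OF cP[OF x]] .
    also have "\<dots> = \<epsilon> n (f n (e m x))" using finerD[OF m(2) c[OF x] cP[OF x] eP] .
    also have "\<dots> = \<epsilon> n (f m (e m x))" using fn[OF eP] .
    also have "\<dots> = \<epsilon> n x" using fe[OF x] by simp
    finally show "\<epsilon> n (d (c x)) = \<epsilon> n x" .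
  qed (use cP dP x in simp_all)
  have qp: "q (p x) = x" if "x \<in> Carrier P" for x
    by (rule inverse[OF p(1) q(1) p(2) q(2) a b ab(2) that])
  have pq: "p (q x) = x" if "x \<in> Carrier P" for x
    by (rule inverse[OF q(1) p(1) q(2) p(2) b a ab(1) that])
  have "isomorphism L P P p"
    by (rule Aut_limit[of p q a b]) (use p q a b qp pq in simp_all)
  then have g: "restrict p (Carrier P) \<in> Aut L P" (is "?g \<in> _") by (rule restrict_isomorphism_Aut)
  have ig: "(inv\<^bsub>\<Gamma>\<^esub> ?g) x = q x" if "x \<in> Carrier P" for x
    using inv_apply(2)[OF g q(1)[OF that]] pq[OF that] q(1)[OF that] by simp
  have "?g \<otimes>\<^bsub>\<Gamma>\<^esub> inv\<^bsub>\<Gamma>\<^esub> (a n) \<in> V n" for n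
    using p(2) by (simp add: V_coset_iff[OF g a])
  moreover have "inv\<^bsub>\<Gamma>\<^esub> ?g \<otimes>\<^bsub>\<Gamma>\<^esub> inv\<^bsub>\<Gamma>\<^esub> (b n) \<in> V n" for n
    using q(2) ig by (simp add: V_coset_iff[OF inv_Aut[OF g] b])
  ultimately show ?thesis
    using g unfolding a_eq[symmetric] by auto
qed

text \<open>After \<epsilon> n, an automorphism is a locally constant map, so it factors through
  some \<epsilon> m. Between the finite images of \<epsilon> m and \<epsilon> n there are only
  finitely many maps.\<close>

lemma V_countable_index:
  "\<exists>I. countable I \<and> I \<subseteq> Aut L P \<and> (\<forall>g\<in>Aut L P. \<exists>c\<in>I. g \<otimes>\<^bsub>\<Gamma>\<^esub> inv\<^bsub>\<Gamma>\<^esub> c \<in> V n)"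
proof -
  define r where "r g = restrict (\<lambda>x. \<epsilon> n (g x)) (Carrier P)" for g
  define R where "R = (\<Union>m. (\<lambda>h. restrict (\<lambda>x. h (\<epsilon> m x)) (Carrier P)) `
    (\<epsilon> m ` Carrier P \<rightarrow>\<^sub>E \<epsilon> n ` Carrier P))"
  have fin: "finite (\<epsilon> m ` Carrier P)" for m using loc_const_finite[OF \<epsilon>_loc_const] .
  have "countable R"
    unfolding R_def by (intro countable_UN[OF countableI_type] countable_image countable_finite finite_PiE fin)
  moreover have "r ` Aut L P \<subseteq> R"
  proof
    fix u assume "u \<in> r ` Aut L P"
    then obtain g where g: "g \<in> Aut L P" "u = r g" by auto
    obtain m where "m \<ge> 0" and m: "finer (\<epsilon> m) (\<lambda>x. \<epsilon> n (g x))"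
      using \<epsilon>_cofinal[OF loc_const_compose[OF \<epsilon>_loc_const Aut_continuous[OF g(1)]]] .
    define h where "h = (\<lambda>b\<in>\<epsilon> m ` Carrier P. \<epsilon> n (g (inv_into (Carrier P) (\<epsilon> m) b)))"
    have h: "h (\<epsilon> m x) = \<epsilon> n (g x)" if "x \<in> Carrier P" for x
    proof -
      have "\<epsilon> n (g (inv_into (Carrier P) (\<epsilon> m) (\<epsilon> m x))) = \<epsilon> n (g x)"
        using that inv_into_into[of "\<epsilon> m x" "\<epsilon> m" "Carrier P"] f_inv_into_f[of "\<epsilon> m x" "\<epsilon> m" "Carrier P"]
        by (intro finerD[OF m]) simp_all
      then show ?thesis using that by (simp add: h_def)
    qed
    have "h \<in> \<epsilon> m ` Carrier P \<rightarrow>\<^sub>E \<epsilon> n ` Carrier P"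
    proof (rule PiE_I)
      fix b assume "b \<in> \<epsilon> m ` Carrier P"
      then obtain x where "x \<in> Carrier P" "b = \<epsilon> m x" by auto
      then show "h b \<in> \<epsilon> n ` Carrier P" using h Aut_in[OF g(1)] by simp
    qed (simp add: h_def)
    moreover have "u = restrict (\<lambda>x. h (\<epsilon> m x)) (Carrier P)"
      using h by (simp add: g(2) r_def fun_eq_iff restrict_def)
    ultimately show "u \<in> R" unfolding R_def by auto
  qed
  ultimately have cr: "countable (r ` Aut L P)" using countable_subset by auto
  let ?I = "inv_into (Aut L P) r ` r ` Aut L P"
  have "\<exists>c\<in>?I. g \<otimes>\<^bsub>\<Gamma>\<^esub> inv\<^bsub>\<Gamma>\<^esub> c \<in> V n" if g: "g \<in> Aut L P" for g
  proof
    let ?c = "inv_into (Aut L P) r (r g)"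
    show "?c \<in> ?I" using g by simp
    have c: "?c \<in> Aut L P" "r ?c = r g"
      using inv_into_into[of "r g" r "Aut L P"] f_inv_into_f[of "r g" r "Aut L P"] g by simp_all
    have "\<epsilon> n (g x) = \<epsilon> n (?c x)" if "x \<in> Carrier P" for x
      using fun_cong[OF c(2), of x] that by (simp add: r_def)
    then show "g \<otimes>\<^bsub>\<Gamma>\<^esub> inv\<^bsub>\<Gamma>\<^esub> ?c \<in> V n" using V_coset_iff[OF g c(1)] by simp
  qed
  moreover have "?I \<subseteq> Aut L P" using inv_into_into[of _ r "Aut L P"] by auto
  ultimately show ?thesis using cr by (intro exI[of _ ?I]) simp
qed

lemma filtered_Aut: "filtered_group \<Gamma> V"
proof (intro filtered_group.intro filtered_group_axioms.intro)
  show "group \<Gamma>" by (rule Aut_group)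
  show "subgroup (V n) \<Gamma>" for n
  proof
    show "V n \<subseteq> carrier \<Gamma>" by (auto simp: V_def)
    show "g \<otimes>\<^bsub>\<Gamma>\<^esub> h \<in> V n" if "g \<in> V n" "h \<in> V n" for g h
      using that by (simp add: V_def mult_Aut mult_apply Aut_in)
    show "\<one>\<^bsub>\<Gamma>\<^esub> \<in> V n"
      using monoid.one_closed[OF group.is_monoid[OF Aut_group]] by (simp add: V_def one_apply)
    show "inv\<^bsub>\<Gamma>\<^esub> g \<in> V n" if g: "g \<in> V n" for g
    proof -
      have gA: "g \<in> Aut L P" using g by (simp add: V_def)
      have "\<epsilon> n ((inv\<^bsub>\<Gamma>\<^esub> g) x) = \<epsilon> n x" if x: "x \<in> Carrier P" for x
      proof -
        have "\<epsilon> n (g ((inv\<^bsub>\<Gamma>\<^esub> g) x)) = \<epsilon> n ((inv\<^bsub>\<Gamma>\<^esub> g) x)"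
          using g Aut_in[OF inv_Aut[OF gA] x] by (simp add: V_def)
        then show ?thesis using inv_apply(1)[OF gA x] by simp
      qed
      then show ?thesis using inv_Aut[OF gA] by (simp add: V_def)
    qed
  qed
  show "V n \<subseteq> V m" if "m \<le> n" for m n
  proof
    fix g assume g: "g \<in> V n"
    then have "\<epsilon> m (g x) = \<epsilon> m x" if x: "x \<in> Carrier P" for x
      using finerD[OF \<epsilon>_mono[OF \<open>m \<le> n\<close>] _ Aut_in[OF _ x] x] x by (simp add: V_def)
    then show "g \<in> V m" using g by (simp add: V_def)
  qed
  show "\<exists>m. \<forall>v\<in>V m. g \<otimes>\<^bsub>\<Gamma>\<^esub> v \<otimes>\<^bsub>\<Gamma>\<^esub> inv\<^bsub>\<Gamma>\<^esub> g \<in> V n" if "g \<in> carrier \<Gamma>" for g n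
  proof -
    have g: "g \<in> Aut L P" using that by simp
    \<comment> \<open>Since \<epsilon> n \<circ> g factors through \<epsilon> m, precomposing it
      with an element of \<open>V m\<close> changes nothing.\<close>
    obtain m where "m \<ge> 0" and m: "finer (\<epsilon> m) (\<lambda>x. \<epsilon> n (g x))"
      using \<epsilon>_cofinal[OF loc_const_compose[OF \<epsilon>_loc_const Aut_continuous[OF g]]] .
    have "g \<otimes>\<^bsub>\<Gamma>\<^esub> v \<otimes>\<^bsub>\<Gamma>\<^esub> inv\<^bsub>\<Gamma>\<^esub> g \<in> V n" if v: "v \<in> V m" for v
    proof -
      have vA: "v \<in> Aut L P" using v by (simp add: V_def)
      have "\<epsilon> n ((g \<otimes>\<^bsub>\<Gamma>\<^esub> v) x) = \<epsilon> n (g x)" if x: "x \<in> Carrier P" for x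
        using finerD[OF m _ Aut_in[OF vA x] x] v x g vA by (simp add: V_def mult_apply)
      then show ?thesis using V_coset_iff[OF mult_Aut[OF g vA] g] by simp
    qed
    then show ?thesis by auto
  qed
  show "(\<Inter>n. V n) = {\<one>\<^bsub>\<Gamma>\<^esub>}"
  proof (intro equalityI subsetI)
    fix g assume g: "g \<in> (\<Inter>n. V n)"
    have one: "\<one>\<^bsub>\<Gamma>\<^esub> \<in> Aut L P" using monoid.one_closed[OF group.is_monoid[OF Aut_group]] by simp
    have gA: "g \<in> Aut L P" using g by (auto simp: V_def)
    have "g x = x" if "x \<in> Carrier P" for x
      using that g Aut_in[OF gA that] by (intro \<epsilon>_separates) (auto simp: V_def)
    then have "g = \<one>\<^bsub>\<Gamma>\<^esub>" by (intro Aut_eqI gA one) (simp add: one_apply)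
    then show "g \<in> {\<one>\<^bsub>\<Gamma>\<^esub>}" by simp
  next
    fix g assume "g \<in> {\<one>\<^bsub>\<Gamma>\<^esub>}"
    then show "g \<in> (\<Inter>n. V n)"
      using monoid.one_closed[OF group.is_monoid[OF Aut_group]] by (simp add: V_def one_apply)
  qed
  show "\<exists>I. countable I \<and> I \<subseteq> carrier \<Gamma> \<and> (\<forall>g\<in>carrier \<Gamma>. \<exists>c\<in>I. g \<otimes>\<^bsub>\<Gamma>\<^esub> inv\<^bsub>\<Gamma>\<^esub> c \<in> V n)" for n
    using V_countable_index by simp
  show "\<exists>g\<in>carrier \<Gamma>. \<forall>n. g \<otimes>\<^bsub>\<Gamma>\<^esub> inv\<^bsub>\<Gamma>\<^esub> (a n) \<in> V n \<and> inv\<^bsub>\<Gamma>\<^esub> g \<otimes>\<^bsub>\<Gamma>\<^esub> a n \<in> V n"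
    if "\<And>n. a n \<in> carrier \<Gamma>" "\<And>n. a (Suc n) \<otimes>\<^bsub>\<Gamma>\<^esub> inv\<^bsub>\<Gamma>\<^esub> (a n) \<in> V n"
      "\<And>n. inv\<^bsub>\<Gamma>\<^esub> (a (Suc n)) \<otimes>\<^bsub>\<Gamma>\<^esub> a n \<in> V n" for a
    using V_complete[of a] that by simp
qed

interpretation F: filtered_group \<Gamma> V by (rule filtered_Aut)

section \<open>Comparison with the compact-open topology\<close>

lemma openin_F:
  "openin F.filtration_topology U \<longleftrightarrow> U \<subseteq> Aut L P \<and>
    (\<forall>g\<in>U. \<exists>n. \<forall>h\<in>Aut L P. (\<forall>x\<in>Carrier P. \<epsilon> n (h x) = \<epsilon> n (g x)) \<longrightarrow> h \<in> U)"
proof (cases "U \<subseteq> Aut L P")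
  case True
  then have "h \<otimes>\<^bsub>\<Gamma>\<^esub> inv\<^bsub>\<Gamma>\<^esub> g \<in> V n \<longleftrightarrow> (\<forall>x\<in>Carrier P. \<epsilon> n (h x) = \<epsilon> n (g x))"
    if "g \<in> U" "h \<in> Aut L P" for g h n
    using V_coset_iff[OF that(2), of g n] that(1) by auto
  then show ?thesis by (simp add: F.openin_filtration cong: ball_cong)
qed (simp add: F.openin_filtration)

lemma Aut_subset_Homeo: "Aut L P \<subseteq> Homeo (Top P)"
proof
  fix g assume g: "g \<in> Aut L P"
  have "homeomorphic_map (Top P) (Top P) g"
    using continuous_imp_homeomorphic_map[OF Aut_continuous[OF g] P_compact P_Hausdorff]
      Aut_bij[OF g] by (simp add: bij_betw_def)
  then show "g \<in> Homeo (Top P)" using g by (simp add: Homeo_def Aut_iff)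
qed

text \<open>For a subbasic set, compactness of the image of \<open>K\<close> under \<open>g\<close>
  gives one level \<open>n\<close> such that every automorphism agreeing with \<open>g\<close> up to
  \<epsilon> n still maps \<open>K\<close> into \<open>U\<close>.\<close>

lemma openin_Homeo_imp_openin_F:
  assumes "openin (Homeo_topology (Top P)) T"
  shows "openin F.filtration_topology (T \<inter> Aut L P)"
proof -
  let ?S = "{{f \<in> Homeo (Top P). f ` K \<subseteq> U} | K U. compactin (Top P) K \<and> openin (Top P) U}"
  have "generate_topology_on ?S T"
    using assms unfolding Homeo_topology_def by (rule openin_topology_generated_by)
  then show ?thesis
  proof induction
    case (Int S T)
    have "openin F.filtration_topology ((S \<inter> Aut L P) \<inter> (T \<inter> Aut L P))"
      by (rule openin_Int[OF Int.IH])
    moreover have "(S \<inter> Aut L P) \<inter> (T \<inter> Aut L P) = S \<inter> T \<inter> Aut L P" by auto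
    ultimately show ?case by simp
  next
    case (UN \<K>)
    have "openin F.filtration_topology (\<Union>k\<in>\<K>. k \<inter> Aut L P)"
      by (rule openin_Union) (use UN.IH in auto)
    moreover have "(\<Union>k\<in>\<K>. k \<inter> Aut L P) = \<Union>\<K> \<inter> Aut L P" by auto
    ultimately show ?case by simp
  next
    case (Basis T)
    then obtain K U where KU: "T = {f \<in> Homeo (Top P). f ` K \<subseteq> U}" "compactin (Top P) K" "openin (Top P) U"
      by auto
    have KP: "K \<subseteq> Carrier P" using compactin_subset_topspace[OF KU(2)] .
    show ?case
      unfolding openin_F
    proof (intro conjI ballI)
      fix g assume "g \<in> T \<inter> Aut L P"
      then have g: "g \<in> Aut L P" "g ` K \<subseteq> U" using KU(1) by auto
      have "compactin (Top P) (g ` K)" using image_compactin[OF KU(2) Aut_continuous[OF g(1)]] .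
      then obtain n where n: "\<forall>x\<in>g ` K. \<forall>y\<in>Carrier P. \<epsilon> n y = \<epsilon> n x \<longrightarrow> y \<in> U"
        using compact_saturation[OF _ KU(3) g(2)] by auto
      have "h \<in> T \<inter> Aut L P" if h: "h \<in> Aut L P" "\<forall>x\<in>Carrier P. \<epsilon> n (h x) = \<epsilon> n (g x)" for h
      proof -
        have "h x \<in> U" if "x \<in> K" for x
          using n that KP Aut_in[OF h(1)] h(2) by (simp add: subset_iff)
        then show ?thesis using h(1) Aut_subset_Homeo by (auto simp: KU(1))
      qed
      then show "\<exists>n. \<forall>h\<in>Aut L P. (\<forall>x\<in>Carrier P. \<epsilon> n (h x) = \<epsilon> n (g x)) \<longrightarrow> h \<in> T \<inter> Aut L P"
        by auto
    qed auto
  qed simp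
qed

text \<open>The coset is a finite intersection of subbasic sets: each fibre of \<epsilon> n \<circ>
  g, which is compact, must be mapped into the corresponding fibre of \<epsilon> n, which is
  open.\<close>

lemma openin_Aut_coset:
  assumes g: "g \<in> Aut L P"
  shows "openin (Aut_topology L P) {h \<in> Aut L P. \<forall>x\<in>Carrier P. \<epsilon> n (h x) = \<epsilon> n (g x)}"
proof -
  let ?T = "Homeo_topology (Top P)"
  define W where "W z = {f \<in> Homeo (Top P). f ` {x \<in> Carrier P. \<epsilon> n (g x) = z} \<subseteq> {y \<in> Carrier P. \<epsilon> n y = z}}" for z
  have W: "openin ?T (W z)" for z
    unfolding Homeo_topology_def
  proof (rule topology_generated_by_Basis)
    have "compactin (Top P) {x \<in> Carrier P. \<epsilon> n (g x) = z}"
      by (rule closedin_compact_space[OF P_compact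
          closedin_loc_const[OF loc_const_compose[OF \<epsilon>_loc_const Aut_continuous[OF g]]]])
    moreover have "openin (Top P) {y \<in> Carrier P. \<epsilon> n y = z}"
      by (rule openin_loc_const[OF \<epsilon>_loc_const])
    ultimately show "W z \<in> {{f \<in> Homeo (Top P). f ` K \<subseteq> U} | K U. compactin (Top P) K \<and> openin (Top P) U}"
      unfolding W_def by auto
  qed
  \<comment> \<open>Intersecting with the whole space covers an empty index set, which occurs for an
    empty carrier.\<close>
  let ?I = "(\<Inter>z\<in>\<epsilon> n ` Carrier P. W z) \<inter> topspace ?T"
  have "openin ?T ?I"
    using loc_const_finite[OF \<epsilon>_loc_const] W by (intro openin_INT) simp_all
  moreover have "Aut L P \<subseteq> topspace ?T"
  proof -
    \<comment> \<open>The subbasic set for \<open>K = {}\<close> and \<open>U = {}\<close> consists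
      of all homeomorphisms, so every automorphism is a point of the generated topology.\<close>
    have "openin ?T {f \<in> Homeo (Top P). f ` {} \<subseteq> {}}"
      unfolding Homeo_topology_def
      by (rule topology_generated_by_Basis) (intro CollectI exI[of _ "{}"] conjI refl openin_empty compactin_empty)
    then have "{f \<in> Homeo (Top P). f ` {} \<subseteq> {}} \<subseteq> topspace ?T" by (rule openin_subset)
    then show ?thesis using Aut_subset_Homeo by auto
  qed
  moreover have "h \<in> W z \<longleftrightarrow> (\<forall>x\<in>Carrier P. \<epsilon> n (g x) = z \<longrightarrow> \<epsilon> n (h x) = z)" if "h \<in> Aut L P" for h z
    using that Aut_subset_Homeo Aut_in[OF that] by (auto simp: W_def)
  then have "(\<forall>z\<in>\<epsilon> n ` Carrier P. h \<in> W z) \<longleftrightarrow> (\<forall>x\<in>Carrier P. \<epsilon> n (h x) = \<epsilon> n (g x))"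
    if "h \<in> Aut L P" for h
    using that Aut_in[OF g] by auto
  ultimately have "{h \<in> Aut L P. \<forall>x\<in>Carrier P. \<epsilon> n (h x) = \<epsilon> n (g x)} = ?I \<inter> Aut L P"
    by auto
  then show ?thesis
    unfolding Aut_topology_def using \<open>openin ?T ?I\<close> by (auto simp: openin_subtopology)
qed

lemma Aut_topology_eq: "Aut_topology L P = F.filtration_topology"
proof (rule topology_eq[THEN iffD2], intro allI iffI)
  fix S assume "openin (Aut_topology L P) S"
  then show "openin F.filtration_topology S"
    using openin_Homeo_imp_openin_F by (auto simp: Aut_topology_def openin_subtopology)
next
  fix S assume S: "openin F.filtration_topology S"
  show "openin (Aut_topology L P) S"
  proof (subst openin_subopen, intro ballI)
    fix g assume g: "g \<in> S"
    then have gA: "g \<in> Aut L P" using S by (auto simp: openin_F)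
    obtain n where "\<forall>h\<in>Aut L P. (\<forall>x\<in>Carrier P. \<epsilon> n (h x) = \<epsilon> n (g x)) \<longrightarrow> h \<in> S"
      using S g unfolding openin_F by auto
    then have "{h \<in> Aut L P. \<forall>x\<in>Carrier P. \<epsilon> n (h x) = \<epsilon> n (g x)} \<subseteq> S" by auto
    then show "\<exists>T. openin (Aut_topology L P) T \<and> g \<in> T \<and> T \<subseteq> S"
      using openin_Aut_coset[OF gA, of n] gA
      by (intro exI[of _ "{h \<in> Aut L P. \<forall>x\<in>Carrier P. \<epsilon> n (h x) = \<epsilon> n (g x)}"]) simp
  qed
qed

end

section \<open>The induced family and the conjugation action\<close>

locale induced_setting = fraisse_sequence L G P E \<epsilon>
  for L :: "('f, 'r) language" and G :: "('a, 'f, 'r) lstruct set" and P :: "('p, 'f, 'r) lstruct"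
    and E :: "nat \<Rightarrow> ('a, 'f, 'r) lstruct" and \<epsilon> :: "nat \<Rightarrow> 'p \<Rightarrow> 'a" +
  fixes H :: "('p \<Rightarrow> 'p) set" and s :: 'r
  assumes H_closed: "closedin (Aut_topology L P) H"
    and H_nonempty: "H \<noteq> {}"
    and H_conj: "\<lbrakk>g \<in> Aut L P; h \<in> H\<rbrakk> \<Longrightarrow> conj_action (Aut_group L P) g h \<in> H"
    and s_new: "s \<notin> rels L"
begin

abbreviation "L' \<equiv> expand_language L s"
abbreviation "\<F> \<equiv> induced_family L s G P H"

interpretation F: filtered_group \<Gamma> V by (rule filtered_Aut)

lemma conjugation_space_Aut: "conjugation_space \<Gamma> V H"
proof (intro conjugation_space.intro conjugation_space_axioms.intro)
  show "filtered_group \<Gamma> V" by (rule filtered_Aut)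
  show "closedin F.filtration_topology H" using H_closed unfolding Aut_topology_eq .
  show "H \<noteq> {}" by (rule H_nonempty)
  show "conj_action \<Gamma> g x \<in> H" if "g \<in> carrier \<Gamma>" "x \<in> H" for g x
    using that H_conj by simp
qed

interpretation CS: conjugation_space \<Gamma> V H by (rule conjugation_space_Aut)

lemma H_Aut: "f \<in> H \<Longrightarrow> f \<in> Aut L P"
  using CS.H_carrier by simp

section \<open>Members of the family as basic open subsets of \<open>H\<close>\<close>

lemma epimorphism_induced_iff:
  assumes "epimorphism L P A \<alpha>" and "epimorphism L P B \<beta>" and "f \<in> H" and "g \<in> H"
  shows "epimorphism L' (expand s B (push \<beta> f)) (expand s A (push \<alpha> g)) \<pi> \<longleftrightarrow>
    epimorphism L B A \<pi> \<and> push (\<lambda>x. \<pi> (\<beta> x)) f = push \<alpha> g"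
  unfolding push_compose
  by (rule epimorphism_expand_iff[OF s_new push_subset[OF H_Aut[OF assms(3)] epimorphism_surj[OF assms(2)]]
    push_subset[OF H_Aut[OF assms(4)] epimorphism_surj[OF assms(1)]]])

text \<open>Once \<phi> and \<open>f\<close> are chosen the relation is forced to be the image of
  the graph of \<open>f\<close>. Conversely the structure does not determine \<phi> and
  \<open>f\<close>, hence the need for \<open>realize_push\<close>.\<close>

lemma induced_iff:
  "X \<in> \<F> \<longleftrightarrow> (\<exists>A \<phi> f. A \<in> G \<and> epimorphism L P A \<phi> \<and> f \<in> H \<and> X = expand s A (push \<phi> f))"
proof -
  have epi: "epimorphism L' (expand_fun s P f) (expand s A R) \<phi> \<longleftrightarrow> epimorphism L P A \<phi> \<and> push \<phi> f = R"
    if f: "f \<in> H" and R: "R \<subseteq> Carrier A \<times> Carrier A" for f A R \<phi>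
  proof -
    let ?g = "{(x, y). x \<in> Carrier P \<and> y \<in> Carrier P \<and> f x = y}"
    have "?g = (\<lambda>x. (x, f x)) ` Carrier P" using Aut_in[OF H_Aut[OF f]] by auto
    then have "map_prod \<phi> \<phi> ` ?g = push \<phi> f" by (simp add: push_def image_image)
    moreover have "?g \<subseteq> Carrier P \<times> Carrier P" by auto
    ultimately show ?thesis
      unfolding expand_fun_def using epimorphism_expand_iff[OF s_new _ R, of ?g P \<phi>] by simp
  qed
  show ?thesis
  proof
    assume "X \<in> \<F>"
    then obtain A R \<phi> f where X: "X = expand s A R" "A \<in> G" "R \<subseteq> Carrier A \<times> Carrier A" "epimorphism L P A \<phi>"
      "f \<in> H" "epimorphism L' (expand_fun s P f) (expand s A R) \<phi>"
      unfolding induced_family_def by auto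
    then have "R = push \<phi> f" using epi[OF X(5,3)] by simp
    with X show "\<exists>A \<phi> f. A \<in> G \<and> epimorphism L P A \<phi> \<and> f \<in> H \<and> X = expand s A (push \<phi> f)" by auto
  next
    assume "\<exists>A \<phi> f. A \<in> G \<and> epimorphism L P A \<phi> \<and> f \<in> H \<and> X = expand s A (push \<phi> f)"
    then obtain A \<phi> f where X: "A \<in> G" "epimorphism L P A \<phi>" "f \<in> H" "X = expand s A (push \<phi> f)" by auto
    have R: "push \<phi> f \<subseteq> Carrier A \<times> Carrier A"
      by (rule push_subset[OF H_Aut[OF X(3)] epimorphism_surj[OF X(2)]])
    have "epimorphism L' (expand_fun s P f) (expand s A (push \<phi> f)) \<phi>" using epi[OF X(3) R] X(2) by simp
    with X R show "X \<in> \<F>" unfolding induced_family_def by auto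
  qed
qed

lemma inducedI: "\<lbrakk>A \<in> G; epimorphism L P A \<phi>; f \<in> H\<rbrakk> \<Longrightarrow> expand s A (push \<phi> f) \<in> \<F>"
  using induced_iff by auto

lemma inducedE:
  assumes "X \<in> \<F>"
  obtains A \<phi> f where "A \<in> G" "epimorphism L P A \<phi>" "f \<in> H" "X = expand s A (push \<phi> f)"
  using assms induced_iff by auto

text \<open>Here conjugation invariance of \<open>H\<close> meets (L3): the automorphism relating
  the two epimorphisms conjugates \<open>f\<close> into the required map.\<close>

lemma realize_push:
  assumes "A \<in> G" and "epimorphism L P A \<phi>" and "epimorphism L P A \<psi>" and "f \<in> H"
  shows "\<exists>f'\<in>H. push \<psi> f' = push \<phi> f"
proof -
  obtain g where g: "g \<in> Aut L P" "\<forall>x\<in>Carrier P. \<phi> x = \<psi> (g x)"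
    using Aut_conjugates_epis[OF assms(1,3,2)] by auto
  have "push \<phi> f = push (\<lambda>x. \<psi> (g x)) f" by (rule push_cong[OF H_Aut[OF assms(4)]]) (use g(2) in simp)
  also have "\<dots> = push \<psi> (conj_action \<Gamma> g f)" by (rule push_conj[OF g(1) H_Aut[OF assms(4)], symmetric])
  finally show ?thesis using H_conj[OF g(1) assms(4)] by (intro bexI[of _ "conj_action \<Gamma> g f"]) simp_all
qed

lemma nbd_iff:
  "f \<in> H \<Longrightarrow> f' \<in> CS.nbd n f \<longleftrightarrow> f' \<in> H \<and> (\<forall>x\<in>Carrier P. \<epsilon> n (f' x) = \<epsilon> n (f x))"
  using V_coset_iff H_Aut by (auto simp: CS.nbd_def)

text \<open>If \<epsilon> n refines \<phi>, maps that agree after \<epsilon> n induce the same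
  relation along \<phi>.\<close>

lemma openin_push:
  assumes "loc_const \<phi>"
  shows "openin CS.X {f \<in> H. push \<phi> f = R}"
  unfolding CS.openin_X
proof (intro conjI ballI)
  fix f assume "f \<in> {f \<in> H. push \<phi> f = R}"
  then have f: "f \<in> H" "push \<phi> f = R" by auto
  obtain n where n: "n \<ge> 0" "finer (\<epsilon> n) \<phi>" using \<epsilon>_cofinal[OF assms] .
  have "f' \<in> {f \<in> H. push \<phi> f = R}" if f': "f' \<in> CS.nbd n f" for f'
  proof -
    have H': "f' \<in> H" and eq: "\<forall>x\<in>Carrier P. \<epsilon> n (f' x) = \<epsilon> n (f x)"
      using f' nbd_iff[OF f(1)] by auto
    have "\<phi> (f' x) = \<phi> (f x)" if "x \<in> Carrier P" for x
      using finerD[OF n(2) bspec[OF eq that] Aut_in[OF H_Aut[OF H'] that] Aut_in[OF H_Aut[OF f(1)] that]] .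
    then have "push \<phi> f' = push \<phi> f" unfolding push_def by (intro image_cong) simp_all
    then show ?thesis using H' f(2) by simp
  qed
  then show "\<exists>n. CS.nbd n f \<subseteq> {f \<in> H. push \<phi> f = R}" by auto
qed auto

text \<open>The relation on \<open>E m\<close> determines \<open>f\<close> up to \<epsilon> n once
  \<epsilon> m refines both \<epsilon> n and \<epsilon> n \<circ> f. The pair that \<open>f'\<close>
  gives at \<open>x\<close> is the pair that \<open>f\<close> gives at some \<open>y\<close>; so
  \<epsilon> n takes equal values at \<open>f' x\<close> and \<open>f y\<close>, and also at
  \<open>f y\<close> and \<open>f x\<close>.\<close>

lemma push_base:
  assumes U: "openin CS.X U" "f \<in> U"
  shows "\<exists>m\<ge>k. \<forall>f'\<in>H. push (\<epsilon> m) f' = push (\<epsilon> m) f \<longrightarrow> f' \<in> U"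
proof -
  have fH: "f \<in> H" using CS.openin_X_H[OF U] .
  obtain n where n: "CS.nbd n f \<subseteq> U" using U unfolding CS.openin_X by auto
  obtain m where m: "m \<ge> max k n" "finer (\<epsilon> m) (\<lambda>x. \<epsilon> n (f x))"
    using \<epsilon>_cofinal[OF loc_const_compose[OF \<epsilon>_loc_const Aut_continuous[OF H_Aut[OF fH]]]] .
  show ?thesis
  proof (intro exI conjI ballI impI)
    show "m \<ge> k" using m(1) by simp
    fix f' assume f': "f' \<in> H" "push (\<epsilon> m) f' = push (\<epsilon> m) f"
    have "\<epsilon> n (f' x) = \<epsilon> n (f x)" if x: "x \<in> Carrier P" for x
    proof -
      have "(\<epsilon> m x, \<epsilon> m (f' x)) \<in> push (\<epsilon> m) f'" using x unfolding push_def by (rule rev_image_eqI) (rule refl)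
      then have "(\<epsilon> m x, \<epsilon> m (f' x)) \<in> push (\<epsilon> m) f" using f'(2) by simp
      then obtain y where y: "y \<in> Carrier P" "\<epsilon> m x = \<epsilon> m y" "\<epsilon> m (f' x) = \<epsilon> m (f y)"
        by (auto simp: push_def)
      have "m \<ge> n" using m(1) by simp
      have "\<epsilon> n (f' x) = \<epsilon> n (f y)"
        using finerD[OF \<epsilon>_mono[OF \<open>m \<ge> n\<close>] y(3) Aut_in[OF H_Aut[OF f'(1)] x] Aut_in[OF H_Aut[OF fH] y(1)]] .
      also have "\<dots> = \<epsilon> n (f x)" using finerD[OF m(2) y(2) x y(1)] by simp
      finally show ?thesis .
    qed
    then have "f' \<in> CS.nbd n f" using nbd_iff[OF fH] f'(1) by simp
    then show "f' \<in> U" using n by auto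
  qed
qed

text \<open>By (L3), \<psi> is \<epsilon> n composed with an automorphism \<open>g\<close>, and
  conjugation by \<open>g\<close> carries the relation from \<psi> over to \<epsilon> n. The formula
  for \<psi> stays in the conclusion because weak amalgamation compares two such
  automorphisms.\<close>

lemma hit_push_nbd:
  assumes U: "\<forall>f'\<in>H. push (\<epsilon> n) f' = push (\<epsilon> n) f0 \<longrightarrow> f' \<in> U"
    and \<psi>: "epimorphism L P (E n) \<psi>" and f: "f \<in> H" and tr: "push \<psi> f = push (\<epsilon> n) f0"
  shows "\<exists>g\<in>Aut L P. (\<forall>x\<in>Carrier P. \<psi> x = \<epsilon> n (g x)) \<and> conj_action \<Gamma> g f \<in> U"
proof -
  obtain g where g: "g \<in> Aut L P" "\<forall>x\<in>Carrier P. \<psi> x = \<epsilon> n (g x)"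
    using Aut_conjugates_epis[OF E_in \<epsilon>_epi \<psi>] by auto
  have "push (\<epsilon> n) (conj_action \<Gamma> g f) = push (\<lambda>x. \<epsilon> n (g x)) f" by (rule push_conj[OF g(1) H_Aut[OF f]])
  also have "\<dots> = push \<psi> f" by (rule push_cong[OF H_Aut[OF f]]) (use g(2) in simp)
  also note tr
  finally have "conj_action \<Gamma> g f \<in> U" using U H_conj[OF g(1) f] by simp
  then show ?thesis using g by (intro bexI[of _ g] conjI)
qed

section \<open>Projection properties of the family against transitivity of the action\<close>

lemma conj_transfer:
  assumes "g1 \<in> Aut L P" and "g2 \<in> Aut L P" and "f \<in> H"
  shows "conj_action \<Gamma> (g2 \<otimes>\<^bsub>\<Gamma>\<^esub> inv\<^bsub>\<Gamma>\<^esub> g1) (conj_action \<Gamma> g1 f) = conj_action \<Gamma> g2 f"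
proof -
  have "conj_action \<Gamma> (g2 \<otimes>\<^bsub>\<Gamma>\<^esub> inv\<^bsub>\<Gamma>\<^esub> g1) (conj_action \<Gamma> g1 f) =
    conj_action \<Gamma> g2 (conj_action \<Gamma> (inv\<^bsub>\<Gamma>\<^esub> g1) (conj_action \<Gamma> g1 f))"
    by (rule CS.act_mult) (simp_all only: carrier_Aut assms inv_Aut H_conj)
  also have "conj_action \<Gamma> (inv\<^bsub>\<Gamma>\<^esub> g1) (conj_action \<Gamma> g1 f) = f"
    by (rule CS.act_inv) (simp_all only: carrier_Aut assms)
  finally show ?thesis .
qed

text \<open>A common cover of the structures induced by \<open>f1\<close> and \<open>f2\<close>
  carries a single \<open>f\<close>. Each projection, read as an epimorphism from \<open>P\<close>,
  provides an automorphism that conjugates \<open>f\<close> into the corresponding open set.\<close>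

lemma JPP_imp_transitive:
  assumes "JPP L' \<F>"
  shows CS.transitive
  unfolding CS.transitive_def
proof (intro allI impI)
  fix W1 W2 assume "openin CS.X W1 \<and> W1 \<noteq> {} \<and> openin CS.X W2 \<and> W2 \<noteq> {}"
  then obtain f1 f2 where W: "openin CS.X W1" "f1 \<in> W1" "openin CS.X W2" "f2 \<in> W2" by auto
  have fH: "f1 \<in> H" "f2 \<in> H" using CS.openin_X_H[OF W(1,2)] CS.openin_X_H[OF W(3,4)] .
  obtain n1 where n1: "n1 \<ge> 0" "\<forall>f'\<in>H. push (\<epsilon> n1) f' = push (\<epsilon> n1) f1 \<longrightarrow> f' \<in> W1"
    using push_base[OF W(1,2)] by metis
  obtain n2 where n2: "n2 \<ge> 0" "\<forall>f'\<in>H. push (\<epsilon> n2) f' = push (\<epsilon> n2) f2 \<longrightarrow> f' \<in> W2"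
    using push_base[OF W(3,4)] by metis
  obtain C' \<pi>1 \<pi>2 where C': "C' \<in> \<F>"
    "epimorphism L' C' (expand s (E n1) (push (\<epsilon> n1) f1)) \<pi>1"
    "epimorphism L' C' (expand s (E n2) (push (\<epsilon> n2) f2)) \<pi>2"
    using assms inducedI[OF E_in \<epsilon>_epi fH(1), of n1] inducedI[OF E_in \<epsilon>_epi fH(2), of n2]
    unfolding JPP_def by meson
  obtain C \<gamma> f where C: "C \<in> G" "epimorphism L P C \<gamma>" "f \<in> H" "C' = expand s C (push \<gamma> f)"
    using inducedE[OF C'(1)] .
  have \<pi>1: "epimorphism L C (E n1) \<pi>1" "push (\<lambda>x. \<pi>1 (\<gamma> x)) f = push (\<epsilon> n1) f1"
    using C'(2) epimorphism_induced_iff[OF \<epsilon>_epi C(2,3) fH(1)] unfolding C(4) by simp_all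
  have \<pi>2: "epimorphism L C (E n2) \<pi>2" "push (\<lambda>x. \<pi>2 (\<gamma> x)) f = push (\<epsilon> n2) f2"
    using C'(3) epimorphism_induced_iff[OF \<epsilon>_epi C(2,3) fH(2)] unfolding C(4) by simp_all
  obtain g1 where g1: "g1 \<in> Aut L P" "\<forall>x\<in>Carrier P. \<pi>1 (\<gamma> x) = \<epsilon> n1 (g1 x)" "conj_action \<Gamma> g1 f \<in> W1"
    using hit_push_nbd[OF n1(2) epimorphism_compose[OF C(2) \<pi>1(1)] C(3) \<pi>1(2)] by (elim bexE conjE)
  obtain g2 where g2: "g2 \<in> Aut L P" "\<forall>x\<in>Carrier P. \<pi>2 (\<gamma> x) = \<epsilon> n2 (g2 x)" "conj_action \<Gamma> g2 f \<in> W2"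
    using hit_push_nbd[OF n2(2) epimorphism_compose[OF C(2) \<pi>2(1)] C(3) \<pi>2(2)] by (elim bexE conjE)
  show "\<exists>g\<in>carrier \<Gamma>. \<exists>x\<in>W1. conj_action \<Gamma> g x \<in> W2"
  proof (intro bexI)
    show "conj_action \<Gamma> (g2 \<otimes>\<^bsub>\<Gamma>\<^esub> inv\<^bsub>\<Gamma>\<^esub> g1) (conj_action \<Gamma> g1 f) \<in> W2"
      unfolding conj_transfer[OF g1(1) g2(1) C(3)] by (rule g2(3))
    show "conj_action \<Gamma> g1 f \<in> W1" by (rule g1(3))
    show "g2 \<otimes>\<^bsub>\<Gamma>\<^esub> inv\<^bsub>\<Gamma>\<^esub> g1 \<in> carrier \<Gamma>" using mult_Aut[OF g2(1) inv_Aut[OF g1(1)]] by simp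
  qed
qed

text \<open>The structure \<open>B'\<close> obtained for the one that \<open>f0\<close> induces on
  \<open>E m\<close> becomes the open set \<open>U'\<close>. Two open parts of \<open>U'\<close>
  contain basic sets given by two structures over \<open>B'\<close>; the amalgam carries one
  \<open>f\<close> whose conjugates by \<open>g1\<close> and \<open>g2\<close> lie in these parts,
  and \<open>g2 \<otimes> inv g1\<close> is the element sought.\<close>

lemma WAP_imp_locally_transitive:
  assumes "WAP L' \<F>"
  shows CS.locally_transitive
  unfolding CS.locally_transitive_def
proof (intro allI impI)
  fix n U assume "openin CS.X U \<and> U \<noteq> {}"
  then obtain f0 where U: "openin CS.X U" "f0 \<in> U" by auto
  have f0H: "f0 \<in> H" using CS.openin_X_H[OF U] .
  \<comment> \<open>The demand \<open>m \<ge> n\<close> turns agreement after \<epsilon> m, which is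
    all that weak amalgamation provides, into membership in \<open>V n\<close>.\<close>
  obtain m where m: "m \<ge> n" "\<forall>f'\<in>H. push (\<epsilon> m) f' = push (\<epsilon> m) f0 \<longrightarrow> f' \<in> U"
    using push_base[OF U] by metis
  obtain B' \<pi> where B': "B' \<in> \<F>" "epimorphism L' B' (expand s (E m) (push (\<epsilon> m) f0)) \<pi>"
    and amalg: "\<forall>C1\<in>\<F>. \<forall>C2\<in>\<F>. \<forall>\<phi>1 \<phi>2. epimorphism L' C1 B' \<phi>1 \<and> epimorphism L' C2 B' \<phi>2 \<longrightarrow>
       (\<exists>D\<in>\<F>. \<exists>\<phi>3 \<phi>4. epimorphism L' D C1 \<phi>3 \<and> epimorphism L' D C2 \<phi>4 \<and>
          (\<forall>x\<in>Carrier D. \<pi> (\<phi>1 (\<phi>3 x)) = \<pi> (\<phi>2 (\<phi>4 x))))"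
    using bspec[OF assms[unfolded WAP_def] inducedI[OF E_in \<epsilon>_epi f0H, of m]] by (elim bexE exE conjE)
  obtain B \<beta>0 f1 where B: "B \<in> G" "epimorphism L P B \<beta>0" "f1 \<in> H" "B' = expand s B (push \<beta>0 f1)"
    using inducedE[OF B'(1)] .
  have \<pi>: "epimorphism L B (E m) \<pi>" "push (\<lambda>x. \<pi> (\<beta>0 x)) f1 = push (\<epsilon> m) f0"
    using B'(2) epimorphism_induced_iff[OF \<epsilon>_epi B(2,3) f0H] unfolding B(4) by simp_all
  \<comment> \<open>The epimorphism \<beta>0 that comes with \<open>B'\<close> need not lie over
    \<epsilon> m. It is replaced by a lift \<beta> of \<epsilon> m through \<pi>, and
    \<open>f1\<close> by a map \<open>f2\<close> that induces the same relation along
    \<beta>.\<close>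
  obtain \<beta> where \<beta>: "epimorphism L P B \<beta>" "\<And>x. x \<in> Carrier P \<Longrightarrow> \<pi> (\<beta> x) = \<epsilon> m x"
    using lift_epi[OF E_in B(1) \<pi>(1) \<epsilon>_epi] by auto
  obtain f2 where f2: "f2 \<in> H" "push \<beta> f2 = push \<beta>0 f1"
    using realize_push[OF B(1,2) \<beta>(1) B(3)] by auto
  define U' where "U' = {f \<in> H. push \<beta> f = push \<beta>0 f1}"
  have U'_open: "openin CS.X U'"
    unfolding U'_def by (rule openin_push[OF loc_const_epi[OF B(1) \<beta>(1)]])
  have "U' \<subseteq> U"
  proof
    fix f assume "f \<in> U'"
    then have f: "f \<in> H" "push \<beta> f = push \<beta>0 f1" by (auto simp: U'_def)
    have "push (\<epsilon> m) f = push (\<lambda>x. \<pi> (\<beta> x)) f"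
      by (rule push_cong[OF H_Aut[OF f(1)]]) (simp add: \<beta>(2))
    also have "\<dots> = push (\<lambda>x. \<pi> (\<beta>0 x)) f1" unfolding push_compose f(2) ..
    finally show "f \<in> U" using m(2) f(1) \<pi>(2) by simp
  qed
  have "CS.transitive_on n U'"
    unfolding CS.transitive_on_def
  proof (intro allI impI)
    fix W1 W2 assume "openin CS.X W1 \<and> W1 \<noteq> {} \<and> W1 \<subseteq> U' \<and> openin CS.X W2 \<and> W2 \<noteq> {} \<and> W2 \<subseteq> U'"
    then have W: "openin CS.X W1" "W1 \<noteq> {}" "W1 \<subseteq> U'" "openin CS.X W2" "W2 \<noteq> {}" "W2 \<subseteq> U'" by simp_all
    \<comment> \<open>A nonempty open part of \<open>U'\<close> contains a basic set given by a
      structure on some \<open>E k\<close>, with \<open>k\<close> so large that \<beta> factors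
      through \<epsilon> k; the factor \<rho> maps that structure onto \<open>B'\<close>.\<close>
    have refine: "\<exists>k \<rho> h. h \<in> H \<and> epimorphism L (E k) B \<rho> \<and> (\<forall>x\<in>Carrier P. \<rho> (\<epsilon> k x) = \<beta> x) \<and>
        epimorphism L' (expand s (E k) (push (\<epsilon> k) h)) B' \<rho> \<and>
        (\<forall>f'\<in>H. push (\<epsilon> k) f' = push (\<epsilon> k) h \<longrightarrow> f' \<in> W)"
      if W: "openin CS.X W" "W \<noteq> {}" "W \<subseteq> U'" for W
    proof -
      obtain h where h: "h \<in> W" using W(2) by auto
      then have hH: "h \<in> H" "push \<beta> h = push \<beta>0 f1" using W(3) by (auto simp: U'_def)
      obtain k0 where k0: "k0 \<ge> 0" "finer (\<epsilon> k0) \<beta>"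
        using \<epsilon>_cofinal[OF loc_const_epi[OF B(1) \<beta>(1)]] .
      obtain k where k: "k \<ge> k0" "\<forall>f'\<in>H. push (\<epsilon> k) f' = push (\<epsilon> k) h \<longrightarrow> f' \<in> W"
        using push_base[OF W(1) h] by metis
      have "finer (\<epsilon> k) \<beta>" by (rule finer_trans[OF \<epsilon>_mono[OF k(1)] k0(2)])
      then obtain \<rho> where \<rho>: "epimorphism L (E k) B \<rho>" "\<forall>x\<in>Carrier P. \<rho> (\<epsilon> k x) = \<beta> x"
        using finer_epimorphism[OF E_in \<epsilon>_epi \<beta>(1)] by auto
      have "push (\<lambda>x. \<rho> (\<epsilon> k x)) h = push \<beta> h"
        by (rule push_cong[OF H_Aut[OF hH(1)]]) (use \<rho>(2) in simp)
      then have "epimorphism L' (expand s (E k) (push (\<epsilon> k) h)) B' \<rho>"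
        unfolding B(4) epimorphism_induced_iff[OF B(2) \<epsilon>_epi hH(1) B(3)] using \<rho>(1) hH(2) by simp
      with hH(1) \<rho> k(2) show ?thesis by (intro exI[of _ k] exI[of _ \<rho>] exI[of _ h] conjI) simp_all
    qed
    obtain k1 \<rho>1 h1 where 1: "h1 \<in> H" "epimorphism L (E k1) B \<rho>1" "\<forall>x\<in>Carrier P. \<rho>1 (\<epsilon> k1 x) = \<beta> x"
      "epimorphism L' (expand s (E k1) (push (\<epsilon> k1) h1)) B' \<rho>1"
      "\<forall>f'\<in>H. push (\<epsilon> k1) f' = push (\<epsilon> k1) h1 \<longrightarrow> f' \<in> W1"
      using refine[OF W(1-3)] by (elim exE conjE)
    obtain k2 \<rho>2 h2 where 2: "h2 \<in> H" "epimorphism L (E k2) B \<rho>2" "\<forall>x\<in>Carrier P. \<rho>2 (\<epsilon> k2 x) = \<beta> x"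
      "epimorphism L' (expand s (E k2) (push (\<epsilon> k2) h2)) B' \<rho>2"
      "\<forall>f'\<in>H. push (\<epsilon> k2) f' = push (\<epsilon> k2) h2 \<longrightarrow> f' \<in> W2"
      using refine[OF W(4-6)] by (elim exE conjE)
    obtain D' \<sigma>1 \<sigma>2 where D': "D' \<in> \<F>"
      "epimorphism L' D' (expand s (E k1) (push (\<epsilon> k1) h1)) \<sigma>1"
      "epimorphism L' D' (expand s (E k2) (push (\<epsilon> k2) h2)) \<sigma>2"
      "\<forall>x\<in>Carrier D'. \<pi> (\<rho>1 (\<sigma>1 x)) = \<pi> (\<rho>2 (\<sigma>2 x))"
      using amalg[rule_format, OF inducedI[OF E_in \<epsilon>_epi 1(1)] inducedI[OF E_in \<epsilon>_epi 2(1)], OF conjI[OF 1(4) 2(4)]]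
      by (elim bexE exE conjE)
    obtain D \<delta> f where D: "D \<in> G" "epimorphism L P D \<delta>" "f \<in> H" "D' = expand s D (push \<delta> f)"
      using inducedE[OF D'(1)] .
    have \<sigma>1: "epimorphism L D (E k1) \<sigma>1" "push (\<lambda>x. \<sigma>1 (\<delta> x)) f = push (\<epsilon> k1) h1"
      using D'(2) epimorphism_induced_iff[OF \<epsilon>_epi D(2,3) 1(1)] unfolding D(4) by simp_all
    have \<sigma>2: "epimorphism L D (E k2) \<sigma>2" "push (\<lambda>x. \<sigma>2 (\<delta> x)) f = push (\<epsilon> k2) h2"
      using D'(3) epimorphism_induced_iff[OF \<epsilon>_epi D(2,3) 2(1)] unfolding D(4) by simp_all
    have agree: "\<pi> (\<rho>1 (\<sigma>1 (\<delta> x))) = \<pi> (\<rho>2 (\<sigma>2 (\<delta> x)))" if "x \<in> Carrier P" for x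
    proof -
      have "\<delta> x \<in> Carrier D'"
        using that epimorphism_surj[OF D(2)] by (auto simp: D(4) expand_def)
      then show ?thesis using D'(4) by simp
    qed
    obtain g1 where g1: "g1 \<in> Aut L P" "\<forall>x\<in>Carrier P. \<sigma>1 (\<delta> x) = \<epsilon> k1 (g1 x)" "conj_action \<Gamma> g1 f \<in> W1"
      using hit_push_nbd[OF 1(5) epimorphism_compose[OF D(2) \<sigma>1(1)] D(3) \<sigma>1(2)] by (elim bexE conjE)
    obtain g2 where g2: "g2 \<in> Aut L P" "\<forall>x\<in>Carrier P. \<sigma>2 (\<delta> x) = \<epsilon> k2 (g2 x)" "conj_action \<Gamma> g2 f \<in> W2"
      using hit_push_nbd[OF 2(5) epimorphism_compose[OF D(2) \<sigma>2(1)] D(3) \<sigma>2(2)] by (elim bexE conjE)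
    have "\<epsilon> m (g2 x) = \<epsilon> m (g1 x)" if x: "x \<in> Carrier P" for x
    proof -
      have "\<pi> (\<rho>1 (\<sigma>1 (\<delta> x))) = \<epsilon> m (g1 x)"
        using bspec[OF g1(2) x] 1(3) \<beta>(2) Aut_in[OF g1(1) x] by simp
      moreover have "\<pi> (\<rho>2 (\<sigma>2 (\<delta> x))) = \<epsilon> m (g2 x)"
        using bspec[OF g2(2) x] 2(3) \<beta>(2) Aut_in[OF g2(1) x] by simp
      ultimately show ?thesis using agree[OF x] by simp
    qed
    then have eq: "\<epsilon> n (g2 x) = \<epsilon> n (g1 x)" if x: "x \<in> Carrier P" for x
      using finerD[OF \<epsilon>_mono[OF m(1)] _ Aut_in[OF g2(1) x] Aut_in[OF g1(1) x]] x by simp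
    show "\<exists>v\<in>V n. \<exists>x\<in>W1. conj_action \<Gamma> v x \<in> W2"
    proof (intro bexI)
      show "conj_action \<Gamma> (g2 \<otimes>\<^bsub>\<Gamma>\<^esub> inv\<^bsub>\<Gamma>\<^esub> g1) (conj_action \<Gamma> g1 f) \<in> W2"
        unfolding conj_transfer[OF g1(1) g2(1) D(3)] by (rule g2(3))
      show "conj_action \<Gamma> g1 f \<in> W1" by (rule g1(3))
      show "g2 \<otimes>\<^bsub>\<Gamma>\<^esub> inv\<^bsub>\<Gamma>\<^esub> g1 \<in> V n" using V_coset_iff[OF g2(1) g1(1)] eq by simp
    qed
  qed
  moreover have "f2 \<in> U'" using f2 by (simp add: U'_def)
  ultimately show "\<exists>U'. openin CS.X U' \<and> U' \<noteq> {} \<and> U' \<subseteq> U \<and> CS.transitive_on n U'"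
    using U'_open \<open>U' \<subseteq> U\<close> by (intro exI[of _ U']) auto
qed

text \<open>The conjugate of \<open>f\<close> by \<open>g\<close> induces along \<beta> what
  \<open>f\<close> induces along \<beta> \<circ> g. So one \<open>f\<close> serves for both
  structures, and an epimorphism refining \<alpha> and \<beta> \<circ> g yields the common
  cover.\<close>

lemma transitive_imp_JPP:
  assumes CS.transitive
  shows "JPP L' \<F>"
  unfolding JPP_def
proof (intro ballI)
  fix A' B' assume A': "A' \<in> \<F>" and B': "B' \<in> \<F>"
  obtain A \<alpha> f1 where A: "A \<in> G" "epimorphism L P A \<alpha>" "f1 \<in> H" "A' = expand s A (push \<alpha> f1)"
    using inducedE[OF A'] .
  obtain B \<beta> f2 where B: "B \<in> G" "epimorphism L P B \<beta>" "f2 \<in> H" "B' = expand s B (push \<beta> f2)"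
    using inducedE[OF B'] .
  let ?W1 = "{f \<in> H. push \<alpha> f = push \<alpha> f1}" and ?W2 = "{f \<in> H. push \<beta> f = push \<beta> f2}"
  have "openin CS.X ?W1" "openin CS.X ?W2" "?W1 \<noteq> {}" "?W2 \<noteq> {}"
    using openin_push[OF loc_const_epi] A(1-3) B(1-3) by auto
  then have "\<exists>g\<in>carrier \<Gamma>. \<exists>x\<in>?W1. conj_action \<Gamma> g x \<in> ?W2"
    using assms[unfolded CS.transitive_def, rule_format, of ?W1 ?W2] by simp
  then obtain g f where g: "g \<in> Aut L P" and f: "f \<in> H" "push \<alpha> f = push \<alpha> f1"
    and gf: "push \<beta> (conj_action \<Gamma> g f) = push \<beta> f2"
    by auto
  have \<beta>g: "epimorphism L P B (\<lambda>x. \<beta> (g x))" by (rule epimorphism_compose[OF Aut_epi[OF g] B(2)])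
  obtain C \<gamma> where C: "C \<in> G" "epimorphism L P C \<gamma>" "finer \<gamma> \<alpha>" "finer \<gamma> (\<lambda>x. \<beta> (g x))"
    using common_refinement[OF loc_const_epi[OF A(1,2)] loc_const_epi[OF B(1) \<beta>g]] by auto
  obtain \<pi>1 where \<pi>1: "epimorphism L C A \<pi>1" "\<forall>x\<in>Carrier P. \<pi>1 (\<gamma> x) = \<alpha> x"
    using finer_epimorphism[OF C(1,2) A(2) C(3)] by auto
  obtain \<pi>2 where \<pi>2: "epimorphism L C B \<pi>2" "\<forall>x\<in>Carrier P. \<pi>2 (\<gamma> x) = \<beta> (g x)"
    using finer_epimorphism[OF C(1,2) \<beta>g C(4)] by auto
  have "push (\<lambda>x. \<pi>1 (\<gamma> x)) f = push \<alpha> f"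
    by (rule push_cong[OF H_Aut[OF f(1)]]) (use \<pi>1(2) in simp)
  then have 1: "epimorphism L' (expand s C (push \<gamma> f)) A' \<pi>1"
    unfolding A(4) epimorphism_induced_iff[OF A(2) C(2) f(1) A(3)] using \<pi>1(1) f(2) by simp
  have "push (\<lambda>x. \<pi>2 (\<gamma> x)) f = push (\<lambda>x. \<beta> (g x)) f"
    by (rule push_cong[OF H_Aut[OF f(1)]]) (use \<pi>2(2) in simp)
  then have 2: "epimorphism L' (expand s C (push \<gamma> f)) B' \<pi>2"
    unfolding B(4) epimorphism_induced_iff[OF B(2) C(2) f(1) B(3)]
    using \<pi>2(1) gf push_conj[OF g H_Aut[OF f(1)], of \<beta>] by simp
  show "\<exists>C\<in>\<F>. (\<exists>\<phi>. epimorphism L' C A' \<phi>) \<and> (\<exists>\<psi>. epimorphism L' C B' \<psi>)"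
    by (rule bexI[OF _ inducedI[OF C(1,2) f(1)]]) (intro conjI exI, rule 1, rule 2)
qed

text \<open>Local transitivity shrinks the basic set of \<open>A'\<close> to some \<open>U'\<close>,
  and \<open>?B\<close> describes a basic subset of \<open>U'\<close>. Structures over
  \<open>?B\<close> correspond to open subsets of \<open>U'\<close>; an element \<open>v\<close> of
  \<open>V n\<close> linking two of them gives the amalgam, as a common refinement of \<gamma>1 and
  \<gamma>2 \<circ> v.\<close>

lemma locally_transitive_imp_WAP:
  assumes CS.locally_transitive
  shows "WAP L' \<F>"
  unfolding WAP_def
proof (rule ballI)
  fix A' assume A': "A' \<in> \<F>"
  obtain A \<alpha> f0 where A: "A \<in> G" "epimorphism L P A \<alpha>" "f0 \<in> H" "A' = expand s A (push \<alpha> f0)"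
    using inducedE[OF A'] .
  \<comment> \<open>This \<open>n\<close> makes \<alpha> invariant under \<open>V n\<close>, on
    which the final agreement over \<open>A'\<close> rests.\<close>
  obtain n where n: "n \<ge> 0" "finer (\<epsilon> n) \<alpha>" using \<epsilon>_cofinal[OF loc_const_epi[OF A(1,2)]] .
  let ?U = "{f \<in> H. push \<alpha> f = push \<alpha> f0}"
  have "openin CS.X ?U" "?U \<noteq> {}"
    using openin_push[OF loc_const_epi[OF A(1,2)]] A(3) by auto
  then have "\<exists>U'. openin CS.X U' \<and> U' \<noteq> {} \<and> U' \<subseteq> ?U \<and> CS.transitive_on n U'"
    using assms[unfolded CS.locally_transitive_def, rule_format, of ?U n] by simp
  then obtain U' f' where U': "openin CS.X U'" "f' \<in> U'" "U' \<subseteq> ?U" "CS.transitive_on n U'" by auto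
  have f': "f' \<in> H" "push \<alpha> f' = push \<alpha> f0" using U'(2,3) by auto
  obtain m where m: "m \<ge> n" "\<forall>f\<in>H. push (\<epsilon> m) f = push (\<epsilon> m) f' \<longrightarrow> f \<in> U'"
    using push_base[OF U'(1,2)] by metis
  have "finer (\<epsilon> m) \<alpha>" by (rule finer_trans[OF \<epsilon>_mono[OF m(1)] n(2)])
  then obtain \<pi> where \<pi>: "epimorphism L (E m) A \<pi>" "\<forall>x\<in>Carrier P. \<pi> (\<epsilon> m x) = \<alpha> x"
    using finer_epimorphism[OF E_in \<epsilon>_epi A(2)] by auto
  let ?B = "expand s (E m) (push (\<epsilon> m) f')"
  have "push (\<lambda>x. \<pi> (\<epsilon> m x)) f' = push \<alpha> f'"
    by (rule push_cong[OF H_Aut[OF f'(1)]]) (use \<pi>(2) in simp)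
  then have \<pi>_epi: "epimorphism L' ?B A' \<pi>"
    unfolding A(4) epimorphism_induced_iff[OF A(2) \<epsilon>_epi f'(1) A(3)] using \<pi>(1) f'(2) by simp
  \<comment> \<open>A structure over \<open>?B\<close> becomes a nonempty open subset of
    \<open>U'\<close>: with \<rho> \<circ> \<gamma> = \<epsilon> m, any \<open>h\<close> inducing
    this structure along \<gamma> induces \<open>?B\<close> along \<epsilon> m.\<close>
  have lift: "\<exists>C \<gamma> f. C \<in> G \<and> epimorphism L P C \<gamma> \<and> f \<in> H \<and> C' = expand s C (push \<gamma> f) \<and>
      (\<forall>x\<in>Carrier P. \<rho> (\<gamma> x) = \<epsilon> m x) \<and> openin CS.X {h \<in> H. push \<gamma> h = push \<gamma> f} \<and>
      {h \<in> H. push \<gamma> h = push \<gamma> f} \<noteq> {} \<and> {h \<in> H. push \<gamma> h = push \<gamma> f} \<subseteq> U'"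
    if C': "C' \<in> \<F>" "epimorphism L' C' ?B \<rho>" for C' \<rho>
  proof -
    obtain C \<gamma>0 f1 where C: "C \<in> G" "epimorphism L P C \<gamma>0" "f1 \<in> H" "C' = expand s C (push \<gamma>0 f1)"
      using inducedE[OF C'(1)] .
    have \<rho>: "epimorphism L C (E m) \<rho>" "push (\<lambda>x. \<rho> (\<gamma>0 x)) f1 = push (\<epsilon> m) f'"
      using C'(2) epimorphism_induced_iff[OF \<epsilon>_epi C(2,3) f'(1)] unfolding C(4) by simp_all
    obtain \<gamma> where \<gamma>: "epimorphism L P C \<gamma>" "\<forall>x\<in>Carrier P. \<rho> (\<gamma> x) = \<epsilon> m x"
      using lift_epi[OF E_in C(1) \<rho>(1) \<epsilon>_epi] by auto
    obtain f where f: "f \<in> H" "push \<gamma> f = push \<gamma>0 f1"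
      using realize_push[OF C(1,2) \<gamma>(1) C(3)] by auto
    have "h \<in> U'" if h: "h \<in> H" "push \<gamma> h = push \<gamma> f" for h
    proof -
      have "push (\<epsilon> m) h = push (\<lambda>x. \<rho> (\<gamma> x)) h"
        by (rule push_cong[OF H_Aut[OF h(1)]]) (use \<gamma>(2) in simp)
      also have "\<dots> = push (\<lambda>x. \<rho> (\<gamma>0 x)) f1" unfolding push_compose h(2) f(2) ..
      also note \<rho>(2)
      finally show ?thesis using m(2) h(1) by simp
    qed
    then have "{h \<in> H. push \<gamma> h = push \<gamma> f} \<subseteq> U'" by auto
    moreover have "{h \<in> H. push \<gamma> h = push \<gamma> f} \<noteq> {}" using f(1) by auto
    moreover have "C' = expand s C (push \<gamma> f)" unfolding C(4) f(2) ..
    ultimately show ?thesis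
      using C(1) \<gamma> f(1) openin_push[OF loc_const_epi[OF C(1) \<gamma>(1)]]
      by (intro exI[of _ C] exI[of _ \<gamma>] exI[of _ f] conjI)
  qed
  have amalg: "\<exists>D\<in>\<F>. \<exists>\<phi>3 \<phi>4. epimorphism L' D C1 \<phi>3 \<and> epimorphism L' D C2 \<phi>4 \<and>
      (\<forall>x\<in>Carrier D. \<pi> (\<phi>1 (\<phi>3 x)) = \<pi> (\<phi>2 (\<phi>4 x)))"
    if in\<F>: "C1 \<in> \<F>" "C2 \<in> \<F>" and epi: "epimorphism L' C1 ?B \<phi>1" "epimorphism L' C2 ?B \<phi>2"
    for C1 C2 \<phi>1 \<phi>2
  proof -
    obtain K1 \<gamma>1 f1 where 1: "K1 \<in> G" "epimorphism L P K1 \<gamma>1" "f1 \<in> H" "C1 = expand s K1 (push \<gamma>1 f1)"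
      "\<forall>x\<in>Carrier P. \<phi>1 (\<gamma>1 x) = \<epsilon> m x" "openin CS.X {h \<in> H. push \<gamma>1 h = push \<gamma>1 f1}"
      "{h \<in> H. push \<gamma>1 h = push \<gamma>1 f1} \<noteq> {}" "{h \<in> H. push \<gamma>1 h = push \<gamma>1 f1} \<subseteq> U'"
      using lift[OF in\<F>(1) epi(1)] by (elim exE conjE)
    obtain K2 \<gamma>2 f2 where 2: "K2 \<in> G" "epimorphism L P K2 \<gamma>2" "f2 \<in> H" "C2 = expand s K2 (push \<gamma>2 f2)"
      "\<forall>x\<in>Carrier P. \<phi>2 (\<gamma>2 x) = \<epsilon> m x" "openin CS.X {h \<in> H. push \<gamma>2 h = push \<gamma>2 f2}"
      "{h \<in> H. push \<gamma>2 h = push \<gamma>2 f2} \<noteq> {}" "{h \<in> H. push \<gamma>2 h = push \<gamma>2 f2} \<subseteq> U'"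
      using lift[OF in\<F>(2) epi(2)] by (elim exE conjE)
    have "\<exists>v\<in>V n. \<exists>x\<in>{h \<in> H. push \<gamma>1 h = push \<gamma>1 f1}.
        conj_action \<Gamma> v x \<in> {h \<in> H. push \<gamma>2 h = push \<gamma>2 f2}"
      using U'(4)[unfolded CS.transitive_on_def, rule_format, OF conjI[OF 1(6) conjI[OF 1(7) conjI[OF 1(8)
        conjI[OF 2(6) conjI[OF 2(7) 2(8)]]]]]] .
    then obtain v f where v: "v \<in> V n" and f: "f \<in> H" "push \<gamma>1 f = push \<gamma>1 f1"
      and vf: "push \<gamma>2 (conj_action \<Gamma> v f) = push \<gamma>2 f2"
      by auto
    have vA: "v \<in> Aut L P" using v by (simp add: V_def)
    have \<gamma>v: "epimorphism L P K2 (\<lambda>x. \<gamma>2 (v x))" by (rule epimorphism_compose[OF Aut_epi[OF vA] 2(2)])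
    obtain D \<delta> where D: "D \<in> G" "epimorphism L P D \<delta>" "finer \<delta> \<gamma>1" "finer \<delta> (\<lambda>x. \<gamma>2 (v x))"
      using common_refinement[OF loc_const_epi[OF 1(1,2)] loc_const_epi[OF 2(1) \<gamma>v]] by auto
    obtain \<rho>1 where \<rho>1: "epimorphism L D K1 \<rho>1" "\<forall>x\<in>Carrier P. \<rho>1 (\<delta> x) = \<gamma>1 x"
      using finer_epimorphism[OF D(1,2) 1(2) D(3)] by auto
    obtain \<rho>2 where \<rho>2: "epimorphism L D K2 \<rho>2" "\<forall>x\<in>Carrier P. \<rho>2 (\<delta> x) = \<gamma>2 (v x)"
      using finer_epimorphism[OF D(1,2) \<gamma>v D(4)] by auto
    let ?D = "expand s D (push \<delta> f)"
    have "push (\<lambda>x. \<rho>1 (\<delta> x)) f = push \<gamma>1 f"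
      by (rule push_cong[OF H_Aut[OF f(1)]]) (use \<rho>1(2) in simp)
    then have e1: "epimorphism L' ?D C1 \<rho>1"
      unfolding 1(4) epimorphism_induced_iff[OF 1(2) D(2) f(1) 1(3)] using \<rho>1(1) f(2) by simp
    have "push (\<lambda>x. \<rho>2 (\<delta> x)) f = push (\<lambda>x. \<gamma>2 (v x)) f"
      by (rule push_cong[OF H_Aut[OF f(1)]]) (use \<rho>2(2) in simp)
    then have e2: "epimorphism L' ?D C2 \<rho>2"
      unfolding 2(4) epimorphism_induced_iff[OF 2(2) D(2) f(1) 2(3)]
      using \<rho>2(1) vf push_conj[OF vA H_Aut[OF f(1)], of \<gamma>2] by simp
    \<comment> \<open>For \<open>d = \<delta> x\<close> the two sides are \<open>\<alpha> x\<close>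
      and \<open>\<alpha> (v x)\<close>.\<close>
    have "\<pi> (\<phi>1 (\<rho>1 d)) = \<pi> (\<phi>2 (\<rho>2 d))" if "d \<in> Carrier ?D" for d
    proof -
      have "d \<in> \<delta> ` Carrier P" using that epimorphism_surj[OF D(2)] by (simp add: expand_def)
      then obtain x where x: "x \<in> Carrier P" "d = \<delta> x" by auto
      have vx: "v x \<in> Carrier P" by (rule Aut_in[OF vA x(1)])
      have "\<epsilon> n (v x) = \<epsilon> n x" using v x(1) by (simp add: V_def)
      then have "\<alpha> (v x) = \<alpha> x" by (rule finerD[OF n(2) _ vx x(1)])
      then show ?thesis
        using x \<rho>1(2) \<rho>2(2) 1(5) 2(5) \<pi>(2) vx by simp
    qed
    then show ?thesis
      by (intro bexI[OF _ inducedI[OF D(1,2) f(1)]] exI[of _ \<rho>1] exI[of _ \<rho>2] conjI ballI e1 e2)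
  qed
  show "\<exists>B\<in>\<F>. \<exists>\<phi>. epimorphism L' B A' \<phi> \<and>
      (\<forall>C1\<in>\<F>. \<forall>C2\<in>\<F>. \<forall>\<phi>1 \<phi>2. epimorphism L' C1 B \<phi>1 \<and> epimorphism L' C2 B \<phi>2 \<longrightarrow>
        (\<exists>D\<in>\<F>. \<exists>\<phi>3 \<phi>4. epimorphism L' D C1 \<phi>3 \<and> epimorphism L' D C2 \<phi>4 \<and>
          (\<forall>x\<in>Carrier D. \<phi> (\<phi>1 (\<phi>3 x)) = \<phi> (\<phi>2 (\<phi>4 x)))))"
  proof (rule bexI[OF _ inducedI[OF E_in \<epsilon>_epi f'(1)]], rule exI[of _ \<pi>], intro conjI ballI allI impI)
    show "epimorphism L' ?B A' \<pi>" by (rule \<pi>_epi)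
    show "\<exists>D\<in>\<F>. \<exists>\<phi>3 \<phi>4. epimorphism L' D C1 \<phi>3 \<and> epimorphism L' D C2 \<phi>4 \<and>
        (\<forall>x\<in>Carrier D. \<pi> (\<phi>1 (\<phi>3 x)) = \<pi> (\<phi>2 (\<phi>4 x)))"
      if "C1 \<in> \<F>" "C2 \<in> \<F>" "epimorphism L' C1 ?B \<phi>1 \<and> epimorphism L' C2 ?B \<phi>2" for C1 C2 \<phi>1 \<phi>2
      by (rule amalg[OF that(1,2) that(3)[THEN conjunct1] that(3)[THEN conjunct2]])
  qed
qed

lemma JPP_WAP_iff_comeager:
  "JPP L' \<F> \<and> WAP L' \<F> \<longleftrightarrow>
    (\<exists>h\<in>H. comeager_in (subtopology (Aut_topology L P) H) (orbit \<Gamma> (conj_action \<Gamma>) h))"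
proof
  assume "JPP L' \<F> \<and> WAP L' \<F>"
  then have CS.transitive CS.locally_transitive
    using JPP_imp_transitive WAP_imp_locally_transitive by simp_all
  then show "\<exists>h\<in>H. comeager_in (subtopology (Aut_topology L P) H) (orbit \<Gamma> (conj_action \<Gamma>) h)"
    unfolding Aut_topology_eq by (rule CS.transitive_imp_comeager_orbit)
next
  assume "\<exists>h\<in>H. comeager_in (subtopology (Aut_topology L P) H) (orbit \<Gamma> (conj_action \<Gamma>) h)"
  then obtain h where h: "h \<in> H" "comeager_in CS.X (orbit \<Gamma> (conj_action \<Gamma>) h)"
    unfolding Aut_topology_eq by auto
  show "JPP L' \<F> \<and> WAP L' \<F>"
    using transitive_imp_JPP[OF CS.comeager_orbit_imp_transitive(1)[OF h]]
      locally_transitive_imp_WAP[OF CS.comeager_orbit_imp_transitive(2)[OF h]] by simp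
qed

end

theorem theoremA2:
  fixes L0 :: "('f, 'r) language"
    and G :: "('a, 'f, 'r) lstruct set"
    and P :: "('p, 'f, 'r) lstruct"
    and H :: "('p \<Rightarrow> 'p) set"
    and s :: 'r
  assumes "projective_Fraisse_family L0 G"
    and "countable_family L0 G"
    and "projective_Fraisse_limit L0 G P"
    and "closedin (Aut_topology L0 P) H"
    and "H \<noteq> {}"
    and "\<forall>g\<in>Aut L0 P. \<forall>h\<in>H. conj_action (Aut_group L0 P) g h \<in> H"
    and "s \<notin> rels L0"
  shows "JPP (expand_language L0 s) (induced_family L0 s G P H) \<and>
         WAP (expand_language L0 s) (induced_family L0 s G P H) \<longleftrightarrow>
         (\<exists>h\<in>H. comeager_in (subtopology (Aut_topology L0 P) H)
                  (orbit (Aut_group L0 P) (conj_action (Aut_group L0 P)) h))"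
proof -
  interpret fraisse_limit L0 G P
    using assms(1,3) by unfold_locales (simp_all add: projective_Fraisse_family_def)
  obtain E \<epsilon> where E: "\<forall>n. E n \<in> G \<and> epimorphism L0 P (E n) (\<epsilon> n) \<and> finer (\<epsilon> (Suc n)) (\<epsilon> n)"
    "\<forall>K. openin (Top P) K \<and> closedin (Top P) K \<longrightarrow> (\<exists>n. finer (\<epsilon> n) (\<lambda>x. x \<in> K))"
    using ex_cofinal_sequence by (elim exE conjE)
  interpret induced_setting L0 G P E \<epsilon> H s
    using E assms(4-7) by unfold_locales simp_all
  show ?thesis by (rule JPP_WAP_iff_comeager)
qed

end
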